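(* Let $G$ be a real Lie group with Lie algebra $\mathfrak{g}$ and $E$ a countable set with a coding map $c\colon E\to G$, $e\mapsto g_e$. Suppose that a Markov chain on $E$ is irreducible and recurrent and let $e\in E$. (i) If the Markov chain is $e$-expanding, then $\mathrm{Ad}_*\mu_e$ is uniformly expanding on Grassmannians. (ii) Suppose the Markov chain is additionally positive recurrent, with stationary distribution $\pi$, and that $c_*\pi$ has a finite first moment in $\mathfrak{g}$. Then the Markov chain is $e$-expanding if and only if $\mathrm{Ad}_*\mu_e$ is uniformly expanding on Grassmannians.
   Context: Markov chain notation: $\mathbb{P}_e$ is the Markov measure on $\Omega=E^{\mathbb{N}}$ (indices from $0$) started at $\omega_0=e$, with expectation $\mathbb{E}_e$; $\tau_e(\omega)=\inf\{n\ge1:\omega_n=e\}$. Irreducible: $\mathbb{P}_e[\tau_{e'}<\infty]>0$ for all $e,e'$. Recurrent: $\mathbb{P}_e[\tau_e<\infty]=1$ for all $e$. Positive recurrent: $\mathbb{E}_e[\tau_e]<\infty$ for all $e$. For $\omega\in\Omega$, $g_{\omega|_n}=g_{\omega_{n-1}}\cdots g_{\omega_0}$. The renewal measure $\mu_e$ is the law on $G$ of $g_{\omega|_{\tau_e}}$ under $\mathbb{P}_e$. Fix a norm on $\mathfrak{g}$ and on its exterior powers. $c_*\pi$ has a finite first moment in $\mathfrak{g}$ if $\sum_{e'\in E}\log N(g_{e'})\,\pi(\{e'\})<\infty$, where $N(g)=\max(\|\mathrm{Ad}(g)\|,\|\mathrm{Ad}(g)^{-1}\|)$. $e$-expanding: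 for every $1\le k\le\dim(G)-1$ and every non-zero pure wedge product $v\in\mathfrak{g}^{\wedge k}$, $\liminf_{n\to\infty}\frac1n\log\|\mathrm{Ad}^{\wedge k}(g_{\omega|_n})v\|>0$ for $\mathbb{P}_e$-a.e. $\omega$. For a probability measure $\mu$ on $G$, $\mathrm{Ad}_*\mu$ is uniformly expanding on Grassmannians if for every $1\le k\le\dim(G)-1$ and every non-zero pure wedge product $v\in\mathfrak{g}^{\wedge k}$, for $\mu^{\otimes\mathbb{N}}$-a.e. $b=(b_m)_{m\ge0}\in G^{\mathbb{N}}$, $\liminf_{n\to\infty}\frac1n\log\|\mathrm{Ad}^{\wedge k}(b_{n-1}\cdots b_0)v\|>0$. *)

theory Defs
  imports "HOL-Probability.Probability" "HOL-Algebra.Group"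
begin

section \<open>Lie groups and the adjoint representation\<close>

text \<open>
  \<^term>\<open>C_diff n S f\<close> is meant for open sets \<^term>\<open>S\<close> of a finite-dimensional normed space. There,
  continuity of every directional derivative amounts to continuity of the derivative, so this is
  the usual class of \<open>n\<close> times continuously differentiable functions.
\<close>

primrec C_diff ::
    "nat \<Rightarrow> 'a::real_normed_vector set \<Rightarrow> ('a \<Rightarrow> 'b::real_normed_vector) \<Rightarrow> bool" where
  "C_diff 0 S f \<longleftrightarrow> continuous_on S f"
| "C_diff (Suc n) S f \<longleftrightarrow>
     (\<forall>x\<in>S. f differentiable (at x)) \<and> (\<forall>v. C_diff n S (\<lambda>x. frechet_derivative f (at x) v))"

definition smooth_on ::
    "'a::real_normed_vector set \<Rightarrow> ('a \<Rightarrow> 'b::real_normed_vector) \<Rightarrow> bool" where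
  "smooth_on S f \<longleftrightarrow> (\<forall>n. C_diff n S f)"

text \<open>
  A real Lie group: a group, a topology on its carrier, and a smooth atlas \<open>A\<close> whose charts
  \<open>(U, \<phi>)\<close> take values in the model space \<open>'a\<close>, a finite-dimensional real vector space with an
  arbitrary norm. (The class \<open>euclidean_space\<close> would exclude dimension zero.)
\<close>

locale lie_group =
  fixes G :: "('g, 'm) monoid_scheme" (structure)
    and T :: "'g topology"
    and A :: "('g set \<times> ('g \<Rightarrow> 'a::real_normed_vector)) set"
  assumes group: "group G"
    and topspace: "topspace T = carrier G"
    and Hausdorff: "Hausdorff_space T"
    and second_countable: "second_countable T"
    and finite_dim: "\<exists>B::'a set. finite B \<and> span B = UNIV"
    and chart: "\<And>U \<phi>. (U, \<phi>) \<in> A \<Longrightarrow>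
      openin T U \<and> open (\<phi> ` U) \<and>
      homeomorphic_map (subtopology T U) (top_of_set (\<phi> ` U)) \<phi>"
    and charts_cover: "(\<Union>(U, \<phi>)\<in>A. U) = carrier G"
    and transition_smooth: "\<And>U \<phi> V \<psi>. (U, \<phi>) \<in> A \<Longrightarrow> (V, \<psi>) \<in> A \<Longrightarrow>
      smooth_on (\<phi> ` (U \<inter> V)) (\<lambda>s. \<psi> (inv_into U \<phi> s))"
    and mult_continuous: "continuous_map (prod_topology T T) T (\<lambda>(x, y). x \<otimes> y)"
    and mult_smooth: "\<And>U \<phi> V \<psi> W \<rho>. (U, \<phi>) \<in> A \<Longrightarrow> (V, \<psi>) \<in> A \<Longrightarrow> (W, \<rho>) \<in> A \<Longrightarrow>
      smooth_on {(\<phi> x, \<psi> y) | x y. x \<in> U \<and> y \<in> V \<and> x \<otimes> y \<in> W}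
        (\<lambda>(s, t). \<rho> (inv_into U \<phi> s \<otimes> inv_into V \<psi> t))"
    and inv_continuous: "continuous_map T T (\<lambda>x. m_inv G x)"
    and inv_smooth: "\<And>U \<phi> W \<rho>. (U, \<phi>) \<in> A \<Longrightarrow> (W, \<rho>) \<in> A \<Longrightarrow>
      smooth_on {\<phi> x | x. x \<in> U \<and> m_inv G x \<in> W} (\<lambda>s. \<rho> (m_inv G (inv_into U \<phi> s)))"

text \<open>
  A chart \<open>(U, \<phi>)\<close> around the identity identifies the Lie algebra, i.e. the tangent space at the
  identity, with \<open>'a\<close>. In these coordinates, \<open>Ad(g)\<close> is the derivative at the identity of the
  conjugation by \<open>g\<close>.
\<close>

definition Ad ::
    "('g, 'm) monoid_scheme \<Rightarrow> 'g set \<Rightarrow> ('g \<Rightarrow> 'a::real_normed_vector) \<Rightarrow> 'g \<Rightarrow> 'a \<Rightarrow> 'a" where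
  "Ad G U \<phi> g = frechet_derivative
     (\<lambda>s. \<phi> (g \<otimes>\<^bsub>G\<^esub> inv_into U \<phi> s \<otimes>\<^bsub>G\<^esub> m_inv G g)) (at (\<phi> \<one>\<^bsub>G\<^esub>))"

definition Ad_size ::
    "('g, 'm) monoid_scheme \<Rightarrow> 'g set \<Rightarrow> ('g \<Rightarrow> 'a::real_normed_vector) \<Rightarrow> 'g \<Rightarrow> real" where
  "Ad_size G U \<phi> g = max (onorm (Ad G U \<phi> g)) (onorm (inv_into UNIV (Ad G U \<phi> g)))"

primrec left_prod :: "('g, 'm) monoid_scheme \<Rightarrow> (nat \<Rightarrow> 'g) \<Rightarrow> nat \<Rightarrow> 'g" where
  "left_prod G b 0 = \<one>\<^bsub>G\<^esub>"
| "left_prod G b (Suc n) = b n \<otimes>\<^bsub>G\<^esub> left_prod G b n"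


section \<open>Exterior powers\<close>

text \<open>
  The exterior powers of a real vector space \<open>V\<close> are realised inside the duals of the spaces of
  alternating multilinear forms: \<open>v\<^sub>1 \<and> \<dots> \<and> v\<^sub>k\<close> is the evaluation of such forms at
  \<open>(v\<^sub>1, \<dots>, v\<^sub>k)\<close>. An element of \<open>altform\<close> is a family of alternating \<open>k\<close>-linear forms, one for
  each \<open>k\<close>, with the degree given by the length of the argument list.
\<close>

definition alternating_form :: "('a::real_vector list \<Rightarrow> real) \<Rightarrow> bool" where
  "alternating_form \<alpha> \<longleftrightarrow>
     (\<forall>us ws. linear (\<lambda>v. \<alpha> (us @ v # ws))) \<and>
     (\<forall>us v ws zs. \<alpha> (us @ v # ws @ v # zs) = 0)"

typedef (overloaded) 'a altform = "{\<alpha> :: 'a::real_vector list \<Rightarrow> real. alternating_form \<alpha>}"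
  morphisms form_apply Altform
  by (rule exI[of _ "\<lambda>_. 0"]) (simp add: alternating_form_def linear_iff)

typedef (overloaded) 'a multivector = "UNIV :: ('a::real_vector altform \<Rightarrow> real) set"
  morphisms pairing Multivector
  by simp

lemma multivector_eqI: "(\<And>\<alpha>. pairing x \<alpha> = pairing y \<alpha>) \<Longrightarrow> x = y"
  by (metis ext pairing_inject)

instantiation multivector :: (real_vector) real_vector
begin

definition "0 = Multivector (\<lambda>_. 0)"
definition "x + y = Multivector (\<lambda>\<alpha>. pairing x \<alpha> + pairing y \<alpha>)"
definition "x - y = Multivector (\<lambda>\<alpha>. pairing x \<alpha> - pairing y \<alpha>)"
definition "- x = Multivector (\<lambda>\<alpha>. - pairing x \<alpha>)"
definition "r *\<^sub>R x = Multivector (\<lambda>\<alpha>. r * pairing x \<alpha>)"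

lemma pairing_simps [simp]:
  "pairing 0 \<alpha> = 0"
  "pairing (x + y) \<alpha> = pairing x \<alpha> + pairing y \<alpha>"
  "pairing (x - y) \<alpha> = pairing x \<alpha> - pairing y \<alpha>"
  "pairing (- x) \<alpha> = - pairing x \<alpha>"
  "pairing (r *\<^sub>R x) \<alpha> = r * pairing x \<alpha>"
  by (simp_all add: zero_multivector_def plus_multivector_def minus_multivector_def
      uminus_multivector_def scaleR_multivector_def Multivector_inverse)

instance
  by standard (auto intro!: multivector_eqI simp: algebra_simps)

end

definition wedge :: "'a::real_vector list \<Rightarrow> 'a multivector" where
  "wedge vs = Multivector (\<lambda>\<alpha>. form_apply \<alpha> vs)"

definition pure_wedges :: "nat \<Rightarrow> 'a::real_vector multivector set" where
  "pure_wedges k = wedge ` {vs. length vs = k}"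

definition exterior_power :: "nat \<Rightarrow> 'a::real_vector multivector set" where
  "exterior_power k = span (pure_wedges k)"

definition exterior_map ::
    "('a::real_vector \<Rightarrow> 'a) \<Rightarrow> 'a multivector \<Rightarrow> 'a multivector" where
  "exterior_map L x = Multivector (\<lambda>\<alpha>. pairing x (Altform (\<lambda>vs. form_apply \<alpha> (map L vs))))"

definition norm_on :: "'v::real_vector set \<Rightarrow> ('v \<Rightarrow> real) \<Rightarrow> bool" where
  "norm_on S nrm \<longleftrightarrow>
     (\<forall>x\<in>S. 0 \<le> nrm x \<and> (nrm x = 0 \<longleftrightarrow> x = 0)) \<and>
     (\<forall>x\<in>S. \<forall>r. nrm (r *\<^sub>R x) = \<bar>r\<bar> * nrm x) \<and>
     (\<forall>x\<in>S. \<forall>y\<in>S. nrm (x + y) \<le> nrm x + nrm y)"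

lemma pairing_wedge [simp]: "pairing (wedge vs) \<alpha> = form_apply \<alpha> vs"
  by (simp add: wedge_def Multivector_inverse)

lemma alternating_form_apply: "alternating_form (form_apply \<alpha>)"
  using form_apply[of \<alpha>] by simp

lemma form_apply_linear: "linear (\<lambda>v. form_apply \<alpha> (us @ v # ws))"
  and form_apply_repeated [simp]: "form_apply \<alpha> (us @ v # ws @ v # zs) = 0"
  using alternating_form_apply[of \<alpha>] by (auto simp: alternating_form_def)

lemma linear_wedge: "linear (\<lambda>v. wedge (us @ v # ws))"
  using form_apply_linear[of _ us ws]
  by (auto simp: linear_iff intro!: multivector_eqI)

lemma wedge_repeated: "wedge (us @ v # ws @ v # zs) = 0"
  by (rule multivector_eqI) simp

lemma exterior_power_universal:
  assumes "alternating_form \<alpha>"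
  shows "\<exists>f. linear f \<and> (\<forall>vs. f (wedge vs) = \<alpha> vs)"
  using assms
  by (intro exI[of _ "\<lambda>x. pairing x (Altform \<alpha>)"]) (auto simp: linear_iff Altform_inverse)

lemma linear_exterior_map: "linear (exterior_map L)"
  by (auto simp: linear_iff exterior_map_def Multivector_inverse intro!: multivector_eqI)

lemma exterior_map_wedge:
  assumes "linear L"
  shows "exterior_map L (wedge vs) = wedge (map L vs)"
proof (rule multivector_eqI)
  fix \<alpha> :: "'a altform"
  have "alternating_form (\<lambda>vs. form_apply \<alpha> (map L vs))"
    using alternating_form_apply[of \<alpha>] linear_compose[OF assms]
    by (auto simp: alternating_form_def o_def)
  then show "pairing (exterior_map L (wedge vs)) \<alpha> = pairing (wedge (map L vs)) \<alpha>"
    by (simp add: exterior_map_def Multivector_inverse Altform_inverse)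
qed


section \<open>Markov chains\<close>

text \<open>
  A Markov chain on \<open>E\<close> is given by its transition kernel. Its law on the space of trajectories
  is provided by the theorem of Ionescu Tulcea.
\<close>

definition markov_step ::
    "('e \<Rightarrow> 'e pmf) \<Rightarrow> 'e \<Rightarrow> nat \<Rightarrow> (nat \<Rightarrow> 'e) \<Rightarrow> 'e measure" where
  "markov_step K e n \<omega> = measure_pmf (case n of 0 \<Rightarrow> return_pmf e | Suc m \<Rightarrow> K (\<omega> m))"

lemma Ionescu_Tulcea_markov_step:
  "Ionescu_Tulcea (markov_step K (e::'e::countable)) (\<lambda>_. count_space UNIV)"
proof (rule Ionescu_Tulcea.intro)
  fix i :: nat
  show "markov_step K e i \<in>
      PiM {0..<i} (\<lambda>_. count_space UNIV) \<rightarrow>\<^sub>M subprob_algebra (count_space UNIV)"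
  proof (cases i)
    case 0
    then show ?thesis
      by (auto simp: markov_step_def[abs_def] space_subprob_algebra
          intro!: measurable_const measure_pmf.subprob_space_axioms)
  next
    case (Suc m)
    have "(\<lambda>\<omega>. \<omega> m) \<in> PiM {0..<i} (\<lambda>_. count_space (UNIV::'e set)) \<rightarrow>\<^sub>M count_space UNIV"
      using Suc by (intro measurable_component_singleton) auto
    moreover have "(\<lambda>e. measure_pmf (K e)) \<in> count_space UNIV \<rightarrow>\<^sub>M subprob_algebra (count_space UNIV)"
      by (auto simp: space_subprob_algebra intro!: measure_pmf.subprob_space_axioms)
    ultimately show ?thesis
      using Suc by (auto simp: markov_step_def[abs_def] intro: measurable_compose)
  qed
  fix x :: "nat \<Rightarrow> 'e"
  show "prob_space (markov_step K e i x)"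
    by (simp add: markov_step_def measure_pmf.prob_space_axioms)
qed

global_interpretation markov:
  Ionescu_Tulcea "markov_step K e" "\<lambda>_. count_space (UNIV :: 'e set)"
  for K :: "'e::countable \<Rightarrow> 'e pmf" and e :: 'e
  by (rule Ionescu_Tulcea_markov_step)

definition markov_measure ::
    "('e::countable \<Rightarrow> 'e pmf) \<Rightarrow> 'e \<Rightarrow> (nat \<Rightarrow> 'e) measure" where
  "markov_measure K e = markov.PF.lim K e"

lemma sets_markov_measure:
  "sets (markov_measure K e) = sets (PiM UNIV (\<lambda>_. count_space UNIV))"
  by (simp add: markov_measure_def)

lemma space_markov_measure: "space (markov_measure K e) = UNIV"
  using sets_eq_imp_space_eq[OF sets_markov_measure] by (simp add: space_PiM)

lemma emeasure_markov_C:
  fixes K :: "'e::countable \<Rightarrow> 'e pmf" and x :: "nat \<Rightarrow> 'e"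
  shows "emeasure (markov.C K e 0 n (\<lambda>_. undefined)) {restrict x {0..<n}} =
    (\<Prod>i<n. ennreal (pmf (case i of 0 \<Rightarrow> return_pmf e | Suc j \<Rightarrow> K (x j)) (x i)))"
proof (induction n)
  case 0
  then show ?case
    by (simp add: PiM_empty restrict_def space_PiM)
next
  case (Suc n)
  let ?M = "\<lambda>n. PiM {0..<n} (\<lambda>_. count_space (UNIV :: 'e set))"
  let ?u = "\<lambda>_. undefined :: 'e"
  let ?q = "ennreal (pmf (case n of 0 \<Rightarrow> return_pmf e | Suc j \<Rightarrow> K (x j)) (x n))"
  have sets_single: "{restrict x {0..<m}} \<in> sets (?M m)" for m
  proof -
    have "{restrict x {0..<m}} = PiE {0..<m} (\<lambda>i. {x i})"
      by (auto simp: PiE_iff extensional_def restrict_def fun_eq_iff)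
    then show ?thesis
      by (simp add: sets_PiM_I_finite)
  qed
  have u: "?u \<in> space (?M 0)"
    by (simp add: space_PiM PiE_iff extensional_def)
  have step: "emeasure (markov.eP K e n y) {restrict x {0..<Suc n}} =
      ?q * indicator {restrict x {0..<n}} y" if y: "y \<in> space (?M n)" for y
  proof -
    have ext: "y \<in> extensional {0..<n}"
      using y by (auto simp: space_PiM PiE_def)
    have vim: "(\<lambda>z. y(n := z)) -` {restrict x {0..<Suc n}} =
        (if y = restrict x {0..<n} then {x n} else {})"
    proof (cases "y = restrict x {0..<n}")
      case True
      then show ?thesis
        by (auto simp: fun_eq_iff restrict_def less_Suc_eq) metis
    next
      case False
      then obtain i where i: "i < n" "y i \<noteq> x i"
        using ext by (auto simp: fun_eq_iff restrict_def extensional_def split: if_splits)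
      have "y(n := z) \<noteq> restrict x {0..<Suc n}" for z
      proof
        assume "y(n := z) = restrict x {0..<Suc n}"
        then have "(y(n := z)) i = restrict x {0..<Suc n} i" by simp
        with i show False by simp
      qed
      with False show ?thesis by auto
    qed
    have "emeasure (markov.eP K e n y) {restrict x {0..<Suc n}} =
        emeasure (markov_step K e n y) ((\<lambda>z. y(n := z)) -` {restrict x {0..<Suc n}})"
      using markov.emeasure_eP[OF y sets_single[of "Suc n"]] by simp
    also have "\<dots> = ?q * indicator {restrict x {0..<n}} y"
      unfolding vim
      by (cases n) (auto simp: markov_step_def emeasure_pmf_single split: split_indicator)
    finally show ?thesis .
  qed
  have C_sets: "sets (markov.C K e 0 n ?u) = sets (?M n)"
    using markov.sets_C[OF u, of K e n] by simp
  have C_space: "space (markov.C K e 0 n ?u) = space (?M n)"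
    by (rule sets_eq_imp_space_eq[OF C_sets])
  have "emeasure (markov.C K e 0 (Suc n) ?u) {restrict x {0..<Suc n}} =
      (\<integral>\<^sup>+ y. emeasure (markov.eP K e n y) {restrict x {0..<Suc n}} \<partial>markov.C K e 0 n ?u)"
    using markov.measurable_eP[of K e n] sets_single[of "Suc n"] markov.non_empty
    by (simp, subst emeasure_bind[where N = "?M (Suc n)"])
      (auto simp: C_space measurable_cong_sets[OF C_sets refl] space_PiM)
  also have "\<dots> = (\<integral>\<^sup>+ y. ?q * indicator {restrict x {0..<n}} y \<partial>markov.C K e 0 n ?u)"
    by (intro nn_integral_cong step) (simp add: C_space)
  also have "\<dots> = ?q * emeasure (markov.C K e 0 n ?u) {restrict x {0..<n}}"
    using sets_single[of n] by (subst nn_integral_cmult_indicator) (auto simp: C_sets)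
  finally show ?case
    unfolding Suc.IH by (simp only: prod.lessThan_Suc mult.commute)
qed

lemma emeasure_markov_measure_cylinder:
  fixes K :: "'e::countable \<Rightarrow> 'e pmf"
  shows "emeasure (markov_measure K e) {\<omega>. \<forall>i\<le>n. \<omega> i = x i} =
    (if x 0 = e then \<Prod>i<n. ennreal (pmf (K (x i)) (x (Suc i))) else 0)"
proof -
  let ?J = "{0..<Suc n}"
  let ?M = "\<lambda>_::nat. count_space (UNIV :: 'e set)"
  have single: "{restrict x ?J} = PiE ?J (\<lambda>i. {x i})"
    by (auto simp: PiE_iff extensional_def restrict_def fun_eq_iff)
  then have sets: "{restrict x ?J} \<in> sets (PiM ?J ?M)"
    by (simp only: single) (simp add: sets_PiM_I_finite)
  have "{\<omega>. \<forall>i\<le>n. \<omega> i = x i} = prod_emb UNIV ?M ?J {restrict x ?J}"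
    by (auto simp: prod_emb_def fun_eq_iff restrict_def space_PiM less_Suc_eq_le) metis
  then have "emeasure (markov_measure K e) {\<omega>. \<forall>i\<le>n. \<omega> i = x i} =
      emeasure (markov.CI K e ?J) {restrict x ?J}"
    using markov.lim[OF _ sets] by (simp add: markov_measure_def)
  also have "\<dots> = emeasure (markov.C K e 0 (Suc n) (\<lambda>_. undefined))
      (prod_emb ?J ?M ?J {restrict x ?J})"
    by (rule markov.emeasure_CI[OF order_refl sets])
  also have "prod_emb ?J ?M ?J {restrict x ?J} = {restrict x ?J}"
    by (auto simp: prod_emb_def space_PiM PiE_iff extensional_restrict)
  finally show ?thesis
    unfolding emeasure_markov_C prod.lessThan_Suc_shift by simp
qed

definition return_time :: "'e \<Rightarrow> (nat \<Rightarrow> 'e) \<Rightarrow> enat" where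
  "return_time e \<omega> = Inf (enat ` {n. 1 \<le> n \<and> \<omega> n = e})"

definition markov_irreducible :: "('e::countable \<Rightarrow> 'e pmf) \<Rightarrow> bool" where
  "markov_irreducible K \<longleftrightarrow>
     (\<forall>e e'. 0 < \<P>(\<omega> in markov_measure K e. return_time e' \<omega> < \<infinity>))"

definition markov_recurrent :: "('e::countable \<Rightarrow> 'e pmf) \<Rightarrow> bool" where
  "markov_recurrent K \<longleftrightarrow> (\<forall>e. \<P>(\<omega> in markov_measure K e. return_time e \<omega> < \<infinity>) = 1)"

definition positive_recurrent :: "('e::countable \<Rightarrow> 'e pmf) \<Rightarrow> bool" where
  "positive_recurrent K \<longleftrightarrow>
     (\<forall>e. (\<integral>\<^sup>+ \<omega>. ennreal_of_enat (return_time e \<omega>) \<partial>markov_measure K e) < \<infinity>)"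

definition stationary :: "('e \<Rightarrow> 'e pmf) \<Rightarrow> 'e pmf \<Rightarrow> bool" where
  "stationary K \<pi> \<longleftrightarrow> bind_pmf \<pi> K = \<pi>"


section \<open>Random products\<close>

definition borel_of :: "'g topology \<Rightarrow> 'g measure" where
  "borel_of T = sigma (topspace T) {U. openin T U}"

text \<open>The value of \<^const>\<open>the_enat\<close> at infinity is irrelevant for a recurrent chain.\<close>

definition renewal_measure ::
    "('g, 'm) monoid_scheme \<Rightarrow> 'g topology \<Rightarrow> ('e::countable \<Rightarrow> 'e pmf) \<Rightarrow> ('e \<Rightarrow> 'g) \<Rightarrow> 'e \<Rightarrow> 'g measure"
  where
  "renewal_measure G T K c e = distr (markov_measure K e) (borel_of T)
     (\<lambda>\<omega>. left_prod G (\<lambda>i. c (\<omega> i)) (the_enat (return_time e \<omega>)))"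

text \<open>The growth rate of \<open>Ad(b\<^bsub>n-1\<^esub> \<cdots> b\<^sub>0) v\<close> for \<open>v\<close> in the \<open>k\<close>-th exterior power.\<close>

definition wedge_growth ::
    "('g, 'm) monoid_scheme \<Rightarrow> 'g set \<Rightarrow> ('g \<Rightarrow> 'a::real_normed_vector) \<Rightarrow>
     (nat \<Rightarrow> 'a multivector \<Rightarrow> real) \<Rightarrow> nat \<Rightarrow> (nat \<Rightarrow> 'g) \<Rightarrow> 'a multivector \<Rightarrow> ereal" where
  "wedge_growth G U \<phi> nrm k b v = liminf (\<lambda>n. ereal
     (1 / real n * ln (nrm k (exterior_map (Ad G U \<phi> (left_prod G b n)) v))))"

definition e_expanding ::
    "('g, 'm) monoid_scheme \<Rightarrow> 'g set \<Rightarrow> ('g \<Rightarrow> 'a::real_normed_vector) \<Rightarrow>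
     (nat \<Rightarrow> 'a multivector \<Rightarrow> real) \<Rightarrow> ('e::countable \<Rightarrow> 'e pmf) \<Rightarrow> ('e \<Rightarrow> 'g) \<Rightarrow> 'e \<Rightarrow> bool" where
  "e_expanding G U \<phi> nrm K c e \<longleftrightarrow>
     (\<forall>k. 1 \<le> k \<and> k \<le> dim (UNIV :: 'a set) - 1 \<longrightarrow>
       (\<forall>v \<in> pure_wedges k - {0}. AE \<omega> in markov_measure K e.
          0 < wedge_growth G U \<phi> nrm k (\<lambda>i. c (\<omega> i)) v))"

definition uniformly_expanding ::
    "('g, 'm) monoid_scheme \<Rightarrow> 'g set \<Rightarrow> ('g \<Rightarrow> 'a::real_normed_vector) \<Rightarrow>
     (nat \<Rightarrow> 'a multivector \<Rightarrow> real) \<Rightarrow> 'g measure \<Rightarrow> bool" where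
  "uniformly_expanding G U \<phi> nrm \<mu> \<longleftrightarrow>
     (\<forall>k. 1 \<le> k \<and> k \<le> dim (UNIV :: 'a set) - 1 \<longrightarrow>
       (\<forall>v \<in> pure_wedges k - {0}. AE b in PiM (UNIV :: nat set) (\<lambda>_. \<mu>).
          0 < wedge_growth G U \<phi> nrm k b v))"

text \<open>
  The summands are nonnegative: the submultiplicativity of the operator norm gives
  \<open>Ad_size G U \<phi> g \<ge> 1\<close> (and \<open>ln 0 = 0\<close> when the dimension is zero).
\<close>

definition finite_first_moment ::
    "('g, 'm) monoid_scheme \<Rightarrow> 'g set \<Rightarrow> ('g \<Rightarrow> 'a::real_normed_vector) \<Rightarrow>
     ('e \<Rightarrow> 'g) \<Rightarrow> 'e pmf \<Rightarrow> bool" where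
  "finite_first_moment G U \<phi> c \<pi> \<longleftrightarrow>
     (\<lambda>e. ln (Ad_size G U \<phi> (c e)) * pmf \<pi> e) summable_on UNIV"

end

theory Submission
  imports Defs
begin

text \<open>
  By the Markov property, the excursions of the chain from \<^term>\<open>e\<close> are independent with a common
  law, so that \<open>\<mu>\<^sub>e\<^sup>\<otimes>\<^sup>\<nat>\<close> is the law of the sequence of the products along the excursions,
  and the product of the first \<open>m\<close> of them is \<open>g\<close> along the path up to the \<open>m\<close>-th return time
  \<open>\<tau>\<^sub>m \<ge> m\<close>. Linear growth along all times therefore gives linear growth along the returns.
  Conversely, let \<open>Z\<^sub>m\<close> be the sum of \<open>log N\<close> over the \<open>m\<close>-th excursion. Within this excursion
  the norm of the image of a wedge product drops by at most the factor \<open>C exp (k Z\<^sub>m)\<close>. The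
  expected visits during an excursion are at most \<open>\<pi> / \<pi>(e)\<close>, hence \<open>Z\<^sub>m\<close> is integrable and
  \<open>Z\<^sub>m = o(m)\<close> almost surely by Borel-Cantelli, while \<open>\<tau>\<^sub>m = O(m)\<close> by the maximal ergodic
  inequality. So linear growth at the return times persists in between.
\<close>

section \<open>Orbit sums of measure preserving maps\<close>

lemma PiM_distr_seq:
  assumes "prob_space q" and f: "f \<in> q \<rightarrow>\<^sub>M N"
  shows "PiM UNIV (\<lambda>_::nat. distr q N f) =
    distr (PiM UNIV (\<lambda>_. q)) (PiM UNIV (\<lambda>_. N)) (\<lambda>w i. f (w i))"
proof (rule measure_eqI_PiM_infinite[where M = "\<lambda>_. N" and I = UNIV])
  interpret q: prob_space q by fact
  have fq: "prob_space (distr q N f)"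
    using f by (rule q.prob_space_distr)
  have map[measurable]: "(\<lambda>w i. f (w i)) \<in> PiM UNIV (\<lambda>_::nat. q) \<rightarrow>\<^sub>M PiM UNIV (\<lambda>_. N)"
    using f by (intro measurable_PiM_single') (auto simp: space_PiM PiE_iff intro: measurable_space)
  show sets: "sets (PiM UNIV (\<lambda>_::nat. distr q N f)) = sets (PiM UNIV (\<lambda>_. N))"
    by (intro sets_PiM_cong) auto
  show "sets (distr (PiM UNIV (\<lambda>_::nat. q)) (PiM UNIV (\<lambda>_. N)) (\<lambda>w i. f (w i))) = sets (PiM UNIV (\<lambda>_. N))"
    by simp
  show "finite_measure (PiM UNIV (\<lambda>_::nat. distr q N f))"
    using fq by (intro prob_space.finite_measure prob_space_PiM) auto
  fix A :: "nat \<Rightarrow> _" and J :: "nat set"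
  assume J: "finite J" "J \<subseteq> UNIV" and A: "\<And>i. i \<in> J \<Longrightarrow> A i \<in> sets N"
  have "emeasure (PiM UNIV (\<lambda>_::nat. distr q N f)) (prod_emb UNIV (\<lambda>_. N) J (Pi\<^sub>E J A)) =
      emeasure (PiM UNIV (\<lambda>_::nat. distr q N f)) (prod_emb UNIV (\<lambda>_. distr q N f) J (Pi\<^sub>E J A))"
    by (simp add: prod_emb_def)
  also have "\<dots> = (\<Prod>i\<in>J. emeasure (distr q N f) (A i))"
    using fq J A by (intro emeasure_PiM_emb) auto
  also have "\<dots> = (\<Prod>i\<in>J. emeasure q (f -` A i \<inter> space q))"
    using A f by (intro prod.cong refl emeasure_distr) auto
  also have "\<dots> = emeasure (PiM UNIV (\<lambda>_::nat. q))
      (prod_emb UNIV (\<lambda>_. q) J (PiE J (\<lambda>i. f -` A i \<inter> space q)))"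
    using A f J \<open>prob_space q\<close> by (intro emeasure_PiM_emb[symmetric]) auto
  also have "prod_emb UNIV (\<lambda>_. q) J (PiE J (\<lambda>i. f -` A i \<inter> space q)) =
      (\<lambda>w i. f (w i)) -` prod_emb UNIV (\<lambda>_. N) J (Pi\<^sub>E J A) \<inter> space (PiM UNIV (\<lambda>_::nat. q))"
    using f[THEN measurable_space] by (auto simp: prod_emb_def space_PiM PiE_iff extensional_def restrict_def)
  also have "emeasure (PiM UNIV (\<lambda>_::nat. q)) \<dots> =
      emeasure (distr (PiM UNIV (\<lambda>_. q)) (PiM UNIV (\<lambda>_. N)) (\<lambda>w i. f (w i)))
        (prod_emb UNIV (\<lambda>_. N) J (Pi\<^sub>E J A))"
    using J A by (intro emeasure_distr[symmetric] map) (auto intro: sets_PiM_I)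
  finally show "emeasure (PiM UNIV (\<lambda>_::nat. distr q N f)) (prod_emb UNIV (\<lambda>_. N) J (Pi\<^sub>E J A)) =
      emeasure (distr (PiM UNIV (\<lambda>_. q)) (PiM UNIV (\<lambda>_. N)) (\<lambda>w i. f (w i)))
        (prod_emb UNIV (\<lambda>_. N) J (Pi\<^sub>E J A))" .
qed

lemma distr_PiM_shift:
  assumes "prob_space q"
  shows "distr (PiM UNIV (\<lambda>_::nat. q)) (PiM UNIV (\<lambda>_. q)) (\<lambda>w i. w (Suc i)) = PiM UNIV (\<lambda>_. q)"
  using distr_PiM_reindex[of UNIV "\<lambda>_. q" Suc UNIV] assms by (simp add: restrict_UNIV)

context
  fixes M :: "'b measure" and T :: "'b \<Rightarrow> 'b"
  assumes M: "prob_space M"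
    and T[measurable]: "T \<in> M \<rightarrow>\<^sub>M M" and invariant: "distr M M T = M"
begin

interpretation prob_space M by (rule M)

lemma measurable_iterate: "T ^^ i \<in> M \<rightarrow>\<^sub>M M"
  by (induction i) (auto simp: comp_def intro: measurable_compose[OF _ T])

lemma distr_iterate: "distr M M (T ^^ i) = M"
proof (induction i)
  case 0
  show ?case by (simp add: id_def)
next
  case (Suc i)
  have "distr M M (T ^^ Suc i) = distr (distr M M (T ^^ i)) M T"
    using measurable_iterate T by (subst distr_distr) (simp_all add: comp_def)
  with Suc invariant show ?case by (simp add: comp_def)
qed

lemma integrable_comp_invariant: "integrable M g \<Longrightarrow> integrable M (\<lambda>x. g (T x) :: real)"
  using integrable_distr[OF T, of g] invariant by simp

lemma integral_comp_invariant:
  assumes "integrable M g"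
  shows "(\<integral>x. g (T x) \<partial>M) = (\<integral>x. g x \<partial>M :: real)"
  using integral_distr[OF T, of g] invariant borel_measurable_integrable[OF assms] by simp

lemma maximal_ergodic_bound:
  fixes f :: "'b \<Rightarrow> real"
  assumes f: "integrable M f" "\<And>x. 0 \<le> f x" and "0 < l"
  shows "\<exists>A\<in>sets M. (\<forall>x\<in>space M. (\<exists>n. (\<Sum>i<n. f ((T ^^ i) x)) > l * real n) \<longrightarrow> x \<in> A)
    \<and> l * prob A \<le> (\<integral>x. f x \<partial>M)"
proof -
  define P where "P = rec_nat (\<lambda>x. 0 :: real) (\<lambda>n p x. max 0 (f x - l + p (T x)))"
  have P0: "P 0 x = 0" and PSuc: "P (Suc n) x = max 0 (f x - l + P n (T x))" for n x
    by (simp_all add: P_def)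
  have int: "integrable M (P n)" for n
  proof (induction n)
    case 0
    show ?case by (simp add: P_def)
  next
    case (Suc n)
    have eq: "P (Suc n) = (\<lambda>x. max 0 (f x - l + P n (T x)))"
      by (auto simp: PSuc)
    show ?case unfolding eq
      using f(1) integrable_comp_invariant[OF Suc] by (intro integrable_max) simp_all
  qed
  note [measurable] = borel_measurable_integrable[OF int] borel_measurable_integrable[OF f(1)]
  have nonneg: "0 \<le> P n x" for n x
    by (cases n) (auto simp: P0 PSuc)
  have mono: "P n x \<le> P (Suc n) x" for n x
  proof (induction n arbitrary: x)
    case 0
    show ?case using nonneg[of 1 x] by (simp add: P0)
  next
    case (Suc n)
    show ?case using Suc[of "T x"] unfolding PSuc[of "Suc n"] PSuc[of n x] by linarith
  qed
  have sums: "(\<Sum>i<n. f ((T ^^ i) x)) - l * real n \<le> P n x" for n x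
  proof (induction n arbitrary: x)
    case 0
    show ?case by (simp add: P0)
  next
    case (Suc n)
    have "(\<Sum>i<Suc n. f ((T ^^ i) x)) = f x + (\<Sum>i<n. f ((T ^^ i) (T x)))"
      by (simp only: sum.lessThan_Suc_shift) (simp add: funpow_swap1)
    with Suc[of "T x"] show ?case by (simp add: PSuc algebra_simps)
  qed
  define A where "A n = {x \<in> space M. 0 < P n x}" for n
  have A[measurable]: "A n \<in> sets M" for n by (simp add: A_def)
  have bound: "l * prob (A n) \<le> (\<integral>x. f x \<partial>M)" for n
  proof (cases n)
    case 0
    have "A n = {}" using 0 by (simp add: A_def P0)
    then show ?thesis using f by (simp add: integral_nonneg)
  next
    case (Suc m)
    have "0 \<le> (\<integral>x. P n x \<partial>M) - (\<integral>x. P m (T x) \<partial>M)"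
      using integral_comp_invariant[OF int] integral_mono[OF int int mono, of m] Suc by simp
    also have "\<dots> = (\<integral>x. P n x - P m (T x) \<partial>M)"
      by (rule Bochner_Integration.integral_diff[symmetric])
        (auto intro: int integrable_comp_invariant)
    also have "\<dots> \<le> (\<integral>x. (f x - l) * indicator (A n) x \<partial>M)"
    proof (rule integral_mono)
      show "integrable M (\<lambda>x. P n x - P m (T x))"
        by (intro Bochner_Integration.integrable_diff int integrable_comp_invariant)
      show "integrable M (\<lambda>x. (f x - l) * indicator (A n) x)"
        using f by (intro integrable_real_mult_indicator) auto
      fix x assume "x \<in> space M"
      then show "P n x - P m (T x) \<le> (f x - l) * indicator (A n) x"
        using nonneg[of m "T x"] nonneg[of n x]
        by (auto simp: A_def Suc PSuc max_def split: split_indicator if_splits)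
    qed
    also have "\<dots> = (\<integral>x. f x * indicator (A n) x \<partial>M) - l * prob (A n)"
    proof -
      have "integrable M (\<lambda>x. f x * indicator (A n) x)"
        using f by (intro integrable_real_mult_indicator) auto
      moreover have "integrable M (\<lambda>x. l * indicator (A n) x)"
        by (intro integrable_mult_right integrable_real_indicator) (auto simp: less_top[symmetric])
      ultimately show ?thesis
        by (simp add: left_diff_distrib Int_absorb1 sets.sets_into_space)
    qed
    also have "(\<integral>x. f x * indicator (A n) x \<partial>M) \<le> (\<integral>x. f x \<partial>M)"
      using f by (intro integral_mono integrable_real_mult_indicator) (auto split: split_indicator)
    finally show ?thesis by simp
  qed
  have "incseq A"
    using mono by (auto simp: incseq_Suc_iff A_def intro: less_le_trans)
  then have "(\<lambda>n. prob (A n)) \<longlonglongrightarrow> prob (\<Union>n. A n)"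
    by (intro finite_Lim_measure_incseq) auto
  then have "l * prob (\<Union>n. A n) \<le> (\<integral>x. f x \<partial>M)"
    by (intro LIMSEQ_le_const2[OF tendsto_mult_left]) (auto intro!: exI[of _ 0] bound)
  moreover have "x \<in> (\<Union>n. A n)"
    if "x \<in> space M" "(\<Sum>i<n. f ((T ^^ i) x)) > l * real n" for x n
    using sums[of x n] that by (auto simp: A_def intro!: exI[of _ n])
  ultimately show ?thesis
    by (intro bexI[of _ "\<Union>n. A n"]) auto
qed

lemma AE_orbit_sums_linear_bound:
  fixes f :: "'b \<Rightarrow> real"
  assumes f: "integrable M f" "\<And>x. 0 \<le> f x"
  shows "AE x in M. \<exists>C. \<forall>n. (\<Sum>i<n. f ((T ^^ i) x)) \<le> C * real n"
proof -
  have "\<forall>l::nat. \<exists>A\<in>sets M.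
      (\<forall>x\<in>space M. (\<exists>n. (\<Sum>i<n. f ((T ^^ i) x)) > real (Suc l) * real n) \<longrightarrow> x \<in> A) \<and>
      real (Suc l) * prob A \<le> (\<integral>x. f x \<partial>M)"
    by (intro allI maximal_ergodic_bound f) auto
  then obtain A where A[measurable]: "\<And>l. A l \<in> sets M"
    and sub: "\<And>l x n. x \<in> space M \<Longrightarrow> (\<Sum>i<n. f ((T ^^ i) x)) > real (Suc l) * real n \<Longrightarrow> x \<in> A l"
    and bound: "\<And>l. real (Suc l) * prob (A l) \<le> (\<integral>x. f x \<partial>M)"
    by metis
  have "prob (\<Inter>l. A l) \<le> (\<integral>x. f x \<partial>M) / real (Suc l)" for l
  proof -
    have "prob (\<Inter>l. A l) \<le> prob (A l)"
      by (intro finite_measure_mono) auto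
    also have "\<dots> \<le> (\<integral>x. f x \<partial>M) / real (Suc l)"
      using bound[of l] by (simp add: field_simps)
    finally show ?thesis .
  qed
  moreover have "(\<lambda>l. (\<integral>x. f x \<partial>M) / real (Suc l)) \<longlonglongrightarrow> 0"
    by (rule LIMSEQ_Suc[OF lim_const_over_n])
  ultimately have "prob (\<Inter>l. A l) \<le> 0"
    by (intro LIMSEQ_le_const) auto
  then have "prob (\<Inter>l. A l) = 0"
    by (simp add: measure_le_0_iff)
  then have "AE x in M. x \<notin> (\<Inter>l. A l)"
    by (intro AE_not_in) (auto simp: null_sets_def emeasure_eq_measure)
  then show ?thesis
  proof (rule AE_mp, intro AE_I2 impI)
    fix x assume x: "x \<in> space M" "x \<notin> (\<Inter>l. A l)"
    then obtain l where "x \<notin> A l" by auto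
    then have "(\<Sum>i<n. f ((T ^^ i) x)) \<le> real (Suc l) * real n" for n
      using sub[OF x(1), of l n] by (meson not_le)
    then show "\<exists>C. \<forall>n. (\<Sum>i<n. f ((T ^^ i) x)) \<le> C * real n" by blast
  qed
qed

lemma AE_orbit_sublinear:
  fixes f :: "'b \<Rightarrow> real"
  assumes f: "integrable M f" "\<And>x. 0 \<le> f x"
  shows "AE x in M. \<forall>r>0. \<forall>\<^sub>F n in sequentially. f ((T ^^ n) x) \<le> r * real n"
proof -
  note [measurable] = borel_measurable_integrable[OF f(1)] measurable_iterate
  have *: "AE x in M. \<forall>\<^sub>F n in sequentially. f ((T ^^ n) x) \<le> r * real n" if r: "0 < r" for r
  proof -
    define B where "B n = {x \<in> space M. r * real n < f ((T ^^ n) x)}" for n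
    define B' where "B' n = {x \<in> space M. r * real n < f x}" for n
    have [measurable]: "B n \<in> sets M" "B' n \<in> sets M" for n
      unfolding B_def B'_def by measurable
    have BB: "emeasure M (B n) = emeasure M (B' n)" for n
    proof -
      have "emeasure M (B' n) = emeasure (distr M M (T ^^ n)) (B' n)"
        by (simp add: distr_iterate)
      also have "\<dots> = emeasure M ((T ^^ n) -` B' n \<inter> space M)"
        by (intro emeasure_distr) auto
      also have "(T ^^ n) -` B' n \<inter> space M = B n"
        using measurable_space[OF measurable_iterate] by (auto simp: B_def B'_def)
      finally show ?thesis ..
    qed
    have count: "(\<Sum>n. indicator (B' n) x) \<le> ennreal (f x / r + 1)" if "x \<in> space M" for x
    proof -
      have "(\<Sum>n. indicator (B' n) x :: ennreal) = (\<Sum>n<nat \<lceil>f x / r\<rceil>. indicator (B' n) x)"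
      proof (rule suminf_finite)
        fix n assume "n \<notin> {..<nat \<lceil>f x / r\<rceil>}"
        then have "f x / r \<le> real n" by (simp add: not_less ceiling_le_iff nat_le_iff)
        then show "indicator (B' n) x = (0::ennreal)"
          using r by (auto simp: B'_def field_simps)
      qed simp
      also have "\<dots> \<le> (\<Sum>n<nat \<lceil>f x / r\<rceil>. 1)"
        by (intro sum_mono) (auto split: split_indicator)
      also have "\<dots> = ennreal (real (nat \<lceil>f x / r\<rceil>))"
        by (simp add: ennreal_of_nat_eq_real_of_nat)
      also have "\<dots> \<le> ennreal (f x / r + 1)"
        using f(2)[of x] r by (intro ennreal_leI) (auto simp: of_nat_nat)
      finally show ?thesis .
    qed
    have "(\<Sum>n. emeasure M (B n)) = (\<Sum>n. \<integral>\<^sup>+x. indicator (B' n) x \<partial>M)"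
      by (simp add: BB)
    also have "\<dots> = (\<integral>\<^sup>+x. (\<Sum>n. indicator (B' n) x) \<partial>M)"
      by (rule nn_integral_suminf[symmetric]) simp
    also have "\<dots> \<le> (\<integral>\<^sup>+x. ennreal (f x / r + 1) \<partial>M)"
      by (intro nn_integral_mono count)
    also have "\<dots> = ennreal (\<integral>x. f x / r + 1 \<partial>M)"
      using f r by (intro nn_integral_eq_integral) auto
    finally have fin: "(\<Sum>n. emeasure M (B n)) < \<infinity>"
      by (auto intro: le_less_trans)
    have "AE x in M. \<forall>\<^sub>F n in sequentially. x \<in> space M - B n"
    proof (rule borel_cantelli_AE1)
      show "summable (\<lambda>n. prob (B n))"
        using fin by (intro summable_suminf_not_top) (auto simp: emeasure_eq_measure)
    qed (auto simp: emeasure_eq_measure)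
    then show ?thesis
      by (rule AE_mp) (auto simp: B_def not_less elim: eventually_mono)
  qed
  have "AE x in M. \<forall>k. \<forall>\<^sub>F n in sequentially. f ((T ^^ n) x) \<le> 1 / real (Suc k) * real n"
    unfolding AE_all_countable by (intro allI *) simp
  then show ?thesis
  proof (rule AE_mp, intro AE_I2 impI allI)
    fix x and r :: real
    assume ev: "\<forall>k. \<forall>\<^sub>F n in sequentially. f ((T ^^ n) x) \<le> 1 / real (Suc k) * real n" and r: "0 < r"
    obtain k where k: "1 / real (Suc k) < r"
      using r nat_approx_posE by blast
    show "\<forall>\<^sub>F n in sequentially. f ((T ^^ n) x) \<le> r * real n"
    proof (rule eventually_mono[OF spec[OF ev, of k]])
      fix n assume "f ((T ^^ n) x) \<le> 1 / real (Suc k) * real n"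
      also have "\<dots> \<le> r * real n" using k by (intro mult_right_mono) auto
      finally show "f ((T ^^ n) x) \<le> r * real n" .
    qed
  qed
qed

end

lemma AE_PiM_linear_bound:
  fixes f :: "'b \<Rightarrow> real"
  assumes q: "prob_space q" and f: "integrable q f" "\<And>x. 0 \<le> f x"
  shows "AE w in PiM UNIV (\<lambda>_::nat. q). \<exists>C. \<forall>n. (\<Sum>i<n. f (w i)) \<le> C * real n"
    and "AE w in PiM UNIV (\<lambda>_::nat. q). \<forall>r>0. \<forall>\<^sub>F n in sequentially. f (w n) \<le> r * real n"
proof -
  let ?M = "PiM UNIV (\<lambda>_::nat. q)" and ?T = "\<lambda>w i. w (Suc i)"
  have M: "prob_space ?M" using q by (intro prob_space_PiM)
  have T: "?T \<in> ?M \<rightarrow>\<^sub>M ?M"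
    by (intro measurable_PiM_single' measurable_component_singleton) (auto simp: space_PiM PiE_iff)
  have inv: "distr ?M ?M ?T = ?M" using q by (rule distr_PiM_shift)
  have it: "(?T ^^ n) w = (\<lambda>i. w (n + i))" for n and w :: "nat \<Rightarrow> 'b"
    by (induction n) auto
  have "distr ?M q (\<lambda>w. w 0) = q"
    using distr_PiM_component[of "UNIV :: nat set" "\<lambda>_. q" 0] q by simp
  then have int: "integrable ?M (\<lambda>w. f (w 0))"
    using integrable_distr[of "\<lambda>w. w 0" ?M q f] f(1) by (simp add: measurable_component_singleton)
  show "AE w in ?M. \<exists>C. \<forall>n. (\<Sum>i<n. f (w i)) \<le> C * real n"
    using AE_orbit_sums_linear_bound[OF M T inv int f(2)] by (simp add: it)
  show "AE w in ?M. \<forall>r>0. \<forall>\<^sub>F n in sequentially. f (w n) \<le> r * real n"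
    using AE_orbit_sublinear[OF M T inv int f(2)] by (simp add: it)
qed

lemma liminf_rate_pos_iff:
  fixes L :: "nat \<Rightarrow> real"
  shows "0 < liminf (\<lambda>n. ereal (1 / real n * L n)) \<longleftrightarrow> (\<exists>r>0. \<forall>\<^sub>F n in sequentially. r * real n \<le> L n)"
proof
  assume "0 < liminf (\<lambda>n. ereal (1 / real n * L n))"
  then obtain r where r: "0 < ereal r" "ereal r < liminf (\<lambda>n. ereal (1 / real n * L n))"
    using ereal_dense2 by blast
  from less_LiminfD[OF r(2)] eventually_gt_at_top[of 0]
  have "\<forall>\<^sub>F n in sequentially. r * real n \<le> L n"
    by eventually_elim (simp add: field_simps)
  with r(1) show "\<exists>r>0. \<forall>\<^sub>F n in sequentially. r * real n \<le> L n" by auto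
next
  assume "\<exists>r>0. \<forall>\<^sub>F n in sequentially. r * real n \<le> L n"
  then obtain r where r: "0 < r" "\<forall>\<^sub>F n in sequentially. r * real n \<le> L n" by blast
  from r(2) eventually_gt_at_top[of 0]
  have "\<forall>\<^sub>F n in sequentially. ereal r \<le> ereal (1 / real n * L n)"
    by eventually_elim (simp add: field_simps)
  then have "ereal r \<le> liminf (\<lambda>n. ereal (1 / real n * L n))"
    by (rule Liminf_bounded)
  with r(1) show "0 < liminf (\<lambda>n. ereal (1 / real n * L n))"
    by (metis ereal_less(2) less_le_trans)
qed

lemma linear_growth_subseq:
  fixes L :: "nat \<Rightarrow> real" and s :: "nat \<Rightarrow> nat"
  assumes "\<forall>\<^sub>F n in sequentially. r * real n \<le> L n" "0 < r" and s: "\<And>m. m \<le> s m"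
  shows "\<forall>\<^sub>F m in sequentially. r * real m \<le> L (s m)"
proof -
  have "filterlim s at_top sequentially"
    using s by (intro filterlim_at_top_mono[OF filterlim_ident]) auto
  then have "\<forall>\<^sub>F m in sequentially. r * real (s m) \<le> L (s m)"
    using assms(1) by (auto simp: filterlim_iff)
  then show ?thesis
  proof (rule eventually_mono)
    fix m assume "r * real (s m) \<le> L (s m)"
    moreover have "r * real m \<le> r * real (s m)" using s[of m] assms(2) by simp
    ultimately show "r * real m \<le> L (s m)" by linarith
  qed
qed

lemma linear_growth_interpolate:
  fixes L Z :: "nat \<Rightarrow> real" and s :: "nat \<Rightarrow> nat"
  assumes s0: "s 0 = 0" and s: "\<And>m. s m < s (Suc m)" and C: "\<And>m. real (s m) \<le> C * real m"
    and L: "\<forall>\<^sub>F m in sequentially. r * real m \<le> L (s m)" and r: "0 < r"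
    and Z: "\<And>r. 0 < r \<Longrightarrow> \<forall>\<^sub>F m in sequentially. Z m \<le> r * real m"
    and gap: "\<And>m n. s m \<le> n \<Longrightarrow> n < s (Suc m) \<Longrightarrow> L (s m) \<le> L n + D + Z m"
  shows "\<exists>r>0. \<forall>\<^sub>F n in sequentially. r * real n \<le> L n"
proof -
  have C0: "0 < C" using C[of 1] s[of 0] s0 by simp
  have "filterlim (\<lambda>m. r / 4 * real m) at_top sequentially"
    using r by (intro filterlim_tendsto_pos_mult_at_top[OF tendsto_const] filterlim_real_sequentially) auto
  then have "\<forall>\<^sub>F m in sequentially. D \<le> r / 4 * real m"
    by (simp add: filterlim_at_top)
  with L Z[of "r / 4"] r have "\<forall>\<^sub>F m in sequentially.
      r * real m \<le> L (s m) \<and> Z m \<le> r / 4 * real m \<and> D \<le> r / 4 * real m"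
    by (simp add: eventually_conj_iff)
  then obtain M where M: "\<And>m. M \<le> m \<Longrightarrow>
      r * real m \<le> L (s m) \<and> Z m \<le> r / 4 * real m \<and> D \<le> r / 4 * real m"
    by (auto simp: eventually_sequentially)
  have mono: "strict_mono s" using s by (simp add: strict_mono_Suc_iff)
  have "r / (4 * C) * real n \<le> L n" if n: "s (Suc M) \<le> n" for n
  proof -
    obtain m where m: "s m \<le> n" "n < s (Suc m)"
    proof -
      have "n < s (Suc n)" using seq_suble[OF mono, of "Suc n"] by simp
      then have ex: "\<exists>m. n < s m" by blast
      define m where "m = (LEAST m. n < s m)"
      have lt: "n < s m" unfolding m_def using ex by (rule LeastI_ex)
      then obtain m' where m': "m = Suc m'" using s0 by (cases m) auto
      have "\<not> n < s m'" using not_less_Least[of m' "\<lambda>m. n < s m"] m' by (simp add: m_def)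
      with lt m' show thesis using that[of m'] by simp
    qed
    have "Suc M < Suc m" using n m mono by (meson le_less_trans strict_mono_less)
    then have Mm: "M \<le> m" "1 \<le> m" by auto
    have "real n \<le> C * real (Suc m)" using m C[of "Suc m"] by linarith
    also have "\<dots> \<le> C * (2 * real m)" using Mm C0 by (intro mult_left_mono) auto
    finally have "real n / (2 * C) \<le> real m" using C0 by (simp add: field_simps)
    then have "r / 2 * (real n / (2 * C)) \<le> r / 2 * real m" using r by (intro mult_left_mono) auto
    also have "\<dots> \<le> L n" using M[OF Mm(1)] gap[OF m] by linarith
    finally show ?thesis by simp
  qed
  then show ?thesis
    using r C0 by (intro exI[of _ "r / (4 * C)"]) (auto simp: eventually_sequentially)
qed

section \<open>Laws of sequences in a countable set\<close>

definition cylinder :: "'b list \<Rightarrow> (nat \<Rightarrow> 'b) set" where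
  "cylinder xs = {w. map w [0..<length xs] = xs}"

lemma in_cylinder_iff: "w \<in> cylinder xs \<longleftrightarrow> (\<forall>i<length xs. w i = xs ! i)"
  unfolding cylinder_def mem_Collect_eq list_eq_iff_nth_eq[of _ xs] by simp

lemma sets_cylinder [measurable]:
  fixes xs :: "'b::countable list"
  shows "cylinder xs \<in> sets (PiM UNIV (\<lambda>_. count_space UNIV))"
proof -
  have "{w \<in> space (PiM UNIV (\<lambda>_. count_space UNIV)). \<forall>i<length xs. w i = xs ! i} \<in>
      sets (PiM UNIV (\<lambda>_. count_space (UNIV :: 'b set)))"
    by measurable
  then show ?thesis
    by (simp add: in_cylinder_iff[symmetric] space_PiM)
qed

lemma Int_cylinder:
  "cylinder xs \<inter> cylinder ys \<in> {{}, cylinder xs, cylinder ys}"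
proof -
  have *: "cylinder xs \<inter> cylinder ys \<in> {{}, cylinder ys}" if "length xs \<le> length ys" for xs ys :: "'b list"
  proof (cases "cylinder xs \<inter> cylinder ys = {}")
    case False
    then obtain w where w: "w \<in> cylinder xs" "w \<in> cylinder ys" by auto
    then have "cylinder ys \<subseteq> cylinder xs"
      using that by (auto simp: in_cylinder_iff)
    then show ?thesis by auto
  qed simp
  show ?thesis
    using *[of xs ys] *[of ys xs] by (cases "length xs \<le> length ys") (auto simp: Int_commute)
qed

lemma sets_PiM_cylinder:
  "sets (PiM UNIV (\<lambda>_. count_space (UNIV :: 'b::countable set))) =
    sigma_sets UNIV (insert {} (range cylinder))"
proof
  show "sigma_sets UNIV (insert {} (range cylinder)) \<subseteq>
      sets (PiM UNIV (\<lambda>_. count_space (UNIV :: 'b set)))"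
  proof -
    have "insert {} (range cylinder) \<subseteq> sets (PiM UNIV (\<lambda>_. count_space (UNIV :: 'b set)))"
      by auto
    from sets.sigma_sets_subset[OF this] show ?thesis
      by (simp add: space_PiM)
  qed
  have "(\<lambda>w. w) \<in> sigma UNIV (insert {} (range cylinder)) \<rightarrow>\<^sub>M
      PiM UNIV (\<lambda>_. count_space (UNIV :: 'b set))"
  proof (rule measurable_PiM_single')
    fix i :: nat
    have "(\<lambda>w. w i) -` {x} \<in> sigma_sets UNIV (insert {} (range cylinder))" for x :: 'b
    proof -
      have "(\<lambda>w. w i) -` {x} = (\<Union>xs\<in>{xs. length xs = Suc i \<and> xs ! i = x}. cylinder xs)"
      proof (intro Set.set_eqI iffI)
        fix w :: "nat \<Rightarrow> 'b" assume "w \<in> (\<lambda>w. w i) -` {x}"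
        then show "w \<in> (\<Union>xs\<in>{xs. length xs = Suc i \<and> xs ! i = x}. cylinder xs)"
          by (intro UN_I[of "map w [0..<Suc i]"])
            (auto simp: in_cylinder_iff nth_append simp del: upt_Suc)
      qed (auto simp: in_cylinder_iff)
      also have "\<dots> \<in> sigma_sets UNIV (insert {} (range cylinder))"
        by (intro sigma_sets_UNION) auto
      finally show ?thesis .
    qed
    then show "(\<lambda>w. w i) \<in> sigma UNIV (insert {} (range cylinder)) \<rightarrow>\<^sub>M count_space (UNIV :: 'b set)"
      by (subst measurable_count_space_eq_countable) auto
  qed (simp add: space_measure_of_conv)
  then have "(\<lambda>w. w) -` A \<inter> UNIV \<in> sigma_sets UNIV (insert {} (range cylinder))"
    if "A \<in> sets (PiM UNIV (\<lambda>_. count_space (UNIV :: 'b set)))" for A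
    using measurable_sets[OF _ that, of "\<lambda>w. w" "sigma UNIV (insert {} (range cylinder))"] by simp
  then show "sets (PiM UNIV (\<lambda>_. count_space (UNIV :: 'b set))) \<subseteq>
      sigma_sets UNIV (insert {} (range cylinder))"
    by auto
qed

lemma UN_cylinder_eq: "(\<Union>xs\<in>{xs. length xs = n \<and> P xs}. cylinder xs) = {w. P (map w [0..<n])}"
proof (intro Set.set_eqI iffI)
  fix w assume "w \<in> {w. P (map w [0..<n])}"
  then show "w \<in> (\<Union>xs\<in>{xs. length xs = n \<and> P xs}. cylinder xs)"
    by (intro UN_I[of "map w [0..<n]"]) (simp_all add: cylinder_def)
next
  fix w assume "w \<in> (\<Union>xs\<in>{xs. length xs = n \<and> P xs}. cylinder xs)"
  then show "w \<in> {w. P (map w [0..<n])}" by (auto simp: cylinder_def)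
qed

lemma emeasure_prefix:
  fixes M :: "(nat \<Rightarrow> 'b::countable) measure"
  assumes M[simp]: "sets M = sets (PiM UNIV (\<lambda>_. count_space UNIV))"
  shows "emeasure M {w. P (map w [0..<n])} =
    (\<integral>\<^sup>+xs. emeasure M (cylinder xs) \<partial>count_space {xs. length xs = n \<and> P xs})"
  unfolding UN_cylinder_eq[symmetric]
proof (rule emeasure_UN_countable)
  show "disjoint_family_on cylinder {xs :: 'b list. length xs = n \<and> P xs}"
    by (auto simp: disjoint_family_on_def cylinder_def)
  show "cylinder xs \<in> sets M" for xs
    by (simp add: sets_cylinder)
qed (rule countableI_type)

lemma measure_eqI_cylinder:
  fixes M N :: "(nat \<Rightarrow> 'b::countable) measure"
  assumes M: "prob_space M" "sets M = sets (PiM UNIV (\<lambda>_. count_space UNIV))"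
    and N: "prob_space N" "sets N = sets (PiM UNIV (\<lambda>_. count_space UNIV))"
    and D: "AE w in N. \<forall>i. w i \<in> D"
    and eq: "\<And>xs. set xs \<subseteq> D \<Longrightarrow> emeasure M (cylinder xs) = emeasure N (cylinder xs)"
  shows "M = N"
proof -
  interpret M: prob_space M by (rule M(1))
  interpret N: prob_space N by (rule N(1))
  note [simp] = M(2) N(2)
  have space[simp]: "space M = UNIV" "space N = UNIV"
    using sets_eq_imp_space_eq[OF M(2)] sets_eq_imp_space_eq[OF N(2)] by (auto simp: space_PiM)
  have eqall: "emeasure M (cylinder xs) = emeasure N (cylinder xs)" for xs
  proof (cases "set xs \<subseteq> D")
    case False
    let ?n = "length xs"
    have meas: "{w. Q (map w [0..<?n])} \<in> sets (PiM UNIV (\<lambda>_. count_space UNIV))" for Q :: "'b list \<Rightarrow> bool"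
      unfolding UN_cylinder_eq[symmetric] by (intro sets.countable_UN'') auto
    have "emeasure M {w. set (map w [0..<?n]) \<subseteq> D} = emeasure N {w. set (map w [0..<?n]) \<subseteq> D}"
      unfolding emeasure_prefix[where P="\<lambda>xs. set xs \<subseteq> D", OF M(2)]
        emeasure_prefix[where P="\<lambda>xs. set xs \<subseteq> D", OF N(2)]
      by (intro nn_integral_cong eq) simp
    also have "\<dots> = emeasure N (space N)"
      using D meas[of "\<lambda>xs. set xs \<subseteq> D"] sets.top[of N]
      by (intro emeasure_eq_AE) (auto elim!: eventually_mono)
    finally have "emeasure M {w. set (map w [0..<?n]) \<subseteq> D} = 1"
      by (simp add: N.emeasure_space_1[simplified])
    then have "AE w in M. w \<in> {w. set (map w [0..<?n]) \<subseteq> D}"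
      by (intro M.AE_prob_1) (simp add: M.emeasure_eq_measure)
    then have "AE w in M. w \<notin> cylinder xs"
    proof (rule eventually_mono)
      fix w assume "w \<in> {w. set (map w [0..<?n]) \<subseteq> D}"
      with False show "w \<notin> cylinder xs"
        unfolding cylinder_def mem_Collect_eq by metis
    qed
    moreover have "AE w in N. w \<notin> cylinder xs"
      using D
    proof (rule eventually_mono)
      fix w :: "nat \<Rightarrow> 'b" assume w: "\<forall>i. w i \<in> D"
      show "w \<notin> cylinder xs"
      proof
        assume "w \<in> cylinder xs"
        then have "map w [0..<?n] = xs" unfolding cylinder_def by (rule CollectD)
        then have "set xs = w ` {0..<?n}" by (metis set_map set_upt)
        with w False show False by (simp add: image_subset_iff)
      qed
    qed
    ultimately have "cylinder xs \<in> null_sets M" "cylinder xs \<in> null_sets N"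
      by (simp_all add: AE_iff_null_sets)
    then show ?thesis by (simp add: null_setsD1)
  qed (rule eq)
  show ?thesis
  proof (rule measure_eqI_generator_eq[where \<Omega> = UNIV and E = "insert {} (range cylinder)"
        and A = "\<lambda>_. cylinder []"])
    show "Int_stable (insert {} (range (cylinder :: 'b list \<Rightarrow> _)))"
    proof (rule Int_stableI)
      fix a b :: "(nat \<Rightarrow> 'b) set"
      assume "a \<in> insert {} (range cylinder)" "b \<in> insert {} (range cylinder)"
      then consider "a = {}" | "b = {}" | xs ys where "a = cylinder xs" "b = cylinder ys"
        by auto
      then show "a \<inter> b \<in> insert {} (range cylinder)"
      proof cases
        case (3 xs ys)
        then show ?thesis using Int_cylinder[of xs ys] by auto
      qed simp_all
    qed
    show "sets M = sigma_sets UNIV (insert {} (range cylinder))"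
      "sets N = sigma_sets UNIV (insert {} (range cylinder))"
      by (simp_all add: sets_PiM_cylinder)
    show "(\<Union>i::nat. cylinder []) = (UNIV :: (nat \<Rightarrow> 'b) set)"
      by (simp add: cylinder_def)
    show "emeasure M X = emeasure N X" if "X \<in> insert {} (range cylinder)" for X
      using that eqall by auto
  qed simp_all
qed

section \<open>Excursions of a Markov chain\<close>

lemma cylinder_append:
  "w \<in> cylinder (xs @ ys) \<longleftrightarrow> w \<in> cylinder xs \<and> (\<lambda>i. w (length xs + i)) \<in> cylinder ys"
proof -
  have "(\<forall>i<length xs + length ys. w i = (xs @ ys) ! i) \<longleftrightarrow>
      (\<forall>i<length xs. w i = xs ! i) \<and> (\<forall>i<length ys. w (length xs + i) = ys ! i)" (is "?L \<longleftrightarrow> ?R")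
  proof
    assume L: ?L
    show ?R
    proof (intro conjI allI impI)
      fix i assume "i < length xs"
      then show "w i = xs ! i" using L[rule_format, of i] by (simp add: nth_append)
    next
      fix i assume "i < length ys"
      then show "w (length xs + i) = ys ! i" using L[rule_format, of "length xs + i"] by (simp add: nth_append)
    qed
  next
    assume R: ?R
    show ?L
    proof (intro allI impI)
      fix i assume i: "i < length xs + length ys"
      show "w i = (xs @ ys) ! i"
      proof (cases "i < length xs")
        case False
        then have "w (length xs + (i - length xs)) = ys ! (i - length xs)"
          using R i by (intro R[THEN conjunct2, rule_format]) auto
        with False show ?thesis by (simp add: nth_append)
      qed (use R in \<open>simp add: nth_append\<close>)
    qed
  qed
  then show ?thesis unfolding in_cylinder_iff by simp
qed

lemma cylinder_Nil [simp]: "w \<in> cylinder []"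
  by (simp add: cylinder_def)

lemma cylinder_Cons: "w \<in> cylinder (x # xs) \<longleftrightarrow> w 0 = x \<and> (\<lambda>i. w (Suc i)) \<in> cylinder xs"
  using cylinder_append[of w "[x]" xs] by (simp add: cylinder_def[of "[x]"])

lemma measurable_prefix [measurable]:
  "(\<lambda>w. map w [0..<n]) \<in> PiM UNIV (\<lambda>_. count_space (UNIV :: 'b::countable set)) \<rightarrow>\<^sub>M count_space UNIV"
proof (subst measurable_count_space_eq_countable)
  show "(\<lambda>w. map w [0..<n]) \<in> space (PiM UNIV (\<lambda>_. count_space (UNIV :: 'b set))) \<rightarrow> UNIV \<and>
    (\<forall>xs\<in>UNIV. (\<lambda>w. map w [0..<n]) -` {xs} \<inter> space (PiM UNIV (\<lambda>_. count_space UNIV)) \<in>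
      sets (PiM UNIV (\<lambda>_. count_space (UNIV :: 'b set))))"
  proof (intro conjI ballI)
    fix xs :: "'b list"
    have "(\<lambda>w. map w [0..<n]) -` {xs} = (if length xs = n then cylinder xs else {})"
      by (auto simp: cylinder_def)
    then show "(\<lambda>w. map w [0..<n]) -` {xs} \<inter> space (PiM UNIV (\<lambda>_. count_space UNIV)) \<in>
        sets (PiM UNIV (\<lambda>_. count_space (UNIV :: 'b set)))"
      by (simp add: space_PiM)
  qed simp
qed simp

fun path_weight :: "('e \<Rightarrow> 'e pmf) \<Rightarrow> 'e list \<Rightarrow> ennreal" where
  "path_weight K (x # y # xs) = ennreal (pmf (K x) y) * path_weight K (y # xs)"
| "path_weight K _ = 1"

lemma path_weight_append:
  "path_weight K (xs @ x # ys) = path_weight K (xs @ [x]) * path_weight K (x # ys)"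
proof (induction xs)
  case (Cons y xs)
  then show ?case by (cases xs) (auto simp: mult.assoc)
qed simp

lemma path_weight_conv_prod:
  "path_weight K xs = (\<Prod>i<length xs - 1. ennreal (pmf (K (xs ! i)) (xs ! Suc i)))"
  by (induction K xs rule: path_weight.induct) (simp_all add: prod.lessThan_Suc_shift del: prod.lessThan_Suc)

lemma prob_space_markov_measure: "prob_space (markov_measure K (e :: 'a::countable))"
proof -
  let ?N = "\<lambda>_::nat. count_space (UNIV :: 'a set)"
  have "emeasure (markov_measure K e) (prod_emb UNIV ?N {} (space (PiM {} ?N))) =
      emeasure (markov.CI K e {}) (space (PiM {} ?N))"
    unfolding markov_measure_def by (rule markov.lim) auto
  also have "emeasure (markov.CI K e {}) (space (PiM {} ?N)) = 1"
  proof -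
    have "space (PiM {} ?N) = space (markov.CI K e {})"
      by (rule sets_eq_imp_space_eq[symmetric]) (rule markov.PF.sets_P, simp_all)
    then show ?thesis
      using prob_space.emeasure_space_1[OF markov.PF.prob_space_P[of "{}" K e]] by simp
  qed
  also have "prod_emb UNIV ?N {} (space (PiM {} ?N)) = space (markov_measure K e)"
    by (auto simp: prod_emb_def space_markov_measure space_PiM restrict_def)
  finally have "emeasure (markov_measure K e) (space (markov_measure K e)) = 1" .
  then show ?thesis by (rule prob_spaceI)
qed

lemma emeasure_markov_cylinder:
  assumes "xs \<noteq> []"
  shows "emeasure (markov_measure K e) (cylinder xs) = (if hd xs = e then path_weight K xs else 0)"
proof -
  have "cylinder xs = {\<omega>. \<forall>i\<le>length xs - 1. \<omega> i = xs ! i}"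
    using assms by (cases xs) (auto simp: in_cylinder_iff less_Suc_eq_le)
  then show ?thesis
    using assms by (simp add: emeasure_markov_measure_cylinder path_weight_conv_prod hd_conv_nth)
qed

lemma AE_markov_start: "AE \<omega> in markov_measure K e. \<omega> 0 = e"
proof -
  interpret prob_space "markov_measure K e" by (rule prob_space_markov_measure)
  have "emeasure (markov_measure K e) (cylinder [e]) = 1"
    by (simp add: emeasure_markov_cylinder)
  then have "AE \<omega> in markov_measure K e. \<omega> \<in> cylinder [e]"
    by (intro AE_prob_1) (simp add: measure_def)
  then show ?thesis
    by (rule eventually_mono) (simp add: cylinder_Cons)
qed

lemma return_time_finite:
  assumes "return_time e \<omega> < \<infinity>"
  obtains n where "1 \<le> n" "\<omega> n = e" "\<forall>i. 1 \<le> i \<longrightarrow> i < n \<longrightarrow> \<omega> i \<noteq> e" "return_time e \<omega> = enat n"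
proof -
  let ?S = "enat ` {n. 1 \<le> n \<and> \<omega> n = e}"
  have "?S \<noteq> {}"
  proof
    assume "?S = {}"
    then have "return_time e \<omega> = \<infinity>"
      unfolding return_time_def by (simp only: Inf_enat_def) simp
    with assms show False by simp
  qed
  then have "Inf ?S \<in> ?S"
    by (simp only: Inf_enat_def if_False) (rule LeastI_ex, blast)
  then obtain n where n: "1 \<le> n" "\<omega> n = e" "return_time e \<omega> = enat n"
    by (auto simp: return_time_def)
  moreover have "\<omega> i \<noteq> e" if "1 \<le> i" "i < n" for i
  proof
    assume "\<omega> i = e"
    then have "Inf ?S \<le> enat i"
      using that by (intro Inf_lower) auto
    with n(3) that(2) show False
      by (simp add: return_time_def)
  qed
  ultimately show thesis using that by blast
qed

lemma return_time_eqI: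
  assumes "1 \<le> n" "\<omega> n = e" "\<And>i. 1 \<le> i \<Longrightarrow> i < n \<Longrightarrow> \<omega> i \<noteq> e"
  shows "return_time e \<omega> = enat n"
proof (rule antisym)
  show "return_time e \<omega> \<le> enat n"
    unfolding return_time_def using assms by (intro Inf_lower) auto
  show "enat n \<le> return_time e \<omega>"
    unfolding return_time_def
  proof (rule Inf_greatest)
    fix t assume "t \<in> enat ` {n. 1 \<le> n \<and> \<omega> n = e}"
    then obtain i where i: "t = enat i" "1 \<le> i" "\<omega> i = e" by auto
    then have "\<not> i < n" using assms(3) by blast
    with i show "enat n \<le> t" by simp
  qed
qed

lemma return_time_less_infinity_iff: "return_time e \<omega> < \<infinity> \<longleftrightarrow> (\<exists>n\<ge>1. \<omega> n = e)"
proof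
  assume "\<exists>n\<ge>1. \<omega> n = e"
  then obtain n where "1 \<le> n" "\<omega> n = e" by auto
  then have "return_time e \<omega> \<le> enat n"
    unfolding return_time_def by (intro Inf_lower) auto
  then show "return_time e \<omega> < \<infinity>" by (rule le_less_trans) simp
next
  assume "return_time e \<omega> < \<infinity>"
  then obtain n where "1 \<le> n" "\<omega> n = e" by (rule return_time_finite)
  then show "\<exists>n\<ge>1. \<omega> n = e" by blast
qed

definition first_excursion :: "'e \<Rightarrow> (nat \<Rightarrow> 'e) \<Rightarrow> 'e list" where
  "first_excursion e \<omega> =
     (if return_time e \<omega> < \<infinity> then map \<omega> [0..<the_enat (return_time e \<omega>)] else [])"

definition skip_excursion :: "'e \<Rightarrow> (nat \<Rightarrow> 'e) \<Rightarrow> nat \<Rightarrow> 'e" where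
  "skip_excursion e \<omega> = (\<lambda>i. \<omega> (length (first_excursion e \<omega>) + i))"

definition excursion :: "'e \<Rightarrow> nat \<Rightarrow> (nat \<Rightarrow> 'e) \<Rightarrow> 'e list" where
  "excursion e m \<omega> = first_excursion e ((skip_excursion e ^^ m) \<omega>)"

definition excursion_words :: "'e \<Rightarrow> 'e list set" where
  "excursion_words e = {e # u | u. e \<notin> set u}"

lemma excursion_0 [simp]: "excursion e 0 \<omega> = first_excursion e \<omega>"
  by (simp add: excursion_def)

lemma excursion_Suc: "excursion e (Suc m) \<omega> = excursion e m (skip_excursion e \<omega>)"
  by (simp add: excursion_def funpow_swap1)

lemma first_excursion_eq_map:
  "first_excursion e \<omega> = map \<omega> [0..<length (first_excursion e \<omega>)]"
  by (simp add: first_excursion_def)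

lemma first_excursion_eq_iff:
  assumes w: "w \<in> excursion_words e"
  shows "first_excursion e \<omega> = w \<longleftrightarrow> \<omega> \<in> cylinder (w @ [e])"
proof
  assume *: "first_excursion e \<omega> = w"
  then have fin: "return_time e \<omega> < \<infinity>"
    using w by (auto simp: first_excursion_def excursion_words_def split: if_splits)
  then obtain n where n: "\<omega> n = e" "return_time e \<omega> = enat n"
    by (rule return_time_finite)
  with * fin have w_eq: "w = map \<omega> [0..<n]" by (auto simp: first_excursion_def)
  then show "\<omega> \<in> cylinder (w @ [e])"
    using n(1) by (simp add: cylinder_def)
next
  assume \<omega>: "\<omega> \<in> cylinder (w @ [e])"
  then have w_eq: "map \<omega> [0..<length w] = w" and fin: "\<omega> (length w) = e"
    by (auto simp: cylinder_def)
  obtain u where u: "w = e # u" "e \<notin> set u"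
    using w by (auto simp: excursion_words_def)
  have "return_time e \<omega> = enat (length w)"
  proof (rule return_time_eqI)
    fix i assume i: "1 \<le> i" "i < length w"
    then obtain j where j: "i = Suc j" "j < length u"
      using u by (cases i) auto
    have "\<omega> i = w ! i"
      using \<omega> i unfolding cylinder_append by (simp add: in_cylinder_iff)
    then have "\<omega> i \<in> set u"
      using j u by simp
    then show "\<omega> i \<noteq> e" using u by auto
  qed (use u fin in auto)
  then show "first_excursion e \<omega> = w"
    using w_eq by (simp add: first_excursion_def)
qed

lemma excursions_in_cylinder_iff:
  assumes "set ws \<subseteq> excursion_words e" "\<omega> 0 = e"
  shows "(\<lambda>i. excursion e i \<omega>) \<in> cylinder ws \<longleftrightarrow> \<omega> \<in> cylinder (concat ws @ [e])"
  using assms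
proof (induction ws arbitrary: \<omega>)
  case Nil
  then show ?case by (simp add: cylinder_Cons)
next
  case (Cons w ws)
  let ?\<omega> = "\<lambda>i. \<omega> (length w + i)"
  have w: "w \<in> excursion_words e" and ws: "set ws \<subseteq> excursion_words e"
    using Cons.prems by auto
  have start: "\<omega>' 0 = e" if "\<omega>' \<in> cylinder (concat ws @ [e])" for \<omega>'
    using that ws by (cases ws) (auto simp: excursion_words_def cylinder_Cons)
  have "(\<lambda>i. excursion e i \<omega>) \<in> cylinder (w # ws) \<longleftrightarrow>
      \<omega> \<in> cylinder (w @ [e]) \<and> (\<lambda>i. excursion e i (skip_excursion e \<omega>)) \<in> cylinder ws"
    by (simp add: cylinder_Cons[of _ w] excursion_Suc first_excursion_eq_iff[OF w])
  also have "\<dots> \<longleftrightarrow> \<omega> \<in> cylinder (w @ [e]) \<and> ?\<omega> \<in> cylinder (concat ws @ [e])"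
  proof (rule conj_cong[OF refl])
    assume \<omega>: "\<omega> \<in> cylinder (w @ [e])"
    then have "skip_excursion e \<omega> = ?\<omega>"
      by (simp add: skip_excursion_def first_excursion_eq_iff[OF w, THEN iffD2])
    moreover have "?\<omega> 0 = e"
      using \<omega> by (simp add: cylinder_append[of \<omega> w] cylinder_Cons)
    ultimately show "(\<lambda>i. excursion e i (skip_excursion e \<omega>)) \<in> cylinder ws \<longleftrightarrow>
        ?\<omega> \<in> cylinder (concat ws @ [e])"
      using Cons.IH[OF ws] by simp
  qed
  also have "\<dots> \<longleftrightarrow> \<omega> \<in> cylinder (concat (w # ws) @ [e])"
    using start[of ?\<omega>] by (auto simp: cylinder_append[of \<omega> w] cylinder_Cons)
  finally show ?case .
qed

lemma measurable_return_time:
  "return_time e \<in> PiM UNIV (\<lambda>_. count_space (UNIV :: 'e::countable set)) \<rightarrow>\<^sub>M count_space UNIV"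
proof (subst measurable_count_space_eq_countable)
  let ?M = "PiM UNIV (\<lambda>_. count_space (UNIV :: 'e set))"
  show "return_time e \<in> space ?M \<rightarrow> UNIV \<and>
    (\<forall>t\<in>UNIV. return_time e -` {t} \<inter> space ?M \<in> sets ?M)"
  proof (intro conjI ballI)
    fix t :: enat
    show "return_time e -` {t} \<inter> space ?M \<in> sets ?M"
    proof (cases t)
      case (enat n)
      have "return_time e \<omega> = t \<longleftrightarrow> 1 \<le> n \<and> \<omega> n = e \<and> (\<forall>i\<in>{1..<n}. \<omega> i \<noteq> e)" (is "?L \<longleftrightarrow> ?R") for \<omega>
      proof
        assume ?L
        with enat have "return_time e \<omega> < \<infinity>" by simp
        then obtain m where "1 \<le> m" "\<omega> m = e" "\<forall>i. 1 \<le> i \<longrightarrow> i < m \<longrightarrow> \<omega> i \<noteq> e"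
            "return_time e \<omega> = enat m"
          by (rule return_time_finite)
        with \<open>?L\<close> enat show ?R by simp
      next
        assume ?R
        then show ?L unfolding enat by (intro return_time_eqI) auto
      qed
      then have "return_time e -` {t} \<inter> space ?M =
          {\<omega>\<in>space ?M. 1 \<le> n \<and> \<omega> n = e \<and> (\<forall>i\<in>{1..<n}. \<omega> i \<noteq> e)}"
        by auto
      also have "\<dots> \<in> sets ?M" by measurable
      finally show ?thesis .
    next
      case infinity
      then have "return_time e -` {t} \<inter> space ?M = {\<omega>\<in>space ?M. \<forall>n. 1 \<le> n \<longrightarrow> \<omega> n \<noteq> e}"
        using return_time_less_infinity_iff[of e, unfolded enat_ord_simps(4)] by (auto simp: space_PiM simp del: not_infinity_eq)
      also have "\<dots> \<in> sets ?M" by measurable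
      finally show ?thesis .
    qed
  qed simp
qed simp

lemma measurable_first_excursion:
  "first_excursion e \<in> PiM UNIV (\<lambda>_. count_space (UNIV :: 'e::countable set)) \<rightarrow>\<^sub>M count_space UNIV"
  unfolding first_excursion_def[abs_def]
proof (rule measurable_compose_countable[OF _ measurable_return_time[of e],
      where f = "\<lambda>t \<omega>. if t < \<infinity> then map \<omega> [0..<the_enat t] else []"])
  fix t :: enat
  show "(\<lambda>\<omega>. if t < \<infinity> then map \<omega> [0..<the_enat t] else []) \<in>
      PiM UNIV (\<lambda>_. count_space (UNIV :: 'e set)) \<rightarrow>\<^sub>M count_space UNIV"
    by (cases "t < \<infinity>") (simp_all only: if_True if_False measurable_prefix measurable_const space_count_space UNIV_I)
qed

lemma measurable_skip_excursion:
  "skip_excursion e \<in> PiM UNIV (\<lambda>_. count_space (UNIV :: 'e::countable set)) \<rightarrow>\<^sub>M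
    PiM UNIV (\<lambda>_. count_space UNIV)"
proof (rule measurable_PiM_single')
  fix i
  show "(\<lambda>\<omega>. skip_excursion e \<omega> i) \<in>
      PiM UNIV (\<lambda>_. count_space (UNIV :: 'e set)) \<rightarrow>\<^sub>M count_space UNIV"
    unfolding skip_excursion_def
    by (rule measurable_compose_countable[OF _ measurable_first_excursion[of e],
          where f = "\<lambda>u \<omega>. \<omega> (length u + i)"]) measurable
qed (simp add: space_PiM)

lemma measurable_excursion:
  "excursion e m \<in> PiM UNIV (\<lambda>_. count_space (UNIV :: 'e::countable set)) \<rightarrow>\<^sub>M count_space UNIV"
proof -
  have "skip_excursion e ^^ m \<in>
      PiM UNIV (\<lambda>_. count_space (UNIV :: 'e set)) \<rightarrow>\<^sub>M PiM UNIV (\<lambda>_. count_space UNIV)"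
    by (induction m) (auto intro: measurable_compose[OF _ measurable_skip_excursion] simp: comp_def)
  from measurable_compose[OF this measurable_first_excursion] show ?thesis
    by (simp add: excursion_def[abs_def])
qed

lemma measurable_excursions:
  "(\<lambda>\<omega> i. excursion e i \<omega>) \<in> PiM UNIV (\<lambda>_. count_space (UNIV :: 'e::countable set)) \<rightarrow>\<^sub>M
    PiM UNIV (\<lambda>_. count_space UNIV)"
  by (intro measurable_PiM_single' measurable_excursion) (simp add: space_PiM)

definition excursion_law :: "('e::countable \<Rightarrow> 'e pmf) \<Rightarrow> 'e \<Rightarrow> 'e list measure" where
  "excursion_law K e = distr (markov_measure K e) (count_space UNIV) (first_excursion e)"

lemma measurable_markov_cong:
  "measurable (markov_measure K e) N = measurable (PiM UNIV (\<lambda>_. count_space UNIV)) N"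
  by (rule measurable_cong_sets[OF sets_markov_measure refl])

lemma measurable_first_excursion_markov:
  "first_excursion e \<in> markov_measure K e' \<rightarrow>\<^sub>M count_space UNIV"
  unfolding measurable_markov_cong by (rule measurable_first_excursion)

lemma prob_space_excursion_law: "prob_space (excursion_law K e)"
  unfolding excursion_law_def
  by (intro prob_space.prob_space_distr prob_space_markov_measure
      measurable_first_excursion_markov)

lemma emeasure_excursion_law:
  assumes "w \<in> excursion_words e"
  shows "emeasure (excursion_law K e) {w} = path_weight K (w @ [e])"
proof -
  have "emeasure (excursion_law K e) {w} =
      emeasure (markov_measure K e) (first_excursion e -` {w} \<inter> space (markov_measure K e))"
    unfolding excursion_law_def
    by (rule emeasure_distr[OF measurable_first_excursion_markov]) simp
  also have "first_excursion e -` {w} \<inter> space (markov_measure K e) = cylinder (w @ [e])"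
    unfolding space_markov_measure using first_excursion_eq_iff[OF assms] by blast
  also have "emeasure (markov_measure K e) (cylinder (w @ [e])) = path_weight K (w @ [e])"
    using assms by (auto simp: emeasure_markov_cylinder excursion_words_def)
  finally show ?thesis .
qed

lemma AE_first_excursion:
  assumes "markov_recurrent K"
  shows "AE \<omega> in markov_measure K e. first_excursion e \<omega> \<in> excursion_words e"
proof -
  interpret prob_space "markov_measure K e" by (rule prob_space_markov_measure)
  have "prob {\<omega> \<in> space (markov_measure K e). return_time e \<omega> < \<infinity>} = 1"
    using assms by (simp add: markov_recurrent_def)
  then have "AE \<omega> in markov_measure K e. \<omega> \<in> {\<omega> \<in> space (markov_measure K e). return_time e \<omega> < \<infinity>}"
    by (rule AE_prob_1)
  with AE_markov_start show ?thesis
  proof eventually_elim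
    fix \<omega> assume \<omega>: "\<omega> 0 = e" "\<omega> \<in> {\<omega> \<in> space (markov_measure K e). return_time e \<omega> < \<infinity>}"
    then have "return_time e \<omega> < \<infinity>" by simp
    then obtain n where n: "1 \<le> n" "\<forall>i. 1 \<le> i \<longrightarrow> i < n \<longrightarrow> \<omega> i \<noteq> e" "return_time e \<omega> = enat n"
      by (rule return_time_finite)
    then have "first_excursion e \<omega> = e # map \<omega> [1..<n]"
      using \<omega>(1) upt_conv_Cons[of 0 n] by (simp add: first_excursion_def)
    with n(2) show "first_excursion e \<omega> \<in> excursion_words e"
      by (auto simp: excursion_words_def)
  qed
qed

lemma AE_PiM_excursion_words:
  assumes "markov_recurrent K"
  shows "AE w in PiM (UNIV :: nat set) (\<lambda>_. excursion_law K e). \<forall>i. w i \<in> excursion_words e"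
proof -
  interpret q: product_prob_space "\<lambda>_. excursion_law K e" "UNIV :: nat set"
    by (intro product_prob_spaceI prob_space_excursion_law)
  have "AE w in excursion_law K e. w \<in> excursion_words e"
    unfolding excursion_law_def using AE_first_excursion[OF assms]
    by (subst AE_distr_iff[OF measurable_first_excursion_markov]) auto
  then show ?thesis
    unfolding AE_all_countable by (intro allI q.AE_component) auto
qed

lemma path_weight_concat:
  assumes "set ws \<subseteq> excursion_words e"
  shows "path_weight K (concat ws @ [e]) = (\<Prod>i<length ws. path_weight K (ws ! i @ [e]))"
  using assms
proof (induction ws)
  case (Cons w ws)
  obtain u where "concat ws @ [e] = e # u"
    using Cons.prems by (cases ws) (auto simp: excursion_words_def)
  then have "path_weight K (concat (w # ws) @ [e]) =
      path_weight K (w @ [e]) * path_weight K (concat ws @ [e])"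
    using path_weight_append[of K w e u] by simp
  then show ?case
    using Cons by (simp add: prod.lessThan_Suc_shift del: prod.lessThan_Suc)
qed simp

lemma distr_excursions:
  fixes K :: "'a::countable \<Rightarrow> 'a pmf"
  assumes "markov_recurrent K"
  shows "distr (markov_measure K e) (PiM UNIV (\<lambda>_. count_space UNIV)) (\<lambda>\<omega> i. excursion e i \<omega>) =
    PiM UNIV (\<lambda>_. excursion_law K e)"
proof (rule measure_eqI_cylinder[where D = "excursion_words e"])
  let ?M = "markov_measure K e"
  interpret M: prob_space ?M by (rule prob_space_markov_measure)
  have meas: "(\<lambda>\<omega> i. excursion e i \<omega>) \<in> ?M \<rightarrow>\<^sub>M PiM UNIV (\<lambda>_. count_space UNIV)"
    unfolding measurable_markov_cong by (rule measurable_excursions)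
  then show "prob_space (distr ?M (PiM UNIV (\<lambda>_. count_space UNIV)) (\<lambda>\<omega> i. excursion e i \<omega>))"
    by (rule M.prob_space_distr)
  show "prob_space (PiM (UNIV :: nat set) (\<lambda>_. excursion_law K e))"
    by (intro prob_space_PiM prob_space_excursion_law)
  show "sets (PiM (UNIV :: nat set) (\<lambda>_. excursion_law K e)) = sets (PiM UNIV (\<lambda>_. count_space UNIV))"
    by (intro sets_PiM_cong) (auto simp: excursion_law_def)
  show "AE w in PiM (UNIV :: nat set) (\<lambda>_. excursion_law K e). \<forall>i. w i \<in> excursion_words e"
    using assms by (rule AE_PiM_excursion_words)
  fix ws assume ws: "set ws \<subseteq> excursion_words e"
  have "emeasure (distr ?M (PiM UNIV (\<lambda>_. count_space UNIV)) (\<lambda>\<omega> i. excursion e i \<omega>)) (cylinder ws) =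
      emeasure ?M ((\<lambda>\<omega> i. excursion e i \<omega>) -` cylinder ws \<inter> space ?M)"
    by (intro emeasure_distr meas sets_cylinder)
  also have "\<dots> = emeasure ?M (cylinder (concat ws @ [e]))"
  proof (rule emeasure_eq_AE)
    show "AE \<omega> in ?M. (\<omega> \<in> (\<lambda>\<omega> i. excursion e i \<omega>) -` cylinder ws \<inter> space ?M) =
        (\<omega> \<in> cylinder (concat ws @ [e]))"
      using AE_markov_start[of e K]
      by (rule eventually_mono) (simp add: space_markov_measure excursions_in_cylinder_iff[OF ws])
    show "(\<lambda>\<omega> i. excursion e i \<omega>) -` cylinder ws \<inter> space ?M \<in> sets ?M"
      using meas by (rule measurable_sets) (rule sets_cylinder)
    show "cylinder (concat ws @ [e]) \<in> sets ?M"
      unfolding sets_markov_measure by (rule sets_cylinder)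
  qed
  also have "\<dots> = path_weight K (concat ws @ [e])"
    using ws by (cases ws) (auto simp: emeasure_markov_cylinder excursion_words_def)
  also have "\<dots> = (\<Prod>i<length ws. emeasure (excursion_law K e) {ws ! i})"
    unfolding path_weight_concat[OF ws] using ws
    by (intro prod.cong refl emeasure_excursion_law[symmetric]) (auto simp: subset_iff)
  also have "\<dots> = emeasure (PiM UNIV (\<lambda>_. excursion_law K e))
      (prod_emb UNIV (\<lambda>_. excursion_law K e) {..<length ws} (PiE {..<length ws} (\<lambda>i. {ws ! i})))"
    by (intro emeasure_PiM_emb[symmetric] prob_space_excursion_law) (auto simp: excursion_law_def)
  also have "prod_emb UNIV (\<lambda>_. excursion_law K e) {..<length ws} (PiE {..<length ws} (\<lambda>i. {ws ! i})) =
      cylinder ws"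
  proof (rule Set.set_eqI)
    fix w :: "nat \<Rightarrow> 'a list"
    show "w \<in> prod_emb UNIV (\<lambda>_. excursion_law K e) {..<length ws} (PiE {..<length ws} (\<lambda>i. {ws ! i})) \<longleftrightarrow>
        w \<in> cylinder ws"
      unfolding in_cylinder_iff by (simp add: prod_emb_def PiE_iff space_PiM excursion_law_def Ball_def)
  qed
  finally show "emeasure (distr ?M (PiM UNIV (\<lambda>_. count_space UNIV)) (\<lambda>\<omega> i. excursion e i \<omega>)) (cylinder ws) =
      emeasure (PiM UNIV (\<lambda>_. excursion_law K e)) (cylinder ws)" .
qed simp

section \<open>The stationary distribution\<close>

lemma emeasure_markov_step:
  fixes K :: "'e::countable \<Rightarrow> 'e pmf"
  shows "emeasure (markov_measure K e) {\<omega>. P (map \<omega> [0..<Suc n]) \<and> \<omega> n = y \<and> \<omega> (Suc n) = x} =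
    emeasure (markov_measure K e) {\<omega>. P (map \<omega> [0..<Suc n]) \<and> \<omega> n = y} * ennreal (pmf (K y) x)"
proof -
  let ?M = "markov_measure K e"
  let ?S = "{xs. length xs = Suc n \<and> P xs \<and> xs ! n = y}"
  have nth: "map \<omega> [0..<Suc n] ! n = \<omega> n" for \<omega> :: "nat \<Rightarrow> 'e"
    by (simp add: nth_append)
  have eq: "{\<omega>. P (map \<omega> [0..<Suc n]) \<and> \<omega> n = y \<and> \<omega> (Suc n) = x} = (\<Union>xs\<in>?S. cylinder (xs @ [x]))"
  proof (intro Set.set_eqI iffI)
    fix \<omega> assume "\<omega> \<in> {\<omega>. P (map \<omega> [0..<Suc n]) \<and> \<omega> n = y \<and> \<omega> (Suc n) = x}"
    then show "\<omega> \<in> (\<Union>xs\<in>?S. cylinder (xs @ [x]))"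
      by (intro UN_I[of "map \<omega> [0..<Suc n]"])
        (simp_all add: nth cylinder_append cylinder_Cons cylinder_def[of "map _ _"] del: upt_Suc)
  next
    fix \<omega> assume "\<omega> \<in> (\<Union>xs\<in>?S. cylinder (xs @ [x]))"
    then obtain xs where xs: "length xs = Suc n" "P xs" "xs ! n = y" "\<omega> \<in> cylinder (xs @ [x])"
      by blast
    then have "map \<omega> [0..<Suc n] = xs" "\<omega> (Suc n) = x"
      by (simp_all add: cylinder_append cylinder_Cons cylinder_def[of xs] del: upt_Suc)
    with xs nth[of \<omega>] show "\<omega> \<in> {\<omega>. P (map \<omega> [0..<Suc n]) \<and> \<omega> n = y \<and> \<omega> (Suc n) = x}"
      by simp
  qed
  have step: "emeasure ?M (cylinder (xs @ [x])) = emeasure ?M (cylinder xs) * ennreal (pmf (K y) x)"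
    if "xs \<in> ?S" for xs
  proof -
    have ne: "xs \<noteq> []" using that by auto
    then have "last xs = y" using that by (simp add: last_conv_nth)
    with ne obtain ys where xs: "xs = ys @ [y]"
      by (metis append_butlast_last_id)
    show ?thesis
      using path_weight_append[of K ys y "[x]"]
      by (simp add: xs emeasure_markov_cylinder) (simp add: hd_append)
  qed
  have "emeasure ?M {\<omega>. P (map \<omega> [0..<Suc n]) \<and> \<omega> n = y \<and> \<omega> (Suc n) = x} =
      (\<integral>\<^sup>+xs. emeasure ?M (cylinder (xs @ [x])) \<partial>count_space ?S)"
    unfolding eq
  proof (rule emeasure_UN_countable)
    show "disjoint_family_on (\<lambda>xs. cylinder (xs @ [x])) ?S"
      by (auto simp: disjoint_family_on_def cylinder_append cylinder_def)
    show "cylinder (xs @ [x]) \<in> sets ?M" for xs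
      unfolding sets_markov_measure by (rule sets_cylinder)
  qed (rule countableI_type)
  also have "\<dots> = (\<integral>\<^sup>+xs. emeasure ?M (cylinder xs) * ennreal (pmf (K y) x) \<partial>count_space ?S)"
    by (intro nn_integral_cong step) simp
  also have "\<dots> = (\<integral>\<^sup>+xs. emeasure ?M (cylinder xs) \<partial>count_space ?S) * ennreal (pmf (K y) x)"
    by (rule nn_integral_multc) simp
  also have "(\<integral>\<^sup>+xs. emeasure ?M (cylinder xs) \<partial>count_space ?S) =
      emeasure ?M {\<omega>. P (map \<omega> [0..<Suc n]) \<and> map \<omega> [0..<Suc n] ! n = y}"
    by (rule emeasure_prefix[symmetric, where P = "\<lambda>xs. P xs \<and> xs ! n = y"]) (rule sets_markov_measure)
  finally show ?thesis unfolding nth .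
qed

definition taboo_prob :: "('e::countable \<Rightarrow> 'e pmf) \<Rightarrow> 'e \<Rightarrow> nat \<Rightarrow> 'e \<Rightarrow> ennreal" where
  "taboo_prob K e n x = emeasure (markov_measure K e) {\<omega>. (\<forall>i\<in>{1..n}. \<omega> i \<noteq> e) \<and> \<omega> n = x}"

lemma sets_taboo:
  "{\<omega>. (\<forall>i\<in>{1..n}. \<omega> i \<noteq> e) \<and> \<omega> n = x} \<in> sets (markov_measure K (e' :: 'e::countable))"
proof -
  have "{\<omega> \<in> space (PiM UNIV (\<lambda>_. count_space UNIV)). (\<forall>i\<in>{1..n}. \<omega> i \<noteq> e) \<and> \<omega> n = x} \<in>
      sets (PiM UNIV (\<lambda>_. count_space (UNIV :: 'e set)))"
    by measurable
  then show ?thesis by (simp add: sets_markov_measure space_PiM)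
qed

lemma taboo_prob_Suc_self: "taboo_prob K e (Suc n) e = 0"
proof -
  have "{\<omega>. (\<forall>i\<in>{1..Suc n}. \<omega> i \<noteq> e) \<and> \<omega> (Suc n) = e} = {}"
    by auto
  then show ?thesis unfolding taboo_prob_def by (simp only: emeasure_empty)
qed

lemma taboo_prob_0: "taboo_prob K e 0 x = (if x = e then 1 else 0)"
proof -
  have "{\<omega>. (\<forall>i\<in>{1..0}. \<omega> i \<noteq> e) \<and> \<omega> 0 = x} = cylinder [x]"
    by (auto simp: cylinder_Cons)
  then show ?thesis
    unfolding taboo_prob_def by (simp add: emeasure_markov_cylinder)
qed

lemma taboo_prob_Suc_le:
  "taboo_prob K e (Suc n) x \<le> (\<integral>\<^sup>+y. taboo_prob K e n y * ennreal (pmf (K y) x) \<partial>count_space UNIV)"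
proof -
  let ?M = "markov_measure K e"
  let ?A = "\<lambda>y. {\<omega>. (\<forall>i\<in>{1..n}. map \<omega> [0..<Suc n] ! i \<noteq> e) \<and> \<omega> n = y \<and> \<omega> (Suc n) = x}"
  have nth: "(\<forall>i\<in>{1..n}. map \<omega> [0..<Suc n] ! i \<noteq> e) \<longleftrightarrow> (\<forall>i\<in>{1..n}. \<omega> i \<noteq> e)" for \<omega>
  proof (intro ball_cong refl)
    fix i assume "i \<in> {1..n}"
    then have "map \<omega> [0..<Suc n] ! i = \<omega> i" by (subst nth_map) (auto simp del: upt_Suc)
    then show "map \<omega> [0..<Suc n] ! i \<noteq> e \<longleftrightarrow> \<omega> i \<noteq> e" by simp
  qed
  have meas: "?A y \<in> sets ?M" for y
  proof -
    have "{\<omega> \<in> space (PiM UNIV (\<lambda>_. count_space UNIV)). (\<forall>i\<in>{1..n}. \<omega> i \<noteq> e) \<and> \<omega> n = y \<and> \<omega> (Suc n) = x} \<in>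
        sets (PiM UNIV (\<lambda>_. count_space UNIV))"
      by measurable
    then show ?thesis unfolding nth by (simp add: sets_markov_measure space_PiM)
  qed
  have "taboo_prob K e (Suc n) x \<le> emeasure ?M (\<Union>y. ?A y)"
    unfolding taboo_prob_def nth using meas[unfolded nth]
    by (intro emeasure_mono sets.countable_UN') auto
  also have "\<dots> = (\<integral>\<^sup>+y. emeasure ?M (?A y) \<partial>count_space UNIV)"
    by (intro emeasure_UN_countable meas countableI_type) (auto simp: disjoint_family_on_def)
  also have "\<dots> = (\<integral>\<^sup>+y. taboo_prob K e n y * ennreal (pmf (K y) x) \<partial>count_space UNIV)"
    unfolding emeasure_markov_step[where P = "\<lambda>xs. \<forall>i\<in>{1..n}. xs ! i \<noteq> e"]
    unfolding nth taboo_prob_def ..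
  finally show ?thesis .
qed

lemma stationary_eq_nn_integral:
  assumes "stationary K \<pi>"
  shows "ennreal (pmf \<pi> x) = (\<integral>\<^sup>+y. ennreal (pmf \<pi> y) * ennreal (pmf (K y) x) \<partial>count_space UNIV)"
proof -
  have "ennreal (pmf \<pi> x) = ennreal (pmf (bind_pmf \<pi> K) x)"
    using assms by (simp add: stationary_def)
  also have "\<dots> = (\<integral>\<^sup>+y. ennreal (pmf (K y) x) \<partial>measure_pmf \<pi>)"
    by (rule ennreal_pmf_bind)
  also have "\<dots> = (\<integral>\<^sup>+y. ennreal (pmf \<pi> y) * ennreal (pmf (K y) x) \<partial>count_space UNIV)"
    by (rule nn_integral_measure_pmf)
  finally show ?thesis .
qed

text \<open>Minimality of the excursion measure among the invariant measures.\<close>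

lemma sum_taboo_prob_le_stationary:
  assumes "stationary K \<pi>"
  shows "(\<Sum>n<N. taboo_prob K e n x) * ennreal (pmf \<pi> e) \<le> ennreal (pmf \<pi> x)"
proof (induction N arbitrary: x)
  case (Suc N)
  show ?case
  proof (cases "x = e")
    case True
    then show ?thesis
      by (simp only: sum.lessThan_Suc_shift) (simp add: taboo_prob_0 taboo_prob_Suc_self)
  next
    case False
    have "(\<Sum>n<Suc N. taboo_prob K e n x) = (\<Sum>n<N. taboo_prob K e (Suc n) x)"
      using False by (simp only: sum.lessThan_Suc_shift) (simp add: taboo_prob_0)
    also have "\<dots> \<le> (\<Sum>n<N. \<integral>\<^sup>+y. taboo_prob K e n y * ennreal (pmf (K y) x) \<partial>count_space UNIV)"
      by (intro sum_mono taboo_prob_Suc_le)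
    also have "\<dots> = (\<integral>\<^sup>+y. (\<Sum>n<N. taboo_prob K e n y) * ennreal (pmf (K y) x) \<partial>count_space UNIV)"
      by (subst nn_integral_sum[symmetric]) (auto simp: sum_distrib_right)
    finally have "(\<Sum>n<Suc N. taboo_prob K e n x) * ennreal (pmf \<pi> e) \<le>
        (\<integral>\<^sup>+y. (\<Sum>n<N. taboo_prob K e n y) * ennreal (pmf (K y) x) \<partial>count_space UNIV) * ennreal (pmf \<pi> e)"
      by (rule mult_right_mono) simp
    also have "\<dots> = (\<integral>\<^sup>+y. ((\<Sum>n<N. taboo_prob K e n y) * ennreal (pmf \<pi> e)) * ennreal (pmf (K y) x) \<partial>count_space UNIV)"
      by (subst nn_integral_multc[symmetric]) (auto simp: mult_ac)
    also have "\<dots> \<le> (\<integral>\<^sup>+y. ennreal (pmf \<pi> y) * ennreal (pmf (K y) x) \<partial>count_space UNIV)"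
      by (intro nn_integral_mono mult_right_mono Suc.IH) auto
    also have "\<dots> = ennreal (pmf \<pi> x)"
      by (rule stationary_eq_nn_integral[OF assms, symmetric])
    finally show ?thesis .
  qed
qed simp

lemma nn_integral_excursion_law_le:
  fixes K :: "'e::countable \<Rightarrow> 'e pmf" and f :: "'e \<Rightarrow> ennreal"
  assumes "stationary K \<pi>"
  shows "(\<integral>\<^sup>+w. (\<Sum>x\<leftarrow>w. f x) \<partial>excursion_law K e) * ennreal (pmf \<pi> e) \<le> (\<integral>\<^sup>+x. f x \<partial>measure_pmf \<pi>)"
proof -
  let ?M = "markov_measure K e"
  let ?A = "\<lambda>j x. {\<omega>. (\<forall>i\<in>{1..j}. \<omega> i \<noteq> e) \<and> \<omega> j = x}"
  let ?B = "\<lambda>j. {\<omega>. \<forall>i\<in>{1..j}. \<omega> i \<noteq> e}"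
  note [measurable] = sets_taboo
  have "(\<integral>\<^sup>+w. (\<Sum>x\<leftarrow>w. f x) \<partial>excursion_law K e) = (\<integral>\<^sup>+\<omega>. (\<Sum>x\<leftarrow>first_excursion e \<omega>. f x) \<partial>?M)"
    unfolding excursion_law_def by (rule nn_integral_distr[OF measurable_first_excursion_markov]) simp
  also have "\<dots> \<le> (\<integral>\<^sup>+\<omega>. (\<Sum>j. f (\<omega> j) * indicator (?B j) \<omega>) \<partial>?M)"
  proof (rule nn_integral_mono)
    fix \<omega> :: "nat \<Rightarrow> 'e"
    let ?n = "length (first_excursion e \<omega>)"
    have ne: "\<omega> i \<noteq> e" if "1 \<le> i" "i < ?n" for i
    proof -
      have "return_time e \<omega> < \<infinity>"
        using that by (auto simp: first_excursion_def split: if_splits)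
      then obtain n where n: "\<forall>i. 1 \<le> i \<longrightarrow> i < n \<longrightarrow> \<omega> i \<noteq> e" "return_time e \<omega> = enat n"
        by (rule return_time_finite)
      with that show ?thesis by (simp add: first_excursion_def)
    qed
    have "(\<Sum>x\<leftarrow>first_excursion e \<omega>. f x) = (\<Sum>x\<leftarrow>map \<omega> [0..<?n]. f x)"
      by (subst first_excursion_eq_map) simp
    also have "\<dots> = (\<Sum>j<?n. f (\<omega> j))"
      by (simp add: comp_def interv_sum_list_conv_sum_set_nat atLeast0LessThan)
    also have "\<dots> = (\<Sum>j<?n. f (\<omega> j) * indicator (?B j) \<omega>)"
      using ne by (intro sum.cong refl) (auto split: split_indicator)
    also have "\<dots> \<le> (\<Sum>j. f (\<omega> j) * indicator (?B j) \<omega>)"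
      by (intro sum_le_suminf) auto
    finally show "(\<Sum>x\<leftarrow>first_excursion e \<omega>. f x) \<le> (\<Sum>j. f (\<omega> j) * indicator (?B j) \<omega>)" .
  qed
  also have "\<dots> = (\<Sum>j. \<integral>\<^sup>+\<omega>. f (\<omega> j) * indicator (?B j) \<omega> \<partial>?M)"
  proof (rule nn_integral_suminf)
    fix j :: nat
    have "(\<lambda>\<omega>. f (\<omega> j)) \<in> PiM UNIV (\<lambda>_. count_space (UNIV :: 'e set)) \<rightarrow>\<^sub>M borel"
      by (rule measurable_compose[OF measurable_component_singleton[of j]]) auto
    moreover have "{\<omega> \<in> space (PiM UNIV (\<lambda>_. count_space UNIV)). \<forall>i\<in>{1..j}. \<omega> i \<noteq> e} \<in>
        sets (PiM UNIV (\<lambda>_. count_space (UNIV :: 'e set)))"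
      by measurable
    ultimately show "(\<lambda>\<omega>. f (\<omega> j) * indicator (?B j) \<omega>) \<in> borel_measurable ?M"
      unfolding measurable_markov_cong
      by (intro borel_measurable_times_ennreal borel_measurable_indicator) (auto simp: space_PiM)
  qed
  also have "\<dots> = (\<Sum>j. \<integral>\<^sup>+\<omega>. (\<integral>\<^sup>+x. f x * indicator (?A j x) \<omega> \<partial>count_space UNIV) \<partial>?M)"
  proof (intro suminf_cong nn_integral_cong)
    fix j :: nat and \<omega> :: "nat \<Rightarrow> 'e"
    have "(\<integral>\<^sup>+x. f x * indicator (?A j x) \<omega> \<partial>count_space UNIV) =
        (\<integral>\<^sup>+x. f x * indicator (?B j) \<omega> * indicator {\<omega> j} x \<partial>count_space UNIV)"
      by (intro nn_integral_cong) (auto split: split_indicator)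
    then show "f (\<omega> j) * indicator (?B j) \<omega> = (\<integral>\<^sup>+x. f x * indicator (?A j x) \<omega> \<partial>count_space UNIV)"
      by (simp add: nn_integral_indicator_singleton)
  qed
  also have "\<dots> = (\<Sum>j. \<integral>\<^sup>+x. (\<integral>\<^sup>+\<omega>. f x * indicator (?A j x) \<omega> \<partial>?M) \<partial>count_space UNIV)"
    by (intro suminf_cong nn_integral_count_space_nn_integral countableI_type
        borel_measurable_times_ennreal borel_measurable_indicator sets_taboo) auto
  also have "\<dots> = (\<Sum>j. \<integral>\<^sup>+x. f x * taboo_prob K e j x \<partial>count_space UNIV)"
    unfolding taboo_prob_def
    by (intro suminf_cong nn_integral_cong nn_integral_cmult_indicator sets_taboo)
  also have "\<dots> = (\<integral>\<^sup>+x. f x * (\<Sum>j. taboo_prob K e j x) \<partial>count_space UNIV)"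
    by (subst nn_integral_suminf[symmetric]) (auto simp: ennreal_suminf_cmult)
  finally have "(\<integral>\<^sup>+w. (\<Sum>x\<leftarrow>w. f x) \<partial>excursion_law K e) * ennreal (pmf \<pi> e) \<le>
      (\<integral>\<^sup>+x. f x * (\<Sum>j. taboo_prob K e j x) \<partial>count_space UNIV) * ennreal (pmf \<pi> e)"
    by (rule mult_right_mono) simp
  also have "\<dots> = (\<integral>\<^sup>+x. f x * ((\<Sum>j. taboo_prob K e j x) * ennreal (pmf \<pi> e)) \<partial>count_space UNIV)"
    by (subst nn_integral_multc[symmetric]) (auto simp: mult_ac)
  also have "\<dots> \<le> (\<integral>\<^sup>+x. f x * ennreal (pmf \<pi> x) \<partial>count_space UNIV)"
  proof (intro nn_integral_mono mult_left_mono)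
    fix x
    have "(\<Sum>j. taboo_prob K e j x) * ennreal (pmf \<pi> e) = (\<Sum>j. taboo_prob K e j x * ennreal (pmf \<pi> e))"
      by (rule ennreal_suminf_multc[symmetric])
    also have "\<dots> \<le> ennreal (pmf \<pi> x)"
      using sum_taboo_prob_le_stationary[OF assms, of e x]
      by (intro suminf_le_const) (auto simp: sum_distrib_right)
    finally show "(\<Sum>j. taboo_prob K e j x) * ennreal (pmf \<pi> e) \<le> ennreal (pmf \<pi> x)" .
  qed simp
  also have "\<dots> = (\<integral>\<^sup>+x. f x \<partial>measure_pmf \<pi>)"
    by (subst nn_integral_measure_pmf) (simp add: mult.commute)
  finally show ?thesis .
qed

lemma path_weight_eq_0:
  assumes "\<And>y. y \<in> D \<Longrightarrow> set_pmf (K y) \<subseteq> D" "xs \<noteq> []" "hd xs \<in> D" "\<not> set xs \<subseteq> D"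
  shows "path_weight K xs = 0"
  using assms(2-)
proof (induction xs rule: induct_list012)
  case (3 x y xs)
  show ?case
  proof (cases "y \<in> D")
    case True
    with 3 show ?thesis by simp
  next
    case False
    then have "pmf (K x) y = 0"
      using assms(1)[of x] 3 by (auto simp: pmf_eq_0_set_pmf)
    then show ?thesis by simp
  qed
qed auto

lemma stationary_pos:
  assumes "stationary K \<pi>" "markov_irreducible K"
  shows "0 < pmf \<pi> e"
proof (rule ccontr)
  assume "\<not> 0 < pmf \<pi> e"
  then have e: "e \<notin> set_pmf \<pi>"
    using pmf_nonneg[of \<pi> e] by (simp add: set_pmf_iff)
  obtain y where y: "y \<in> set_pmf \<pi>"
    using set_pmf_not_empty[of \<pi>] by auto
  have closed: "set_pmf (K z) \<subseteq> set_pmf \<pi>" if "z \<in> set_pmf \<pi>" for z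
    using that arg_cong[OF assms(1)[unfolded stationary_def], of set_pmf] by auto
  let ?M = "markov_measure K y"
  have "AE \<omega> in ?M. \<omega> n \<noteq> e" for n
  proof (rule AE_I')
    have "{\<omega>. map \<omega> [0..<Suc n] ! n = e} = (\<Union>xs\<in>{xs. length xs = Suc n \<and> xs ! n = e}. cylinder xs)"
      by (rule UN_cylinder_eq[symmetric])
    moreover have "(\<Union>xs\<in>{xs. length xs = Suc n \<and> xs ! n = e}. cylinder xs) \<in> null_sets ?M"
    proof (intro null_sets_UN' countableI_type)
      fix xs assume xs: "xs \<in> {xs. length xs = Suc n \<and> xs ! n = e}"
      then have "\<not> set xs \<subseteq> set_pmf \<pi>" "xs \<noteq> []"
        using e by (auto simp: subset_iff in_set_conv_nth)
      then have "emeasure ?M (cylinder xs) = 0"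
        using path_weight_eq_0[of "set_pmf \<pi>" K xs] closed y by (auto simp: emeasure_markov_cylinder)
      then show "cylinder xs \<in> null_sets ?M"
        by (simp add: null_sets_def sets_markov_measure)
    qed
    ultimately show "{\<omega>. map \<omega> [0..<Suc n] ! n = e} \<in> null_sets ?M" by simp
    show "{\<omega> \<in> space ?M. \<not> \<omega> n \<noteq> e} \<subseteq> {\<omega>. map \<omega> [0..<Suc n] ! n = e}"
      by (auto simp: nth_append)
  qed
  then have "AE \<omega> in ?M. \<forall>n. \<omega> n \<noteq> e"
    by (simp only: AE_all_countable) simp
  then have "AE \<omega> in ?M. \<not> return_time e \<omega> < \<infinity>"
    by (rule eventually_mono) (auto simp only: return_time_less_infinity_iff)
  then have "\<P>(\<omega> in ?M. return_time e \<omega> < \<infinity>) = 0"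
    by (intro prob_space.prob_eq_0_AE prob_space_markov_measure)
  with assms(2) show False
    unfolding markov_irreducible_def by (metis less_irrefl)
qed

section \<open>Norms on exterior powers\<close>

lemma norm_on_sum_le:
  assumes n: "norm_on S nrm" and S: "subspace S" and x: "\<And>i. i \<in> I \<Longrightarrow> x i \<in> S"
  shows "nrm (sum x I) \<le> (\<Sum>i\<in>I. nrm (x i))"
proof -
  have 0: "nrm 0 = 0"
    using n subspace_0[OF S] by (auto simp: norm_on_def)
  show ?thesis using x
  proof (induction I rule: infinite_finite_induct)
    case (insert i I)
    have "x i \<in> S" "sum x I \<in> S"
      using insert.prems by (auto intro!: subspace_sum[OF S])
    then have "nrm (x i + sum x I) \<le> nrm (x i) + nrm (sum x I)"
      using n unfolding norm_on_def by blast
    with insert show ?case by auto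
  qed (simp_all add: 0)
qed

lemma norm_on_scale: "norm_on S nrm \<Longrightarrow> x \<in> S \<Longrightarrow> nrm (r *\<^sub>R x) = \<bar>r\<bar> * nrm x"
  by (auto simp: norm_on_def)

lemma norm_on_nonneg: "norm_on S nrm \<Longrightarrow> x \<in> S \<Longrightarrow> 0 \<le> nrm x"
  by (auto simp: norm_on_def)

lemma norm_on_UNIV_norm: "norm_on UNIV norm"
  by (auto simp: norm_on_def norm_triangle_ineq)

text \<open>
  A norm on a finite-dimensional space is equivalent to the \<open>l\<^sup>1\<close> norm of the coordinates: by
  compactness it is bounded from below on the \<open>l\<^sup>1\<close> unit sphere.
\<close>

lemma norm_on_ge_coordinates:
  fixes B :: "'v::real_vector set"
  assumes fin: "finite B" and ind: "independent B" and n: "norm_on (span B) nrm"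
  shows "\<exists>C\<ge>0. \<forall>a::'v \<Rightarrow> real. (\<Sum>b\<in>B. \<bar>a b\<bar>) \<le> C * nrm (\<Sum>b\<in>B. a b *\<^sub>R b)"
proof (cases "B = {}")
  case False
  let ?x = "\<lambda>a::'v \<Rightarrow> real. \<Sum>b\<in>B. a b *\<^sub>R b"
  have x_in: "?x a \<in> span B" for a
    by (intro span_sum span_scale span_base)
  have B_in: "b \<in> span B" if "b \<in> B" for b
    using that by (rule span_base)
  have tri: "nrm (u + v) \<le> nrm u + nrm v" if "u \<in> span B" "v \<in> span B" for u v
    using n that by (auto simp: norm_on_def)
  have cont: "continuous_on UNIV (\<lambda>a. nrm (?x a))"
    unfolding continuous_on_def
  proof
    fix a0 :: "'v \<Rightarrow> real"
    have diff: "\<bar>nrm (?x a) - nrm (?x a0)\<bar> \<le> (\<Sum>b\<in>B. \<bar>a b - a0 b\<bar> * nrm b)" for a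
    proof -
      have le: "nrm (?x a) - nrm (?x a') \<le> (\<Sum>b\<in>B. \<bar>a b - a' b\<bar> * nrm b)" for a a'
      proof -
        have "nrm (?x a) = nrm (?x (\<lambda>b. a b - a' b) + ?x a')"
          by (simp add: algebra_simps sum_subtractf)
        also have "\<dots> \<le> nrm (?x (\<lambda>b. a b - a' b)) + nrm (?x a')"
          by (intro tri x_in)
        also have "nrm (?x (\<lambda>b. a b - a' b)) \<le> (\<Sum>b\<in>B. nrm ((a b - a' b) *\<^sub>R b))"
          by (intro norm_on_sum_le[OF n] subspace_span span_scale span_base)
        also have "\<dots> = (\<Sum>b\<in>B. \<bar>a b - a' b\<bar> * nrm b)"
          by (intro sum.cong refl norm_on_scale[OF n] span_base)
        finally show ?thesis by simp
      qed
      from le[of a a0] le[of a0 a] show ?thesis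
        by (simp add: abs_le_iff abs_minus_commute)
    qed
    have coord: "((\<lambda>a. a b) \<longlongrightarrow> a0 b) (at a0)" for b
      using continuous_on_product_coordinates[of b] by (auto simp: continuous_on_def)
    have "((\<lambda>a. \<Sum>b\<in>B. \<bar>a b - a0 b\<bar> * nrm b) \<longlongrightarrow> (\<Sum>b\<in>B. \<bar>a0 b - a0 b\<bar> * nrm b)) (at a0)"
      by (intro tendsto_intros coord)
    then have "((\<lambda>a. \<Sum>b\<in>B. \<bar>a b - a0 b\<bar> * nrm b) \<longlongrightarrow> 0) (at a0)"
      by simp
    then have "((\<lambda>a. nrm (?x a) - nrm (?x a0)) \<longlongrightarrow> 0) (at a0)"
      by (rule Lim_null_comparison[rotated]) (simp add: diff)
    then show "((\<lambda>a. nrm (?x a)) \<longlongrightarrow> nrm (?x a0)) (at a0 within UNIV)"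
      by (rule Lim_null[THEN iffD2])
  qed
  define X where "X b = (if b \<in> B then {-1..1::real} else {0})" for b
  define S where "S = PiE UNIV X \<inter> {a. (\<Sum>b\<in>B. \<bar>a b\<bar>) = 1}"
  have "compactin (product_topology (\<lambda>_::'v. euclidean) UNIV) (PiE UNIV X)"
    unfolding compactin_PiE by (auto simp: X_def)
  then have "compact (PiE UNIV X)"
    by (simp add: euclidean_product_topology)
  moreover have "closed {a::'v \<Rightarrow> real. (\<Sum>b\<in>B. \<bar>a b\<bar>) = 1}"
    by (intro closed_Collect_eq continuous_intros continuous_on_product_coordinates)
  ultimately have "compact S"
    unfolding S_def by (rule compact_Int_closed)
  obtain b0 where b0: "b0 \<in> B" using False by auto
  have "(\<lambda>b. if b = b0 then 1 else 0) \<in> S"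
    using b0 fin by (auto simp: S_def X_def PiE_iff if_distrib[of abs] cong: if_cong)
  then have "S \<noteq> {}" by auto
  obtain a0 where a0: "a0 \<in> S" and min: "\<And>a. a \<in> S \<Longrightarrow> nrm (?x a0) \<le> nrm (?x a)"
    using continuous_attains_inf[OF \<open>compact S\<close> \<open>S \<noteq> {}\<close> continuous_on_subset[OF cont]] by auto
  have "?x a0 \<noteq> 0"
  proof
    assume "?x a0 = 0"
    then have "\<forall>b\<in>B. a0 b = 0"
      using ind fin independentD by blast
    then show False using a0 by (simp add: S_def)
  qed
  then have pos: "0 < nrm (?x a0)"
    using n x_in[of a0] by (auto simp: norm_on_def less_le)
  have "(\<Sum>b\<in>B. \<bar>a b\<bar>) \<le> inverse (nrm (?x a0)) * nrm (?x a)" for a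
  proof (cases "(\<Sum>b\<in>B. \<bar>a b\<bar>) = 0")
    case True
    then show ?thesis using pos norm_on_nonneg[OF n x_in[of a]] by simp
  next
    case False
    define s where "s = (\<Sum>b\<in>B. \<bar>a b\<bar>)"
    have s: "0 < s" using False by (simp add: s_def less_le sum_nonneg)
    define a' where "a' b = (if b \<in> B then a b / s else 0)" for b
    have ab: "- s \<le> a b \<and> a b \<le> s" if "b \<in> B" for b
    proof -
      have "\<bar>a b\<bar> \<le> s"
        unfolding s_def using that fin by (intro member_le_sum) auto
      then show ?thesis by (simp add: abs_le_iff)
    qed
    then have "a' \<in> PiE UNIV X"
      using s by (auto simp: a'_def X_def PiE_iff field_simps)
    moreover have "(\<Sum>b\<in>B. \<bar>a' b\<bar>) = 1"
    proof -
      have "(\<Sum>b\<in>B. \<bar>a' b\<bar>) = (\<Sum>b\<in>B. \<bar>a b\<bar> / s)"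
        using s by (intro sum.cong) (simp_all add: a'_def)
      also have "\<dots> = s / s"
        by (simp only: sum_divide_distrib[symmetric] s_def[symmetric])
      finally show ?thesis using s by simp
    qed
    ultimately have "nrm (?x a0) \<le> nrm (?x a')"
      by (intro min) (simp add: S_def)
    also have "?x a' = (1 / s) *\<^sub>R ?x a"
      unfolding scaleR_sum_right by (intro sum.cong) (simp_all add: a'_def)
    also have "nrm \<dots> = nrm (?x a) / s"
      using s by (simp add: norm_on_scale[OF n x_in])
    finally show ?thesis
      using s pos by (simp add: s_def[symmetric] field_simps)
  qed
  then show ?thesis
    using pos by (intro exI[of _ "inverse (nrm (?x a0))"]) auto
qed auto

lemma span_eq_sum_coordinates:
  assumes "finite B" "x \<in> span B"
  obtains a where "x = (\<Sum>b\<in>B. a b *\<^sub>R b)"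
  using assms by (auto simp: span_finite)

lemma wedge_in_exterior_power: "length vs = k \<Longrightarrow> wedge vs \<in> exterior_power k"
  by (auto simp: exterior_power_def pure_wedges_def intro: span_base)

lemma wedge_sum:
  "wedge (us @ (\<Sum>b\<in>B. a b *\<^sub>R b) # ws) = (\<Sum>b\<in>B. a b *\<^sub>R wedge (us @ b # ws))"
  using linear_sum[OF linear_wedge[of us ws], of "\<lambda>b. a b *\<^sub>R b" B]
    linear_scale[OF linear_wedge[of us ws]] by simp

context
  fixes nrm :: "nat \<Rightarrow> 'a::real_normed_vector multivector \<Rightarrow> real"
  assumes fin_dim: "\<exists>B::'a set. finite B \<and> span B = UNIV"
    and nrm: "\<And>k. norm_on (exterior_power k) (nrm k)"
begin

lemma coordinates_bound:
  obtains D :: "'a set" and C where "finite D" "0 \<le> C"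
    "\<And>u. \<exists>a. u = (\<Sum>d\<in>D. a d *\<^sub>R d) \<and> (\<Sum>d\<in>D. \<bar>a d\<bar>) \<le> C * norm u"
proof -
  obtain B :: "'a set" where B: "finite B" "span B = UNIV" using fin_dim by auto
  obtain D where D: "D \<subseteq> B" "independent D" "B \<subseteq> span D"
    by (rule maximal_independent_subset)
  then have span: "span D = UNIV"
    using B by (metis span_mono span_span top.extremum_unique)
  have fin: "finite D" using D(1) B(1) by (rule finite_subset)
  obtain C where C: "0 \<le> C" "\<And>a. (\<Sum>d\<in>D. \<bar>a d\<bar>) \<le> C * norm (\<Sum>d\<in>D. a d *\<^sub>R d)"
    using norm_on_ge_coordinates[OF fin D(2), of norm] span norm_on_UNIV_norm by auto
  show thesis
  proof (rule that[OF fin C(1)])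
    fix u :: 'a
    obtain a where "u = (\<Sum>d\<in>D. a d *\<^sub>R d)"
      using span_eq_sum_coordinates[OF fin, of u] span by auto
    with C(2)[of a] show "\<exists>a. u = (\<Sum>d\<in>D. a d *\<^sub>R d) \<and> (\<Sum>d\<in>D. \<bar>a d\<bar>) \<le> C * norm u"
      by auto
  qed
qed

lemma norm_wedge_bound: "\<exists>M\<ge>0. \<forall>us. length us = k \<longrightarrow> nrm k (wedge us) \<le> M * (\<Prod>u\<leftarrow>us. norm u)"
proof -
  obtain D :: "'a set" and C where D: "finite D" "0 \<le> C"
    and coord: "\<And>u. \<exists>a. u = (\<Sum>d\<in>D. a d *\<^sub>R d) \<and> (\<Sum>d\<in>D. \<bar>a d\<bar>) \<le> C * norm u"
    by (rule coordinates_bound) blast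
  let ?L = "{ds. set ds \<subseteq> D \<and> length ds = k}"
  have finL: "finite ?L" using D by (intro finite_lists_length_eq) auto
  define M where "M = (\<Sum>ds\<in>?L. nrm k (wedge ds))"
  have nn: "0 \<le> nrm k (wedge vs)" if "length vs = k" for vs
    using norm_on_nonneg[OF nrm wedge_in_exterior_power[OF that]] .
  have M: "nrm k (wedge ds) \<le> M" if "ds \<in> ?L" for ds
    unfolding M_def using that finL nn by (intro member_le_sum) auto
  have M0: "0 \<le> M" unfolding M_def using nn by (intro sum_nonneg) auto
  have claim: "nrm k (wedge (ds @ us)) \<le> M * C ^ length us * (\<Prod>u\<leftarrow>us. norm u)"
    if "set ds \<subseteq> D" "length ds + length us = k" for ds us
    using that
  proof (induction us arbitrary: ds)
    case Nil
    then show ?case using M[of ds] by simp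
  next
    case (Cons u us)
    obtain a where a: "u = (\<Sum>d\<in>D. a d *\<^sub>R d)" "(\<Sum>d\<in>D. \<bar>a d\<bar>) \<le> C * norm u"
      using coord by blast
    let ?R = "M * C ^ length us * (\<Prod>u\<leftarrow>us. norm u)"
    have R: "0 \<le> ?R" using M0 D by (intro mult_nonneg_nonneg prod_list_nonneg) auto
    have in_ext: "wedge (ds @ d # us) \<in> exterior_power k" for d
      using Cons.prems by (intro wedge_in_exterior_power) simp
    have sub: "subspace (exterior_power k :: 'a multivector set)"
      by (simp add: exterior_power_def)
    have "nrm k (wedge (ds @ u # us)) = nrm k (\<Sum>d\<in>D. a d *\<^sub>R wedge (ds @ d # us))"
      unfolding a(1) wedge_sum ..
    also have "\<dots> \<le> (\<Sum>d\<in>D. nrm k (a d *\<^sub>R wedge (ds @ d # us)))"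
      by (intro norm_on_sum_le[OF nrm] sub subspace_scale[OF sub] in_ext)
    also have "\<dots> = (\<Sum>d\<in>D. \<bar>a d\<bar> * nrm k (wedge (ds @ d # us)))"
      by (intro sum.cong refl norm_on_scale[OF nrm] in_ext)
    also have "\<dots> \<le> (\<Sum>d\<in>D. \<bar>a d\<bar> * ?R)"
    proof (intro sum_mono mult_left_mono)
      fix d assume "d \<in> D"
      then show "nrm k (wedge (ds @ d # us)) \<le> ?R"
        using Cons.IH[of "ds @ [d]"] Cons.prems by simp
    qed simp
    also have "\<dots> = (\<Sum>d\<in>D. \<bar>a d\<bar>) * ?R" by (simp add: sum_distrib_right)
    also have "\<dots> \<le> (C * norm u) * ?R" by (intro mult_right_mono a R)
    also have "\<dots> = M * C ^ length (u # us) * (\<Prod>u\<leftarrow>u # us. norm u)" by simp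
    finally show ?case .
  qed
  show ?thesis
    using claim[of "[]"] M0 D by (intro exI[of _ "M * C ^ k"]) auto
qed

lemma exterior_power_finite_basis:
  obtains B :: "'a multivector set"
    where "finite B" "independent B" "span B = exterior_power k" "B \<subseteq> pure_wedges k"
proof -
  obtain D :: "'a set" and C where D: "finite D" "0 \<le> C"
    and coord: "\<And>u. \<exists>a. u = (\<Sum>d\<in>D. a d *\<^sub>R d) \<and> (\<Sum>d\<in>D. \<bar>a d\<bar>) \<le> C * norm u"
    by (rule coordinates_bound) blast
  let ?L = "{ds. set ds \<subseteq> D \<and> length ds = k}"
  have finL: "finite ?L" using D by (intro finite_lists_length_eq) auto
  have claim: "wedge (ds @ us) \<in> span (wedge ` ?L)"
    if "set ds \<subseteq> D" "length ds + length us = k" for ds us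
    using that
  proof (induction us arbitrary: ds)
    case Nil
    then show ?case by (auto intro: span_base)
  next
    case (Cons u us)
    obtain a where a: "u = (\<Sum>d\<in>D. a d *\<^sub>R d)" using coord by blast
    have "wedge (ds @ d # us) \<in> span (wedge ` ?L)" if "d \<in> D" for d
      using Cons.IH[of "ds @ [d]"] Cons.prems that by simp
    then show ?case unfolding a wedge_sum by (intro span_sum span_scale)
  qed
  obtain B where B: "B \<subseteq> wedge ` ?L" "independent B" "wedge ` ?L \<subseteq> span B"
    by (rule maximal_independent_subset)
  have sub: "B \<subseteq> pure_wedges k" using B(1) by (auto simp: pure_wedges_def)
  have "pure_wedges k \<subseteq> span B"
  proof
    fix x :: "'a multivector" assume "x \<in> pure_wedges k"
    then have "x \<in> span (wedge ` ?L)" using claim[of "[]"] by (auto simp: pure_wedges_def)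
    moreover have "span (wedge ` ?L) \<subseteq> span B" using B(3) by (intro span_minimal subspace_span)
    ultimately show "x \<in> span B" by auto
  qed
  then have "span B = exterior_power k"
    unfolding exterior_power_def using span_mono[OF sub] span_minimal[OF _ subspace_span] by blast
  then show thesis using that[of B] B(2) sub finite_subset[OF B(1) finite_imageI[OF finL]] by blast
qed

lemma norm_exterior_map_bound:
  "\<exists>C>0. \<forall>L. bounded_linear L \<longrightarrow>
    (\<forall>x\<in>exterior_power k. nrm k (exterior_map L x) \<le> C * onorm L ^ k * nrm k x)"
proof -
  obtain B :: "'a multivector set" where B: "finite B" "independent B" "span B = exterior_power k" "B \<subseteq> pure_wedges k"
    by (rule exterior_power_finite_basis)
  obtain C where C: "0 \<le> C" "\<And>a. (\<Sum>b\<in>B. \<bar>a b\<bar>) \<le> C * nrm k (\<Sum>b\<in>B. a b *\<^sub>R b)"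
    using norm_on_ge_coordinates[OF B(1,2), of "nrm k"] B(3) nrm by auto
  obtain M where M: "0 \<le> M" "\<And>us. length us = k \<Longrightarrow> nrm k (wedge us) \<le> M * (\<Prod>u\<leftarrow>us. norm u)"
    using norm_wedge_bound by blast
  have "\<exists>vs. length vs = k \<and> b = wedge vs" if "b \<in> B" for b
    using that B(4) by (auto simp: pure_wedges_def)
  then obtain vs where vs: "\<And>b. b \<in> B \<Longrightarrow> length (vs b) = k \<and> b = wedge (vs b)"
    by metis
  define Q where "Q = (\<Sum>b\<in>B. \<Prod>v\<leftarrow>vs b. norm v)"
  have pn: "0 \<le> (\<Prod>v\<leftarrow>us. norm v)" for us :: "'a list"
    by (induction us) auto
  have Q0: "0 \<le> Q" unfolding Q_def by (intro sum_nonneg pn)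
  have Q: "(\<Prod>v\<leftarrow>vs b. norm v) \<le> Q" if "b \<in> B" for b
    unfolding Q_def using that B(1) pn by (intro member_le_sum) auto
  show ?thesis
  proof (intro exI[of _ "C * (M * Q) + 1"] conjI allI impI ballI)
    show "0 < C * (M * Q) + 1"
      using C M Q0 by (simp add: add_nonneg_pos)
    fix L :: "'a \<Rightarrow> 'a" and x :: "'a multivector"
    assume L: "bounded_linear L" and x: "x \<in> exterior_power k"
    have o0: "0 \<le> onorm L" using L by (rule onorm_pos_le)
    have Lb: "nrm k (exterior_map L b) \<le> M * Q * onorm L ^ k" if "b \<in> B" for b
    proof -
      have prod: "(\<Prod>u\<leftarrow>map L us. norm u) \<le> onorm L ^ length us * (\<Prod>u\<leftarrow>us. norm u)" for us
      proof (induction us)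
        case (Cons u us)
        have "norm (L u) * (\<Prod>u\<leftarrow>map L us. norm u) \<le>
            (onorm L * norm u) * (onorm L ^ length us * (\<Prod>u\<leftarrow>us. norm u))"
          using Cons onorm[OF L] o0 pn pn[of "map L us"] by (intro mult_mono) auto
        then show ?case by (simp add: mult_ac)
      qed simp
      have "nrm k (exterior_map L b) = nrm k (wedge (map L (vs b)))"
        using vs[OF that] exterior_map_wedge[OF bounded_linear.linear[OF L], of "vs b"] by simp
      also have "\<dots> \<le> M * (\<Prod>u\<leftarrow>map L (vs b). norm u)"
        using vs[OF that] by (intro M) simp
      also have "\<dots> \<le> M * (onorm L ^ k * (\<Prod>u\<leftarrow>vs b. norm u))"
        using prod[of "vs b"] vs[OF that] M by (intro mult_left_mono) auto
      also have "\<dots> \<le> M * (onorm L ^ k * Q)"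
        using Q[OF that] M o0 by (intro mult_left_mono) auto
      finally show ?thesis by (simp add: mult_ac)
    qed
    obtain a where a: "x = (\<Sum>b\<in>B. a b *\<^sub>R b)"
      using span_eq_sum_coordinates[OF B(1), of x] x B(3) by auto
    have sub: "subspace (exterior_power k :: 'a multivector set)"
      by (simp add: exterior_power_def)
    have in_ext: "exterior_map L b \<in> exterior_power k" if "b \<in> B" for b
      using vs[OF that] exterior_map_wedge[OF bounded_linear.linear[OF L], of "vs b"]
      by (auto intro: wedge_in_exterior_power)
    have "exterior_map L x = (\<Sum>b\<in>B. a b *\<^sub>R exterior_map L b)"
      unfolding a by (simp add: linear_sum[OF linear_exterior_map] linear_scale[OF linear_exterior_map])
    then have "nrm k (exterior_map L x) \<le> (\<Sum>b\<in>B. nrm k (a b *\<^sub>R exterior_map L b))"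
      by (simp add: norm_on_sum_le[OF nrm sub] subspace_scale[OF sub] in_ext)
    also have "\<dots> = (\<Sum>b\<in>B. \<bar>a b\<bar> * nrm k (exterior_map L b))"
      by (intro sum.cong refl norm_on_scale[OF nrm] in_ext)
    also have "\<dots> \<le> (\<Sum>b\<in>B. \<bar>a b\<bar> * (M * Q * onorm L ^ k))"
      by (intro sum_mono mult_left_mono Lb) auto
    also have "\<dots> = (\<Sum>b\<in>B. \<bar>a b\<bar>) * (M * Q * onorm L ^ k)"
      by (simp add: sum_distrib_right)
    also have "\<dots> \<le> (C * nrm k x) * (M * Q * onorm L ^ k)"
      unfolding a using M Q0 o0 by (intro mult_right_mono C mult_nonneg_nonneg) auto
    also have "\<dots> = (C * (M * Q)) * (onorm L ^ k * nrm k x)" by (simp add: mult_ac)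
    also have "\<dots> \<le> (C * (M * Q) + 1) * (onorm L ^ k * nrm k x)"
      using norm_on_nonneg[OF nrm x] o0 by (intro mult_right_mono) auto
    finally show "nrm k (exterior_map L x) \<le> (C * (M * Q) + 1) * onorm L ^ k * nrm k x"
      by (simp add: mult_ac)
  qed
qed

end

section \<open>The adjoint representation\<close>

lemma has_derivative_eventually_eq:
  assumes f: "(f has_derivative f') (at x)" and ev: "\<forall>\<^sub>F s in nhds x. f s = g s"
  shows "(g has_derivative f') (at x)"
proof -
  obtain S where S: "open S" "x \<in> S" "\<And>s. s \<in> S \<Longrightarrow> f s = g s"
    using ev by (auto simp: eventually_nhds)
  show ?thesis
    by (rule has_derivative_transform_within_open[OF f S])
qed

context lie_group
begin

interpretation G: group G by (rule group)

lemma chart_inv [simp]: "(V, \<rho>) \<in> A \<Longrightarrow> x \<in> V \<Longrightarrow> inv_into V \<rho> (\<rho> x) = x"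
proof (rule inv_into_f_f)
  assume V: "(V, \<rho>) \<in> A"
  have "openin T V" "homeomorphic_map (subtopology T V) (top_of_set (\<rho> ` V)) \<rho>"
    using chart[OF V] by auto
  then show "inj_on \<rho> V"
    using openin_subset[of T V] by (simp add: homeomorphic_map_def Int_absorb1)
qed

lemma chart_subset: "(V, \<rho>) \<in> A \<Longrightarrow> V \<subseteq> carrier G"
  using chart[of V \<rho>] by (auto simp: topspace[symmetric] dest: openin_subset)

lemma eventually_chart:
  assumes V: "(V, \<rho>) \<in> A" "x \<in> V" and F: "continuous_map T T F" and W: "openin T W" "F x \<in> W"
  shows "\<forall>\<^sub>F s in nhds (\<rho> x). s \<in> \<rho> ` V \<and> F (inv_into V \<rho> s) \<in> W"
proof -
  have c: "openin T V" "open (\<rho> ` V)" "homeomorphic_map (subtopology T V) (top_of_set (\<rho> ` V)) \<rho>"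
    using chart[OF V(1)] by auto
  have "openin T {y \<in> topspace T. F y \<in> W}"
    using F W(1) by (rule openin_continuous_map_preimage)
  then have "openin (subtopology T V) ({y \<in> topspace T. F y \<in> W} \<inter> V)"
    by (rule openin_subtopology_Int)
  then have "openin (top_of_set (\<rho> ` V)) (\<rho> ` ({y \<in> topspace T. F y \<in> W} \<inter> V))"
    using homeomorphic_imp_open_map[OF c(3)] by (auto simp: open_map_def)
  then have op: "open (\<rho> ` ({y \<in> topspace T. F y \<in> W} \<inter> V))"
    using c(2) by (simp add: openin_open_eq)
  have "x \<in> topspace T" using V chart_subset topspace by auto
  then have "\<rho> x \<in> \<rho> ` ({y \<in> topspace T. F y \<in> W} \<inter> V)" using V W by auto
  with op have "\<forall>\<^sub>F s in nhds (\<rho> x). s \<in> \<rho> ` ({y \<in> topspace T. F y \<in> W} \<inter> V)"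
    by (rule eventually_nhds_in_open)
  then show ?thesis
    by (rule eventually_mono) (use V in auto)
qed

lemma continuous_left_mult: "g \<in> carrier G \<Longrightarrow> continuous_map T T (\<lambda>y. g \<otimes> y)"
  using continuous_map_compose[OF _ mult_continuous, of T "\<lambda>y. (g, y)"]
  by (simp add: comp_def topspace continuous_map_paired)

lemma continuous_right_mult: "g \<in> carrier G \<Longrightarrow> continuous_map T T (\<lambda>y. y \<otimes> g)"
  using continuous_map_compose[OF _ mult_continuous, of T "\<lambda>y. (y, g)"]
  by (simp add: comp_def topspace continuous_map_paired)

lemma continuous_conj: "g \<in> carrier G \<Longrightarrow> continuous_map T T (\<lambda>y. g \<otimes> y \<otimes> inv g)"
  using continuous_map_compose[OF continuous_left_mult continuous_right_mult, of g "inv g"]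
  by (simp add: comp_def)

lemma mult_differentiable:
  assumes "(V, \<rho>) \<in> A" "(V', \<rho>') \<in> A" "(W, \<sigma>) \<in> A" "x \<in> V" "y \<in> V'" "x \<otimes> y \<in> W"
  shows "(\<lambda>p. \<sigma> (inv_into V \<rho> (fst p) \<otimes> inv_into V' \<rho>' (snd p))) differentiable (at (\<rho> x, \<rho>' y))"
proof -
  let ?S = "{(\<rho> x, \<rho>' y) | x y. x \<in> V \<and> y \<in> V' \<and> x \<otimes> y \<in> W}"
  have "C_diff (Suc 0) ?S (\<lambda>(s, t). \<sigma> (inv_into V \<rho> s \<otimes> inv_into V' \<rho>' t))"
    using mult_smooth[OF assms(1-3)] unfolding smooth_on_def by blast
  moreover have "(\<rho> x, \<rho>' y) \<in> ?S" using assms by blast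
  ultimately have "(\<lambda>(s, t). \<sigma> (inv_into V \<rho> s \<otimes> inv_into V' \<rho>' t)) differentiable (at (\<rho> x, \<rho>' y))"
    unfolding C_diff.simps by blast
  then show ?thesis by (simp only: case_prod_unfold)
qed

end

locale identity_chart = lie_group G T A
  for G :: "('g, 'm) monoid_scheme" (structure) and T :: "'g topology"
    and A :: "('g set \<times> ('g \<Rightarrow> 'a::real_normed_vector)) set" +
  fixes U :: "'g set" and \<phi> :: "'g \<Rightarrow> 'a"
  assumes U: "(U, \<phi>) \<in> A" and one_in: "\<one> \<in> U"
begin

interpretation G: group G by (rule group)

abbreviation conj_chart :: "'g \<Rightarrow> 'a \<Rightarrow> 'a" where
  "conj_chart g s \<equiv> \<phi> (g \<otimes> inv_into U \<phi> s \<otimes> inv g)"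

lemma conj_chart_one: "g \<in> carrier G \<Longrightarrow> conj_chart g (\<phi> \<one>) = \<phi> \<one>"
  using U one_in by simp

lemma conj_chart_differentiable:
  assumes g: "g \<in> carrier G"
  shows "conj_chart g differentiable (at (\<phi> \<one>))"
proof -
  obtain V \<rho> where V: "(V, \<rho>) \<in> A" "g \<in> V"
    using g charts_cover by blast
  have "inv g \<in> carrier G" using g by simp
  then obtain V' \<rho>' where V': "(V', \<rho>') \<in> A" "inv g \<in> V'"
    using charts_cover by blast
  let ?F = "\<lambda>p. \<rho> (inv_into V \<rho> (fst p) \<otimes> inv_into U \<phi> (snd p))"
  let ?H = "\<lambda>p. \<phi> (inv_into V \<rho> (fst p) \<otimes> inv_into V' \<rho>' (snd p))"
  let ?h = "\<lambda>s. \<rho> (g \<otimes> inv_into U \<phi> s)"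
  have "?F differentiable (at (\<rho> g, \<phi> \<one>))"
    using V U one_in g by (intro mult_differentiable) auto
  then obtain F' where F': "(?F has_derivative F') (at (\<rho> g, \<phi> \<one>))"
    unfolding differentiable_def by blast
  have "((\<lambda>s. ?F (\<rho> g, s)) has_derivative (\<lambda>s. F' (0, s))) (at (\<phi> \<one>))"
    by (rule has_derivative_compose[where f = "\<lambda>s. (\<rho> g, s)" and g = ?F, OF _ F'])
      (auto intro!: derivative_eq_intros)
  then have h: "(?h has_derivative (\<lambda>s. F' (0, s))) (at (\<phi> \<one>))"
    using V by simp
  have h1: "?h (\<phi> \<one>) = \<rho> g" using U one_in g by simp
  have "?H differentiable (at (\<rho> g, \<rho>' (inv g)))"
    using V V' U one_in g by (intro mult_differentiable) auto
  then obtain H' where H': "(?H has_derivative H') (at (\<rho> g, \<rho>' (inv g)))"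
    unfolding differentiable_def by blast
  have "((\<lambda>s. ?H (?h s, \<rho>' (inv g))) has_derivative (\<lambda>s. H' (F' (0, s), 0))) (at (\<phi> \<one>))"
  proof (rule has_derivative_compose[where f = "\<lambda>s. (?h s, \<rho>' (inv g))" and g = ?H])
    show "((\<lambda>s. (?h s, \<rho>' (inv g))) has_derivative (\<lambda>s. (F' (0, s), 0))) (at (\<phi> \<one>))"
      by (intro has_derivative_Pair h) simp
    show "(?H has_derivative H') (at (?h (\<phi> \<one>), \<rho>' (inv g)))"
      unfolding h1 by (rule H')
  qed
  moreover have "\<forall>\<^sub>F s in nhds (\<phi> \<one>). ?H (?h s, \<rho>' (inv g)) = conj_chart g s"
  proof -
    have "openin T V" using chart[OF V(1)] by simp
    then have "\<forall>\<^sub>F s in nhds (\<phi> \<one>). s \<in> \<phi> ` U \<and> g \<otimes> inv_into U \<phi> s \<in> V"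
      using g V by (intro eventually_chart U one_in continuous_left_mult) auto
    then show ?thesis
      by (rule eventually_mono) (use V V' in auto)
  qed
  ultimately have "(conj_chart g has_derivative (\<lambda>s. H' (F' (0, s), 0))) (at (\<phi> \<one>))"
    by (rule has_derivative_eventually_eq)
  then show ?thesis by (auto simp: differentiable_def)
qed

lemma Ad_has_derivative:
  "g \<in> carrier G \<Longrightarrow> (conj_chart g has_derivative Ad G U \<phi> g) (at (\<phi> \<one>))"
  unfolding Ad_def using conj_chart_differentiable frechet_derivative_works by blast

lemma bounded_linear_Ad: "g \<in> carrier G \<Longrightarrow> bounded_linear (Ad G U \<phi> g)"
  using Ad_has_derivative by (rule has_derivative_bounded_linear)

lemma Ad_mult:
  assumes g: "g \<in> carrier G" and h: "h \<in> carrier G"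
  shows "Ad G U \<phi> (g \<otimes> h) = Ad G U \<phi> g \<circ> Ad G U \<phi> h"
proof -
  have "((\<lambda>s. conj_chart g (conj_chart h s)) has_derivative (\<lambda>s. Ad G U \<phi> g (Ad G U \<phi> h s))) (at (\<phi> \<one>))"
    by (rule has_derivative_compose[OF Ad_has_derivative[OF h]])
      (unfold conj_chart_one[OF h], rule Ad_has_derivative[OF g])
  moreover have "\<forall>\<^sub>F s in nhds (\<phi> \<one>). conj_chart g (conj_chart h s) = conj_chart (g \<otimes> h) s"
  proof -
    have "openin T U" using chart[OF U] by simp
    then have "\<forall>\<^sub>F s in nhds (\<phi> \<one>). s \<in> \<phi> ` U \<and> h \<otimes> inv_into U \<phi> s \<otimes> inv h \<in> U"
      using h one_in by (intro eventually_chart U one_in continuous_conj) auto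
    then show ?thesis
    proof (rule eventually_mono)
      fix s assume s: "s \<in> \<phi> ` U \<and> h \<otimes> inv_into U \<phi> s \<otimes> inv h \<in> U"
      then have "inv_into U \<phi> s \<in> carrier G"
        using U chart_subset[OF U] by auto
      then have "g \<otimes> (h \<otimes> inv_into U \<phi> s \<otimes> inv h) \<otimes> inv g =
          g \<otimes> h \<otimes> inv_into U \<phi> s \<otimes> inv (g \<otimes> h)"
        using g h by (simp add: G.inv_mult_group G.m_assoc)
      then show "conj_chart g (conj_chart h s) = conj_chart (g \<otimes> h) s"
        using s U by simp
    qed
  qed
  ultimately have "(conj_chart (g \<otimes> h) has_derivative (\<lambda>s. Ad G U \<phi> g (Ad G U \<phi> h s))) (at (\<phi> \<one>))"
    by (rule has_derivative_eventually_eq)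
  moreover have "(conj_chart (g \<otimes> h) has_derivative Ad G U \<phi> (g \<otimes> h)) (at (\<phi> \<one>))"
    using g h by (intro Ad_has_derivative) simp
  ultimately show ?thesis
    by (auto simp: comp_def dest: has_derivative_unique)
qed

lemma Ad_one: "Ad G U \<phi> \<one> = id"
proof -
  have "\<forall>\<^sub>F s in nhds (\<phi> \<one>). conj_chart \<one> s = s"
  proof -
    have "openin T U" using chart[OF U] by simp
    then have "\<forall>\<^sub>F s in nhds (\<phi> \<one>). s \<in> \<phi> ` U \<and> inv_into U \<phi> s \<in> U"
      using one_in eventually_chart[OF U one_in continuous_map_id[unfolded id_def]] by simp
    then show ?thesis
      by (rule eventually_mono) (use U chart_subset[OF U] in \<open>auto simp: subset_iff\<close>)
  qed
  then have "\<forall>\<^sub>F s in nhds (\<phi> \<one>). s = conj_chart \<one> s"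
    by (rule eventually_mono) simp
  then have "(conj_chart \<one> has_derivative (\<lambda>s. s)) (at (\<phi> \<one>))"
    by (rule has_derivative_eventually_eq[OF has_derivative_ident])
  moreover have "(conj_chart \<one> has_derivative Ad G U \<phi> \<one>) (at (\<phi> \<one>))"
    by (intro Ad_has_derivative) simp
  ultimately show ?thesis
    by (auto simp: id_def dest: has_derivative_unique)
qed

lemma Ad_inverse:
  assumes g: "g \<in> carrier G"
  shows "Ad G U \<phi> g \<circ> Ad G U \<phi> (inv g) = id" "Ad G U \<phi> (inv g) \<circ> Ad G U \<phi> g = id"
  using g Ad_mult[of g "inv g"] Ad_mult[of "inv g" g] by (simp_all add: Ad_one)

lemma inv_into_Ad:
  assumes g: "g \<in> carrier G"
  shows "inv_into UNIV (Ad G U \<phi> g) = Ad G U \<phi> (inv g)"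
  by (rule inv_unique_comp[OF Ad_inverse[OF g]])

lemma onorm_Ad_inv_le: "g \<in> carrier G \<Longrightarrow> onorm (Ad G U \<phi> (inv g)) \<le> Ad_size G U \<phi> g"
  by (simp add: Ad_size_def inv_into_Ad)

lemma Ad_size_ge_1:
  assumes g: "g \<in> carrier G" and "(v::'a) \<noteq> 0"
  shows "1 \<le> Ad_size G U \<phi> g"
proof -
  have "norm v = norm (Ad G U \<phi> g (Ad G U \<phi> (inv g) v))"
    using fun_cong[OF Ad_inverse(1)[OF g], of v] by simp
  also have "\<dots> \<le> onorm (Ad G U \<phi> g) * norm (Ad G U \<phi> (inv g) v)"
    by (intro onorm bounded_linear_Ad g)
  also have "\<dots> \<le> Ad_size G U \<phi> g * (Ad_size G U \<phi> g * norm v)"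
  proof (intro mult_mono)
    show "onorm (Ad G U \<phi> g) \<le> Ad_size G U \<phi> g" by (simp add: Ad_size_def)
    then show "0 \<le> Ad_size G U \<phi> g"
      using onorm_pos_le[OF bounded_linear_Ad[OF g]] by linarith
    have "norm (Ad G U \<phi> (inv g) v) \<le> onorm (Ad G U \<phi> (inv g)) * norm v"
      using g by (intro onorm bounded_linear_Ad) simp
    also have "\<dots> \<le> Ad_size G U \<phi> g * norm v"
      by (intro mult_right_mono onorm_Ad_inv_le g) simp
    finally show "norm (Ad G U \<phi> (inv g) v) \<le> Ad_size G U \<phi> g * norm v" .
  qed simp
  finally have "1 \<le> Ad_size G U \<phi> g * Ad_size G U \<phi> g"
    using assms(2) by (simp add: mult.assoc[symmetric])
  moreover have "0 \<le> Ad_size G U \<phi> g"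
    using onorm_pos_le[OF bounded_linear_Ad[OF g]] by (simp add: Ad_size_def le_max_iff_disj)
  ultimately show ?thesis
    by (metis mult_le_one mult.right_neutral mult_mono not_le mult_strict_mono' less_eq_real_def zero_le_one)
qed

lemma exterior_map_Ad_inverse:
  assumes g: "g \<in> carrier G" and x: "x \<in> exterior_power k"
  shows "exterior_map (Ad G U \<phi> (inv g)) (exterior_map (Ad G U \<phi> g) x) = x"
proof -
  have gi: "inv g \<in> carrier G" using g by simp
  note lin = bounded_linear_Ad[OF g, THEN bounded_linear.linear]
    bounded_linear_Ad[OF gi, THEN bounded_linear.linear]
  have "(exterior_map (Ad G U \<phi> (inv g)) \<circ> exterior_map (Ad G U \<phi> g)) x = id x"
  proof (rule linear_eq_on_span[where B = "pure_wedges k" and g = id and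
        f = "exterior_map (Ad G U \<phi> (inv g)) \<circ> exterior_map (Ad G U \<phi> g)"])
    show "x \<in> span (pure_wedges k)" using x by (simp add: exterior_power_def)
    show "linear (exterior_map (Ad G U \<phi> (inv g)) \<circ> exterior_map (Ad G U \<phi> g))" "linear id"
      by (auto intro!: linear_compose linear_exterior_map linear_id)
    fix y :: "'a multivector" assume "y \<in> pure_wedges k"
    then obtain vs where y: "y = wedge vs" by (auto simp: pure_wedges_def)
    show "(exterior_map (Ad G U \<phi> (inv g)) \<circ> exterior_map (Ad G U \<phi> g)) y = id y"
      using Ad_inverse(2)[OF g] by (simp add: y exterior_map_wedge lin)
  qed
  then show ?thesis by simp
qed

lemma exterior_map_Ad_mult:
  assumes "g \<in> carrier G" "h \<in> carrier G"
  shows "exterior_map (Ad G U \<phi> (g \<otimes> h)) (wedge vs) =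
    exterior_map (Ad G U \<phi> g) (exterior_map (Ad G U \<phi> h) (wedge vs))"
  using assms bounded_linear_Ad[THEN bounded_linear.linear]
  by (simp add: exterior_map_wedge Ad_mult[OF assms] linear_compose)

end

section \<open>The renewal measure\<close>

lemma excursion_length_sum:
  "(skip_excursion e ^^ m) \<omega> = (\<lambda>i. \<omega> ((\<Sum>j<m. length (excursion e j \<omega>)) + i))"
proof (induction m)
  case (Suc m)
  have "(skip_excursion e ^^ Suc m) \<omega> =
      (\<lambda>i. (skip_excursion e ^^ m) \<omega> (length (excursion e m \<omega>) + i))"
    by (simp add: skip_excursion_def[of e "(skip_excursion e ^^ m) \<omega>"] excursion_def)
  then show ?case unfolding Suc by (simp add: add.assoc)
qed simp

lemma excursion_eq_map:
  "excursion e m \<omega> =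
    map (\<lambda>i. \<omega> ((\<Sum>j<m. length (excursion e j \<omega>)) + i)) [0..<length (excursion e m \<omega>)]"
  using first_excursion_eq_map[of e "(skip_excursion e ^^ m) \<omega>"]
  unfolding excursion_def[of e m \<omega>, symmetric]
  unfolding excursion_length_sum .

lemma AE_excursions_iff:
  fixes K :: "'e::countable \<Rightarrow> 'e pmf"
  assumes "markov_recurrent K"
    and P: "{w. P w} \<in> sets (PiM UNIV (\<lambda>_. count_space UNIV))"
  shows "(AE w in PiM UNIV (\<lambda>_. excursion_law K e). P w) \<longleftrightarrow>
    (AE \<omega> in markov_measure K e. P (\<lambda>i. excursion e i \<omega>))"
proof -
  have meas: "(\<lambda>\<omega> i. excursion e i \<omega>) \<in> markov_measure K e \<rightarrow>\<^sub>M PiM UNIV (\<lambda>_. count_space UNIV)"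
    unfolding measurable_markov_cong by (rule measurable_excursions)
  show ?thesis
    unfolding distr_excursions[OF assms(1), symmetric]
    by (rule AE_distr_iff[OF meas]) (use P in \<open>simp add: space_PiM\<close>)
qed

lemma AE_excursionsD:
  assumes "markov_recurrent K" "AE w in PiM UNIV (\<lambda>_. excursion_law K e). P w"
  shows "AE \<omega> in markov_measure K e. P (\<lambda>i. excursion e i \<omega>)"
proof -
  have "AE w in distr (markov_measure K e) (PiM UNIV (\<lambda>_. count_space UNIV)) (\<lambda>\<omega> i. excursion e i \<omega>). P w"
    using assms(2) by (simp only: distr_excursions[OF assms(1)])
  then show ?thesis
    by (rule AE_distrD[rotated]) (unfold measurable_markov_cong, rule measurable_excursions)
qed

lemma AE_excursions:
  assumes "markov_recurrent K"
  shows "AE \<omega> in markov_measure K e. \<forall>i. excursion e i \<omega> \<in> excursion_words e"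
  using AE_excursionsD[OF assms AE_PiM_excursion_words[OF assms]] .

lemma integrable_excursion_length:
  assumes "positive_recurrent K"
  shows "integrable (excursion_law K e) (\<lambda>w. real (length w))"
proof (rule integrableI_nonneg)
  show "(\<lambda>w. real (length w)) \<in> borel_measurable (excursion_law K e)"
    by (simp add: excursion_law_def)
  have "(\<integral>\<^sup>+w. ennreal (real (length w)) \<partial>excursion_law K e) =
      (\<integral>\<^sup>+\<omega>. ennreal (real (length (first_excursion e \<omega>))) \<partial>markov_measure K e)"
    unfolding excursion_law_def by (rule nn_integral_distr[OF measurable_first_excursion_markov]) simp
  also have "\<dots> \<le> (\<integral>\<^sup>+\<omega>. ennreal_of_enat (return_time e \<omega>) \<partial>markov_measure K e)"
  proof (rule nn_integral_mono)
    fix \<omega>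
    show "ennreal (real (length (first_excursion e \<omega>))) \<le> ennreal_of_enat (return_time e \<omega>)"
      by (cases "return_time e \<omega>") (simp_all add: first_excursion_def ennreal_of_nat_eq_real_of_nat)
  qed
  also have "\<dots> < \<infinity>" using assms by (simp add: positive_recurrent_def)
  finally show "(\<integral>\<^sup>+w. ennreal (real (length w)) \<partial>excursion_law K e) < \<infinity>" .
qed auto

lemma integrable_excursion_sum:
  fixes K :: "'e::countable \<Rightarrow> 'e pmf" and f :: "'e \<Rightarrow> real"
  assumes st: "stationary K \<pi>" and irr: "markov_irreducible K"
    and f: "\<And>x. 0 \<le> f x" "(\<lambda>x. f x * pmf \<pi> x) summable_on UNIV"
  shows "integrable (excursion_law K e) (\<lambda>w. \<Sum>x\<leftarrow>w. f x)"
proof (rule integrableI_nonneg)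
  show "(\<lambda>w. \<Sum>x\<leftarrow>w. f x) \<in> borel_measurable (excursion_law K e)"
    by (simp add: excursion_law_def)
  show "AE w in excursion_law K e. 0 \<le> (\<Sum>x\<leftarrow>w. f x)"
    using f(1) by (intro AE_I2 sum_list_nonneg) auto
  have "(\<lambda>x. norm (f x * pmf \<pi> x)) summable_on UNIV"
    using f by (simp add: abs_mult)
  then have "Infinite_Set_Sum.abs_summable_on (\<lambda>x. f x * pmf \<pi> x) UNIV"
    by (rule abs_summable_equivalent[THEN iffD1])
  then have "integrable (count_space UNIV) (\<lambda>x. f x * pmf \<pi> x)"
    by (simp add: Infinite_Set_Sum.abs_summable_on_def)
  then have "(\<integral>\<^sup>+x. ennreal (norm (f x * pmf \<pi> x)) \<partial>count_space UNIV) < \<infinity>"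
    by (simp add: integrable_iff_bounded)
  also have "(\<integral>\<^sup>+x. ennreal (norm (f x * pmf \<pi> x)) \<partial>count_space UNIV) = (\<integral>\<^sup>+x. ennreal (f x) \<partial>measure_pmf \<pi>)"
    using f(1) by (subst nn_integral_measure_pmf)
      (auto intro!: nn_integral_cong simp: ennreal_mult'[symmetric] abs_mult mult.commute)
  finally have fin: "(\<integral>\<^sup>+x. ennreal (f x) \<partial>measure_pmf \<pi>) < \<infinity>" .
  have sum: "ennreal (\<Sum>x\<leftarrow>w. f x) = (\<Sum>x\<leftarrow>w. ennreal (f x))" for w
  proof (induction w)
    case (Cons x w)
    have "0 \<le> (\<Sum>x\<leftarrow>w. f x)" using f(1) by (intro sum_list_nonneg) auto
    with Cons f(1)[of x] show ?case by simp
  qed simp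
  have "(\<integral>\<^sup>+w. ennreal (\<Sum>x\<leftarrow>w. f x) \<partial>excursion_law K e) * ennreal (pmf \<pi> e) < \<infinity>"
    unfolding sum using nn_integral_excursion_law_le[OF st] fin by (rule le_less_trans)
  moreover have "0 < ennreal (pmf \<pi> e)"
    using stationary_pos[OF st irr] by simp
  ultimately show "(\<integral>\<^sup>+w. ennreal (\<Sum>x\<leftarrow>w. f x) \<partial>excursion_law K e) < \<infinity>"
    by (auto simp: ennreal_mult_less_top)
qed

context group
begin

lemma left_prod_closed: "(\<And>i. b i \<in> carrier G) \<Longrightarrow> left_prod G b n \<in> carrier G"
  by (induction n) auto

lemma left_prod_add:
  assumes "\<And>i. b i \<in> carrier G"
  shows "left_prod G b (m + n) = left_prod G (\<lambda>i. b (m + i)) n \<otimes> left_prod G b m"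
  using assms by (induction n) (auto simp: left_prod_closed m_assoc)

lemma left_prod_cong: "(\<And>i. i < n \<Longrightarrow> b i = b' i) \<Longrightarrow> left_prod G b n = left_prod G b' n"
  by (induction n) auto

end

definition word_prod :: "('g, 'm) monoid_scheme \<Rightarrow> ('e \<Rightarrow> 'g) \<Rightarrow> 'e list \<Rightarrow> 'g" where
  "word_prod G c w = left_prod G (\<lambda>i. c (w ! i)) (length w)"

lemma (in group) word_prod_map:
  "word_prod G c (map \<omega> [0..<n]) = left_prod G (\<lambda>i. c (\<omega> i)) n"
  unfolding word_prod_def by (simp, intro left_prod_cong) simp

lemma (in group) left_prod_excursions:
  assumes c: "\<And>x. c x \<in> carrier G"
  shows "left_prod G (\<lambda>i. word_prod G c (excursion e i \<omega>)) m =
    left_prod G (\<lambda>i. c (\<omega> i)) (\<Sum>i<m. length (excursion e i \<omega>))"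
proof (induction m)
  case (Suc m)
  have "word_prod G c (excursion e m \<omega>) =
      left_prod G (\<lambda>i. c (\<omega> ((\<Sum>j<m. length (excursion e j \<omega>)) + i))) (length (excursion e m \<omega>))"
    by (subst excursion_eq_map) (rule word_prod_map)
  with Suc show ?case
    using left_prod_add[of "\<lambda>i. c (\<omega> i)", OF c] by simp
qed simp

lemma space_borel_of: "space (borel_of X) = topspace X"
  by (simp add: borel_of_def space_measure_of_conv)

lemma sets_borel_of_singleton:
  assumes "Hausdorff_space X" "x \<in> topspace X"
  shows "{x} \<in> sets (borel_of X)"
proof -
  have sub: "{U. openin X U} \<subseteq> Pow (topspace X)"
    using openin_subset by auto
  have "closedin X {x}"
    by (rule closedin_t1_singleton[OF Hausdorff_imp_t1_space[OF assms(1)] assms(2)])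
  then have "openin X (topspace X - {x})" by (simp add: closedin_def)
  then have "topspace X - {x} \<in> sets (borel_of X)"
    unfolding borel_of_def using sub by (simp add: sets_measure_of)
  then have "space (borel_of X) - (topspace X - {x}) \<in> sets (borel_of X)"
    by (rule sets.compl_sets)
  then show ?thesis using assms(2) by (simp add: space_borel_of Diff_Diff_Int)
qed

context lie_group
begin

interpretation G: group G by (rule group)

lemma word_prod_closed: "(\<And>x. c x \<in> carrier G) \<Longrightarrow> word_prod G c w \<in> carrier G"
  unfolding word_prod_def by (rule G.left_prod_closed)

lemma measurable_word_prod:
  assumes "\<And>x. c x \<in> carrier G"
  shows "word_prod G c \<in> count_space UNIV \<rightarrow>\<^sub>M borel_of T"
  using word_prod_closed[of c, OF assms] by (simp add: space_borel_of topspace)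

lemma renewal_measure_eq:
  fixes K :: "'e::countable \<Rightarrow> 'e pmf"
  assumes rec: "markov_recurrent K" and c: "\<And>x. c x \<in> carrier G"
  shows "renewal_measure G T K c e = distr (excursion_law K e) (borel_of T) (word_prod G c)"
proof -
  let ?M = "markov_measure K e"
  have "(\<lambda>\<omega>. word_prod G c (map \<omega> [0..<the_enat (return_time e \<omega>)])) \<in> ?M \<rightarrow>\<^sub>M borel_of T"
    unfolding measurable_markov_cong
    by (rule measurable_compose_countable[where f = "\<lambda>t \<omega>. word_prod G c (map \<omega> [0..<the_enat t])",
          OF measurable_compose[OF measurable_prefix measurable_word_prod[OF c]] measurable_return_time])
  then have meas: "(\<lambda>\<omega>. left_prod G (\<lambda>i. c (\<omega> i)) (the_enat (return_time e \<omega>))) \<in> ?M \<rightarrow>\<^sub>M borel_of T"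
    by (simp only: G.word_prod_map)
  have meas': "(\<lambda>\<omega>. word_prod G c (first_excursion e \<omega>)) \<in> ?M \<rightarrow>\<^sub>M borel_of T"
    by (rule measurable_compose[OF measurable_first_excursion_markov measurable_word_prod[OF c]])
  have "renewal_measure G T K c e = distr ?M (borel_of T) (\<lambda>\<omega>. word_prod G c (first_excursion e \<omega>))"
    unfolding renewal_measure_def
  proof (rule distr_cong_AE[OF refl refl _ meas meas'])
    show "AE \<omega> in ?M. left_prod G (\<lambda>i. c (\<omega> i)) (the_enat (return_time e \<omega>)) =
        word_prod G c (first_excursion e \<omega>)"
      using AE_first_excursion[OF rec]
    proof (rule eventually_mono)
      fix \<omega> assume "first_excursion e \<omega> \<in> excursion_words e"
      then have "first_excursion e \<omega> = map \<omega> [0..<the_enat (return_time e \<omega>)]"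
        by (auto simp: first_excursion_def excursion_words_def split: if_splits)
      then show "left_prod G (\<lambda>i. c (\<omega> i)) (the_enat (return_time e \<omega>)) =
          word_prod G c (first_excursion e \<omega>)"
        by (simp only: G.word_prod_map)
    qed
  qed
  also have "\<dots> = distr (excursion_law K e) (borel_of T) (word_prod G c)"
    unfolding excursion_law_def
    by (simp add: distr_distr[OF measurable_word_prod[OF c] measurable_first_excursion_markov] comp_def)
  finally show ?thesis .
qed

text \<open>
  No regularity of the event \<open>P\<close> in the group variables is needed, since the renewal measure is
  carried by the countable set of the products of words.
\<close>

lemma AE_renewal_measure_iff:
  fixes K :: "'e::countable \<Rightarrow> 'e pmf"
  assumes rec: "markov_recurrent K" and c: "\<And>x. c x \<in> carrier G"
    and P: "{w. P (\<lambda>i. word_prod G c (w i))} \<in> sets (PiM UNIV (\<lambda>_. count_space UNIV))"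
  shows "(AE b in PiM (UNIV :: nat set) (\<lambda>_. renewal_measure G T K c e). P b) \<longleftrightarrow>
    (AE \<omega> in markov_measure K e. P (\<lambda>i. word_prod G c (excursion e i \<omega>)))"
proof -
  let ?q = "excursion_law K e" and ?g = "word_prod G c :: 'e list \<Rightarrow> 'g"
  let ?Q = "PiM (UNIV :: nat set) (\<lambda>_. ?q)" and ?B = "PiM (UNIV :: nat set) (\<lambda>_. borel_of T)"
  have q_sets: "sets ?q = sets (count_space UNIV)"
    by (simp add: excursion_law_def)
  have g: "?g \<in> ?q \<rightarrow>\<^sub>M borel_of T"
    using measurable_word_prod[of c, OF c] by (simp only: measurable_cong_sets[OF q_sets refl])
  have PiM: "PiM UNIV (\<lambda>_::nat. renewal_measure G T K c e) = distr ?Q ?B (\<lambda>w i. ?g (w i))"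
    unfolding renewal_measure_eq[OF rec c] by (rule PiM_distr_seq[OF prob_space_excursion_law g])
  have q_space: "space ?q = UNIV"
    by (simp add: excursion_law_def)
  have map: "(\<lambda>w i. ?g (w i)) \<in> ?Q \<rightarrow>\<^sub>M ?B"
  proof (rule measurable_PiM_single')
    fix i :: nat
    show "(\<lambda>w. ?g (w i)) \<in> ?Q \<rightarrow>\<^sub>M borel_of T"
      by (rule measurable_compose[OF measurable_component_singleton[where i = i and I = UNIV and M = "\<lambda>_. ?q", OF UNIV_I] g])
  qed (use word_prod_closed[of c, OF c] in \<open>auto simp: space_borel_of topspace\<close>)
  have "(AE b in PiM UNIV (\<lambda>_::nat. renewal_measure G T K c e). P b) \<longleftrightarrow> (AE w in ?Q. P (\<lambda>i. ?g (w i)))"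
  proof
    assume "AE b in PiM UNIV (\<lambda>_::nat. renewal_measure G T K c e). P b"
    then show "AE w in ?Q. P (\<lambda>i. ?g (w i))"
      unfolding PiM by (rule AE_distrD[OF map])
  next
    assume *: "AE w in ?Q. P (\<lambda>i. ?g (w i))"
    define R where "R = range ?g"
    define r where "r x = (if x \<in> R then inv_into UNIV ?g x else [])" for x
    have gr: "?g (r x) = x" if "x \<in> R" for x
      using that by (simp add: r_def R_def f_inv_into_f)
    have r_Nil: "r x = []" if "x \<notin> R" for x
      using that by (simp add: r_def)
    have R_sub: "R \<subseteq> carrier G" using word_prod_closed[of c, OF c] by (auto simp: R_def)
    have count: "A \<in> sets (borel_of T)" if "A \<subseteq> R" for A
    proof (rule sets.countable)
      show "{x} \<in> sets (borel_of T)" if "x \<in> A" for x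
        using that \<open>A \<subseteq> R\<close> R_sub by (intro sets_borel_of_singleton Hausdorff) (auto simp: topspace)
      show "countable A"
        using \<open>A \<subseteq> R\<close> by (rule countable_subset) (auto simp: R_def)
    qed
    have r: "r \<in> borel_of T \<rightarrow>\<^sub>M count_space UNIV"
    proof (subst measurable_count_space_eq_countable)
      have "r -` {w} \<inter> space (borel_of T) \<in> sets (borel_of T)" for w
      proof -
        have "r -` {w} \<inter> space (borel_of T) =
            {x \<in> R. r x = w} \<union> (if w = [] then space (borel_of T) - R else {})"
        proof (cases "w = []")
          case True
          then show ?thesis using R_sub r_Nil by (auto simp: space_borel_of topspace)
        next
          case False
          then have "x \<in> R" if "r x = w" for x using that r_Nil[of x] by blast
          with False show ?thesis using R_sub by (auto simp: space_borel_of topspace)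
        qed
        moreover have "{x \<in> R. r x = w} \<in> sets (borel_of T)" "R \<in> sets (borel_of T)"
          by (auto intro: count)
        ultimately show ?thesis by auto
      qed
      then show "r \<in> space (borel_of T) \<rightarrow> UNIV \<and>
          (\<forall>w\<in>UNIV. r -` {w} \<inter> space (borel_of T) \<in> sets (borel_of T))"
        by simp
    qed simp
    have rmap: "(\<lambda>b i. r (b i)) \<in> ?B \<rightarrow>\<^sub>M PiM UNIV (\<lambda>_. count_space UNIV)"
    proof (rule measurable_PiM_single')
      fix i :: nat
      show "(\<lambda>b. r (b i)) \<in> ?B \<rightarrow>\<^sub>M count_space UNIV"
        by (rule measurable_compose[OF measurable_component_singleton[where i = i and I = UNIV and M = "\<lambda>_. borel_of T", OF UNIV_I] r])
    qed simp
    let ?P = "\<lambda>b. (\<forall>i. b i \<in> R) \<and> P (\<lambda>i. ?g (r (b i)))"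
    have "(\<lambda>b i. r (b i)) -` {w. P (\<lambda>i. ?g (w i))} \<inter> space ?B \<in> sets ?B"
      by (rule measurable_sets[OF rmap P])
    moreover have "{b \<in> space ?B. \<forall>i. b i \<in> R} \<in> sets ?B"
    proof -
      have "(\<lambda>b. b i) -` R \<inter> space ?B \<in> sets ?B" for i
        by (rule measurable_sets[OF measurable_component_singleton]) (auto intro: count)
      then have "(\<Inter>i. (\<lambda>b. b i) -` R \<inter> space ?B) \<in> sets ?B"
        by (intro sets.countable_INT) auto
      moreover have "(\<Inter>i. (\<lambda>b. b i) -` R \<inter> space ?B) = {b \<in> space ?B. \<forall>i. b i \<in> R}"
        by auto
      ultimately show ?thesis by simp
    qed
    ultimately have "((\<lambda>b i. r (b i)) -` {w. P (\<lambda>i. ?g (w i))} \<inter> space ?B) \<inter>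
        {b \<in> space ?B. \<forall>i. b i \<in> R} \<in> sets ?B"
      by (rule sets.Int)
    moreover have "((\<lambda>b i. r (b i)) -` {w. P (\<lambda>i. ?g (w i))} \<inter> space ?B) \<inter>
        {b \<in> space ?B. \<forall>i. b i \<in> R} = {b \<in> space ?B. ?P b}"
      by auto
    ultimately have meas: "{b \<in> space ?B. ?P b} \<in> sets ?B" by simp
    have "?g w \<in> R" for w by (simp add: R_def)
    then have "AE w in ?Q. ?P (\<lambda>i. ?g (w i))"
      using * by (simp add: gr)
    then have "AE b in PiM UNIV (\<lambda>_::nat. renewal_measure G T K c e). ?P b"
      unfolding PiM using AE_distr_iff[OF map meas] by blast
    then show "AE b in PiM UNIV (\<lambda>_::nat. renewal_measure G T K c e). P b"
    proof (rule eventually_mono)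
      fix b assume b: "?P b"
      then have "(\<lambda>i. ?g (r (b i))) = b" using gr by auto
      with b show "P b" by simp
    qed
  qed
  also have "\<dots> \<longleftrightarrow> (AE \<omega> in markov_measure K e. P (\<lambda>i. ?g (excursion e i \<omega>)))"
    by (rule AE_excursions_iff[OF rec P])
  finally show ?thesis .
qed

end

section \<open>Expansion along excursions\<close>

lemma excursion_words_length: "w \<in> excursion_words e \<Longrightarrow> 1 \<le> length w"
  by (auto simp: excursion_words_def)

lemma wedge_growth_pos_iff:
  "0 < wedge_growth G U \<phi> nrm k b v \<longleftrightarrow>
    (\<exists>r>0. \<forall>\<^sub>F n in sequentially.
      r * real n \<le> ln (nrm k (exterior_map (Ad G U \<phi> (left_prod G b n)) v)))"
  unfolding wedge_growth_def by (rule liminf_rate_pos_iff)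

lemma (in group) sets_wedge_growth_pos:
  fixes c :: "'e::countable \<Rightarrow> 'a"
  shows "{w. 0 < wedge_growth G U \<phi> nrm k (\<lambda>i. word_prod G c (w i)) v} \<in>
    sets (PiM UNIV (\<lambda>_. count_space UNIV))"
proof -
  let ?M = "PiM UNIV (\<lambda>_::nat. count_space (UNIV :: 'e list set))"
  let ?L = "\<lambda>n p. ereal (1 / real n * ln (nrm k (exterior_map (Ad G U \<phi> p) v)))"
  have "(\<lambda>w. ?L n (left_prod G (\<lambda>i. word_prod G c (w i)) n)) \<in> borel_measurable ?M" for n
  proof -
    have "(\<lambda>w. ?L n (left_prod G (\<lambda>i. word_prod G c (map w [0..<n] ! i)) n)) \<in> borel_measurable ?M"
      by (rule measurable_compose[OF measurable_prefix, of _ _ n]) simp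
    moreover have "left_prod G (\<lambda>i. word_prod G c (map w [0..<n] ! i)) n =
        left_prod G (\<lambda>i. word_prod G c (w i)) n" for w
      by (rule left_prod_cong) simp
    ultimately show ?thesis by simp
  qed
  then have "(\<lambda>w. wedge_growth G U \<phi> nrm k (\<lambda>i. word_prod G c (w i)) v) \<in> borel_measurable ?M"
    unfolding wedge_growth_def by (rule borel_measurable_liminf)
  then have "{w \<in> space ?M. 0 < wedge_growth G U \<phi> nrm k (\<lambda>i. word_prod G c (w i)) v} \<in> sets ?M"
    by (intro borel_measurable_less) auto
  then show ?thesis by (simp add: space_PiM)
qed

context identity_chart
begin

interpretation G: group G by (rule group)

lemma onorm_Ad_inv_left_prod:
  assumes b: "\<And>i. b i \<in> carrier G"
  shows "onorm (Ad G U \<phi> (inv (left_prod G b n))) \<le> (\<Prod>i<n. Ad_size G U \<phi> (b i))"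
proof (induction n)
  case 0
  show ?case using onorm_id_le by (simp add: Ad_one id_def)
next
  case (Suc n)
  have p: "left_prod G b n \<in> carrier G" using b by (rule G.left_prod_closed)
  have "onorm (Ad G U \<phi> (inv (left_prod G b (Suc n)))) =
      onorm (Ad G U \<phi> (inv (left_prod G b n)) \<circ> Ad G U \<phi> (inv (b n)))"
    using p b by (simp add: G.inv_mult_group Ad_mult)
  also have "\<dots> \<le> onorm (Ad G U \<phi> (inv (left_prod G b n))) * onorm (Ad G U \<phi> (inv (b n)))"
    using p b by (intro onorm_compose bounded_linear_Ad) auto
  also have "\<dots> \<le> (\<Prod>i<n. Ad_size G U \<phi> (b i)) * Ad_size G U \<phi> (b n)"
  proof (rule mult_mono[OF Suc onorm_Ad_inv_le])
    show "0 \<le> onorm (Ad G U \<phi> (inv (b n)))"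
      using b by (intro onorm_pos_le bounded_linear_Ad) simp
    have "0 \<le> onorm (Ad G U \<phi> (inv (left_prod G b n)))"
      using p by (intro onorm_pos_le bounded_linear_Ad) simp
    with Suc show "0 \<le> (\<Prod>i<n. Ad_size G U \<phi> (b i))" by linarith
  qed (rule b)
  finally show ?case by simp
qed

context
  fixes nrm :: "nat \<Rightarrow> 'a multivector \<Rightarrow> real"
  assumes nrm: "\<And>k. norm_on (exterior_power k) (nrm k)"
begin

lemma norm_Ad_wedge_pos:
  assumes v: "v \<in> pure_wedges k - {0}" and g: "g \<in> carrier G"
  shows "exterior_map (Ad G U \<phi> g) v \<in> exterior_power k"
    and "0 < nrm k (exterior_map (Ad G U \<phi> g) v)"
proof -
  obtain vs where vs: "v = wedge vs" "length vs = k"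
    using v by (auto simp: pure_wedges_def)
  show in_ext: "exterior_map (Ad G U \<phi> g) v \<in> exterior_power k"
    using vs by (simp add: exterior_map_wedge bounded_linear_Ad[OF g, THEN bounded_linear.linear]
        wedge_in_exterior_power)
  have "exterior_map (Ad G U \<phi> (inv g)) (exterior_map (Ad G U \<phi> g) v) = v"
    using vs by (intro exterior_map_Ad_inverse[where k = k] g) (simp add: wedge_in_exterior_power)
  then have "exterior_map (Ad G U \<phi> g) v \<noteq> 0"
    using v linear_0[OF linear_exterior_map, of "Ad G U \<phi> (inv g)"] by auto
  then show "0 < nrm k (exterior_map (Ad G U \<phi> g) v)"
    using nrm[of k] in_ext by (auto simp: norm_on_def less_le)
qed

lemma log_growth_gap:
  assumes nontrivial: "\<exists>u::'a. u \<noteq> 0"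
  shows "\<exists>D. \<forall>v\<in>pure_wedges k - {0}. \<forall>p\<in>carrier G. \<forall>b n. (\<forall>i. b i \<in> carrier G) \<longrightarrow>
    ln (nrm k (exterior_map (Ad G U \<phi> p) v)) \<le>
      ln (nrm k (exterior_map (Ad G U \<phi> (left_prod G b n \<otimes> p)) v)) + D +
      real k * (\<Sum>i<n. ln (Ad_size G U \<phi> (b i)))"
proof -
  obtain C where C: "0 < C" "\<And>L x. bounded_linear L \<Longrightarrow> x \<in> exterior_power k \<Longrightarrow>
      nrm k (exterior_map L x) \<le> C * onorm L ^ k * nrm k x"
    using norm_exterior_map_bound[OF finite_dim nrm, of k] by blast
  show ?thesis
  proof (intro exI[of _ "ln C"] ballI allI impI)
    fix v :: "'a multivector" and p and b :: "nat \<Rightarrow> 'g" and n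
    assume v: "v \<in> pure_wedges k - {0}" and p: "p \<in> carrier G" and b: "\<forall>i. b i \<in> carrier G"
    let ?h = "left_prod G b n" and ?N = "\<lambda>g. nrm k (exterior_map (Ad G U \<phi> g) v)"
    let ?S = "\<Prod>i<n. Ad_size G U \<phi> (b i)"
    have h: "?h \<in> carrier G" using b by (intro G.left_prod_closed) auto
    have hp: "?h \<otimes> p \<in> carrier G" using h p by simp
    have size: "1 \<le> Ad_size G U \<phi> (b i)" for i
      using nontrivial b Ad_size_ge_1[of "b i"] by blast
    then have size0: "0 < Ad_size G U \<phi> (b i)" for i
      by (rule less_le_trans[OF zero_less_one])
    then have S: "0 < ?S" by (intro prod_pos)
    then have Sk: "0 < ?S ^ k" by (rule zero_less_power)
    obtain vs where vs: "v = wedge vs" using v by (auto simp: pure_wedges_def)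
    have "inv ?h \<otimes> (?h \<otimes> p) = p"
      using h p by (simp add: G.m_assoc[symmetric])
    then have "exterior_map (Ad G U \<phi> p) v =
        exterior_map (Ad G U \<phi> (inv ?h)) (exterior_map (Ad G U \<phi> (?h \<otimes> p)) v)"
      using exterior_map_Ad_mult[of "inv ?h" "?h \<otimes> p" vs] h hp by (simp add: vs)
    then have "?N p \<le> C * onorm (Ad G U \<phi> (inv ?h)) ^ k * ?N (?h \<otimes> p)"
      using C(2)[of "Ad G U \<phi> (inv ?h)"] h hp bounded_linear_Ad[of "inv ?h"]
        norm_Ad_wedge_pos(1)[OF v hp] by simp
    also have "\<dots> \<le> C * ?S ^ k * ?N (?h \<otimes> p)"
    proof (intro mult_right_mono mult_left_mono power_mono)
      show "onorm (Ad G U \<phi> (inv ?h)) \<le> ?S"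
        using b by (intro onorm_Ad_inv_left_prod) auto
      show "0 \<le> onorm (Ad G U \<phi> (inv ?h))"
        using h by (intro onorm_pos_le bounded_linear_Ad) simp
    qed (use C(1) norm_Ad_wedge_pos(2)[OF v hp] in auto)
    finally have "ln (?N p) \<le> ln (C * ?S ^ k * ?N (?h \<otimes> p))"
      using norm_Ad_wedge_pos(2)[OF v p] by (intro ln_mono) auto
    also have "\<dots> = ln C + real k * ln ?S + ln (?N (?h \<otimes> p))"
      unfolding ln_realpow[of ?S, symmetric] using C(1) Sk norm_Ad_wedge_pos(2)[OF v hp]
      by (simp only: ln_mult_pos mult_pos_pos)
    also have "ln ?S = (\<Sum>i<n. ln (Ad_size G U \<phi> (b i)))"
    proof (rule ln_prod)
      show "Ad_size G U \<phi> (b i) \<noteq> 0" for i using size0[of i] by simp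
    qed simp
    finally show "ln (?N p) \<le> ln (?N (?h \<otimes> p)) + ln C + real k * (\<Sum>i<n. ln (Ad_size G U \<phi> (b i)))"
      by simp
  qed
qed

lemma growth_along_excursions:
  assumes c: "\<And>x. c x \<in> carrier G" and exc: "\<And>i. excursion e i \<omega> \<in> excursion_words e"
    and "0 < wedge_growth G U \<phi> nrm k (\<lambda>i. c (\<omega> i)) v"
  shows "0 < wedge_growth G U \<phi> nrm k (\<lambda>i. word_prod G c (excursion e i \<omega>)) v"
proof -
  have "m \<le> (\<Sum>i<m. length (excursion e i \<omega>))" for m
    using sum_mono[of "{..<m}" "\<lambda>_. 1::nat" "\<lambda>i. length (excursion e i \<omega>)"]
      excursion_words_length[OF exc] by simp
  then show ?thesis
    using assms(3) unfolding wedge_growth_pos_iff G.left_prod_excursions[of c, OF c]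
    using linear_growth_subseq[where s = "\<lambda>m. \<Sum>i<m. length (excursion e i \<omega>)"
        and L = "\<lambda>n. ln (nrm k (exterior_map (Ad G U \<phi> (left_prod G (\<lambda>i. c (\<omega> i)) n)) v))"]
    by blast
qed

lemma growth_from_excursions:
  fixes c :: "'e \<Rightarrow> 'g"
  assumes c: "\<And>x. c x \<in> carrier G" and exc: "\<And>i. excursion e i \<omega> \<in> excursion_words e"
    and v: "v \<in> pure_wedges k - {0}" and nontrivial: "\<exists>u::'a. u \<noteq> 0"
    and growth: "0 < wedge_growth G U \<phi> nrm k (\<lambda>i. word_prod G c (excursion e i \<omega>)) v"
    and len: "\<exists>C. \<forall>n. (\<Sum>i<n. real (length (excursion e i \<omega>))) \<le> C * real n"
    and cost: "\<forall>r>0. \<forall>\<^sub>F n in sequentially.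
      (\<Sum>x\<leftarrow>excursion e n \<omega>. ln (Ad_size G U \<phi> (c x))) \<le> r * real n"
  shows "0 < wedge_growth G U \<phi> nrm k (\<lambda>i. c (\<omega> i)) v"
proof -
  let ?s = "\<lambda>m. \<Sum>i<m. length (excursion e i \<omega>)"
  let ?L = "\<lambda>n. ln (nrm k (exterior_map (Ad G U \<phi> (left_prod G (\<lambda>i. c (\<omega> i)) n)) v))"
  let ?l = "\<lambda>x. ln (Ad_size G U \<phi> (c x))"
  let ?Z = "\<lambda>m. real k * (\<Sum>x\<leftarrow>excursion e m \<omega>. ?l x)"
  have l: "0 \<le> ?l x" for x
    using nontrivial c Ad_size_ge_1[of "c x"] by (intro ln_ge_zero) blast
  obtain C where C: "\<And>n. (\<Sum>i<n. real (length (excursion e i \<omega>))) \<le> C * real n"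
    using len by blast
  obtain r where r: "0 < r" "\<forall>\<^sub>F m in sequentially. r * real m \<le> ?L (?s m)"
    using growth unfolding wedge_growth_pos_iff G.left_prod_excursions[of c, OF c] by blast
  obtain D where D: "\<And>p b n. p \<in> carrier G \<Longrightarrow> (\<And>i. b i \<in> carrier G) \<Longrightarrow>
      ln (nrm k (exterior_map (Ad G U \<phi> p) v)) \<le>
        ln (nrm k (exterior_map (Ad G U \<phi> (left_prod G b n \<otimes> p)) v)) + D +
        real k * (\<Sum>i<n. ln (Ad_size G U \<phi> (b i)))"
    using log_growth_gap[OF nontrivial, of k] v by blast
  have "\<exists>r>0. \<forall>\<^sub>F n in sequentially. r * real n \<le> ?L n"
  proof (rule linear_growth_interpolate[where s = ?s and Z = ?Z and D = D])
    show "?s m < ?s (Suc m)" for m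
      using excursion_words_length[OF exc, of m] by (simp add: Suc_le_eq)
    show "real (?s m) \<le> C * real m" for m using C[of m] by simp
    show "\<forall>\<^sub>F m in sequentially. ?Z m \<le> r * real m" if "0 < r" for r
    proof (cases "k = 0")
      case False
      then have "\<forall>\<^sub>F n in sequentially. (\<Sum>x\<leftarrow>excursion e n \<omega>. ?l x) \<le> r / real k * real n"
        using cost[rule_format, of "r / real k"] that by simp
      then show ?thesis
        by (rule eventually_mono) (use False in \<open>simp add: field_simps\<close>)
    qed (use that in simp)
    fix m n assume n: "?s m \<le> n" "n < ?s (Suc m)"
    let ?b = "\<lambda>i. c (\<omega> (?s m + i))"
    have "left_prod G (\<lambda>i. c (\<omega> i)) n = left_prod G ?b (n - ?s m) \<otimes> left_prod G (\<lambda>i. c (\<omega> i)) (?s m)"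
      using G.left_prod_add[of "\<lambda>i. c (\<omega> i)" "?s m" "n - ?s m"] c n by simp
    then have "?L (?s m) \<le> ?L n + D + real k * (\<Sum>i<n - ?s m. ?l (\<omega> (?s m + i)))"
      using D[of "left_prod G (\<lambda>i. c (\<omega> i)) (?s m)" ?b "n - ?s m"] c
        G.left_prod_closed[of "\<lambda>i. c (\<omega> i)"] by simp
    also have "(\<Sum>i<n - ?s m. ?l (\<omega> (?s m + i))) \<le>
        (\<Sum>i<length (excursion e m \<omega>). ?l (\<omega> (?s m + i)))"
      using n l by (intro sum_mono2) auto
    also have "\<dots> = (\<Sum>x\<leftarrow>excursion e m \<omega>. ?l x)"
      by (subst (2) excursion_eq_map)
        (simp add: comp_def interv_sum_list_conv_sum_set_nat atLeast0LessThan)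
    finally show "?L (?s m) \<le> ?L n + D + ?Z m"
      by (simp add: mult_left_mono)
  qed (use r in auto)
  then show ?thesis unfolding wedge_growth_pos_iff .
qed

context
  fixes K :: "'e::countable \<Rightarrow> 'e pmf" and c :: "'e \<Rightarrow> 'g" and e :: 'e
  assumes c: "\<And>x. c x \<in> carrier G" and rec: "markov_recurrent K"
begin

lemma uniformly_expanding_renewal_iff:
  "uniformly_expanding G U \<phi> nrm (renewal_measure G T K c e) \<longleftrightarrow>
    (\<forall>k. 1 \<le> k \<and> k \<le> dim (UNIV :: 'a set) - 1 \<longrightarrow> (\<forall>v\<in>pure_wedges k - {0}.
      AE \<omega> in markov_measure K e.
        0 < wedge_growth G U \<phi> nrm k (\<lambda>i. word_prod G c (excursion e i \<omega>)) v))"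
  unfolding uniformly_expanding_def
  by (simp only: AE_renewal_measure_iff[OF rec, of c, OF c G.sets_wedge_growth_pos])

lemma uniformly_expanding_renewal:
  assumes "e_expanding G U \<phi> nrm K c e"
  shows "uniformly_expanding G U \<phi> nrm (renewal_measure G T K c e)"
  unfolding uniformly_expanding_renewal_iff
proof (intro allI impI ballI)
  fix k and v :: "'a multivector" assume k: "1 \<le> k \<and> k \<le> dim (UNIV :: 'a set) - 1" and v: "v \<in> pure_wedges k - {0}"
  have "AE \<omega> in markov_measure K e. 0 < wedge_growth G U \<phi> nrm k (\<lambda>i. c (\<omega> i)) v"
    using assms k v by (simp add: e_expanding_def)
  with AE_excursions[OF rec]
  show "AE \<omega> in markov_measure K e.
      0 < wedge_growth G U \<phi> nrm k (\<lambda>i. word_prod G c (excursion e i \<omega>)) v"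
    by eventually_elim (rule growth_along_excursions[OF c], auto)
qed

lemma e_expanding_of_renewal:
  assumes irr: "markov_irreducible K" and pos: "positive_recurrent K" and st: "stationary K \<pi>"
    and moment: "finite_first_moment G U \<phi> c \<pi>"
    and exp: "uniformly_expanding G U \<phi> nrm (renewal_measure G T K c e)"
  shows "e_expanding G U \<phi> nrm K c e"
  unfolding e_expanding_def
proof (intro allI impI ballI)
  fix k and v :: "'a multivector" assume k: "1 \<le> k \<and> k \<le> dim (UNIV :: 'a set) - 1" and v: "v \<in> pure_wedges k - {0}"
  have nontrivial: "\<exists>u::'a. u \<noteq> 0"
  proof (rule ccontr)
    assume "\<nexists>u::'a. u \<noteq> 0"
    then have zero: "u = 0" for u :: 'a by blast
    obtain vs where vs: "v = wedge vs" "length vs = k" using v by (auto simp: pure_wedges_def)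
    with k obtain w ws where "vs = w # ws" by (cases vs) auto
    then have "v = wedge ([] @ 0 # ws)" using zero[of w] vs by simp
    also have "\<dots> = 0" by (rule linear_0[OF linear_wedge])
    finally show False using v by simp
  qed
  let ?l = "\<lambda>x. ln (Ad_size G U \<phi> (c x))"
  have l: "0 \<le> ?l x" for x
    using nontrivial c Ad_size_ge_1[of "c x"] by (intro ln_ge_zero) blast
  have int: "integrable (excursion_law K e) (\<lambda>w. \<Sum>x\<leftarrow>w. ?l x)"
    using moment by (intro integrable_excursion_sum[OF st irr l]) (simp add: finite_first_moment_def)
  have "AE \<omega> in markov_measure K e. \<exists>C. \<forall>n. (\<Sum>i<n. real (length (excursion e i \<omega>))) \<le> C * real n"
    by (rule AE_excursionsD[OF rec AE_PiM_linear_bound(1)])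
      (auto intro: prob_space_excursion_law integrable_excursion_length pos)
  moreover have "AE \<omega> in markov_measure K e. \<forall>r>0. \<forall>\<^sub>F n in sequentially.
      (\<Sum>x\<leftarrow>excursion e n \<omega>. ?l x) \<le> r * real n"
    by (rule AE_excursionsD[OF rec AE_PiM_linear_bound(2)])
      (auto intro!: prob_space_excursion_law int sum_list_nonneg l)
  moreover have "AE \<omega> in markov_measure K e.
      0 < wedge_growth G U \<phi> nrm k (\<lambda>i. word_prod G c (excursion e i \<omega>)) v"
    using exp k v unfolding uniformly_expanding_renewal_iff by blast
  ultimately show "AE \<omega> in markov_measure K e. 0 < wedge_growth G U \<phi> nrm k (\<lambda>i. c (\<omega> i)) v"
    using AE_excursions[OF rec]
    by eventually_elim (rule growth_from_excursions[OF c _ v nontrivial], auto)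
qed

end

end

end

theorem lemma3p15:
  fixes G :: "('g, 'm) monoid_scheme"
    and T :: "'g topology"
    and A :: "('g set \<times> ('g \<Rightarrow> 'a::real_normed_vector)) set"
    and U :: "'g set" and \<phi> :: "'g \<Rightarrow> 'a"
    and nrm :: "nat \<Rightarrow> 'a multivector \<Rightarrow> real"
    and K :: "'e::countable \<Rightarrow> 'e pmf"
    and c :: "'e \<Rightarrow> 'g"
    and e :: 'e
  assumes "lie_group G T A"
    and "(U, \<phi>) \<in> A" and "\<one>\<^bsub>G\<^esub> \<in> U"
    and "\<And>k. norm_on (exterior_power k) (nrm k)"
    and "\<And>e'. c e' \<in> carrier G"
    and "markov_irreducible K"
    and "markov_recurrent K"
  shows "(e_expanding G U \<phi> nrm K c e \<longrightarrow>
            uniformly_expanding G U \<phi> nrm (renewal_measure G T K c e)) \<and>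
         (positive_recurrent K \<longrightarrow>
            (\<forall>\<pi>. stationary K \<pi> \<and> finite_first_moment G U \<phi> c \<pi> \<longrightarrow>
              (e_expanding G U \<phi> nrm K c e \<longleftrightarrow>
                 uniformly_expanding G U \<phi> nrm (renewal_measure G T K c e))))"
proof -
  interpret lie_group G T A by (rule assms(1))
  interpret identity_chart G T A U \<phi>
    by unfold_locales (rule assms(2), rule assms(3))
  show ?thesis
    using uniformly_expanding_renewal[of nrm c K e] e_expanding_of_renewal[of nrm c K _ e] assms(4-7)
    by blast
qed

end
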